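(* Let $r\ge 2$ and fix a $\mathscr C^r$ expanding map $E:\mathbb{S}^1\to\mathbb{S}^1$ of degree $\ell\ge 2$. For every $\varrho>1$ there is an open dense subset $\mathscr V\subset\mathscr C^r(\mathbb{S}^1)$ (real-valued $\mathscr C^r$ functions with the $\mathscr C^r$ topology) such that $\mathcal N(\tau)<\varrho$ for every $\tau\in\mathscr V$. Consequently, there is a residual subset $\mathscr R\subset\mathscr C^r(\mathbb{S}^1)$ such that $\mathcal N(\tau)=1$ for every $\tau\in\mathscr R$ (i.e. $f_{E,\tau}$ is partially captive for generic $\tau$).
   Context: Let $\mathbb{S}^1=\mathbb{R}/\mathbb{Z}$ and $\mathbb{T}^2=\mathbb{S}^1\times\mathbb{S}^1$. Let $E$ be a $\mathscr C^r$ expanding map of degree $\ell\ge2$ and let $1<\lambda\le\Lambda$ be constants with $\lambda\le E'(x)\le\Lambda$ for all $x\in\mathbb{S}^1$. For $\tau\in\mathscr C^r(\mathbb{S}^1,\mathbb{R})$ let $f=f_{E,\tau}:\mathbb{T}^2\to\mathbb{T}^2$, $f(x,s)=(E(x),\,s+\tau(x)\bmod 1)$, so that $Df(x,s)=\begin{pmatrix}E'(x)&0\\ \tau'(x)&1\end{pmatrix}$. For $R>0$ set $\vartheta_R=R/(\lambda-1)$ and let $\mathscr K_R=\{(\xi,\eta)\in\mathbb{R}^2:|\eta|\le\vartheta_R|\xi|\}$. For $R>\|\tau'\|_\infty$ and $n\ge1$ define $\mathcal N(\tau,R;n)=\sup_{z\in\mathbb{T}^2}\sup_{v}\#\{\zeta\in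 f^{-n}(z): v\in Df^n(\zeta)\mathscr K_R\}$, where $\sup_v$ is over unit vectors $v\in\mathbb{R}^2$. The sequence $n\mapsto\mathcal N(\tau,R;n)$ is submultiplicative, the limit $\mathcal N(\tau)=\lim_{n\to\infty}\mathcal N(\tau,R;n)^{1/n}=\inf_n\mathcal N(\tau,R;n)^{1/n}$ exists and does not depend on the choice of $R>\|\tau'\|_\infty$. $f_{E,\tau}$ is called partially captive if $\mathcal N(\tau)=1$. *)

theory Defs
  imports "HOL-Analysis.Analysis"
begin

text \<open>Functions on the circle S^1 = R/Z are represented by their 1-periodic
lifts R \<Rightarrow> R; the expanding map E by a lift with E(x+1) = E(x) + l.
Points of the torus T^2 are represented by their unique representatives
in [0,1) x [0,1).\<close>

definition Cr :: "nat \<Rightarrow> (real \<Rightarrow> real) \<Rightarrow> bool" where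
  "Cr r g \<longleftrightarrow> (\<forall>k<r. \<forall>x. ((deriv ^^ k) g) differentiable (at x))
                 \<and> continuous_on UNIV ((deriv ^^ r) g)"

definition periodic1 :: "(real \<Rightarrow> real) \<Rightarrow> bool" where
  "periodic1 g \<longleftrightarrow> (\<forall>x. g (x + 1) = g x)"

definition CrS1 :: "nat \<Rightarrow> (real \<Rightarrow> real) set" where
  "CrS1 r = {g. periodic1 g \<and> Cr r g}"

definition Cr_norm :: "nat \<Rightarrow> (real \<Rightarrow> real) \<Rightarrow> real" where
  "Cr_norm r g = (\<Sum>k\<le>r. (SUP x. \<bar>(deriv ^^ k) g x\<bar>))"

definition Cr_dist :: "nat \<Rightarrow> (real \<Rightarrow> real) \<Rightarrow> (real \<Rightarrow> real) \<Rightarrow> real" where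
  "Cr_dist r g h = Cr_norm r (\<lambda>x. g x - h x)"

definition Cr_open :: "nat \<Rightarrow> (real \<Rightarrow> real) set \<Rightarrow> bool" where
  "Cr_open r V \<longleftrightarrow> V \<subseteq> CrS1 r \<and>
     (\<forall>g\<in>V. \<exists>e>0. \<forall>h\<in>CrS1 r. Cr_dist r h g < e \<longrightarrow> h \<in> V)"

definition Cr_dense :: "nat \<Rightarrow> (real \<Rightarrow> real) set \<Rightarrow> bool" where
  "Cr_dense r V \<longleftrightarrow> V \<subseteq> CrS1 r \<and>
     (\<forall>g\<in>CrS1 r. \<forall>e>0. \<exists>h\<in>V. Cr_dist r h g < e)"

definition Cr_residual :: "nat \<Rightarrow> (real \<Rightarrow> real) set \<Rightarrow> bool" where
  "Cr_residual r S \<longleftrightarrow> S \<subseteq> CrS1 r \<and>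
     (\<exists>U :: nat \<Rightarrow> (real \<Rightarrow> real) set.
        (\<forall>n. Cr_open r (U n) \<and> Cr_dense r (U n)) \<and> (\<Inter>n. U n) \<subseteq> S)"

definition expanding :: "nat \<Rightarrow> (real \<Rightarrow> real) \<Rightarrow> nat \<Rightarrow> real \<Rightarrow> real \<Rightarrow> bool" where
  "expanding r E l lam Lam \<longleftrightarrow> Cr r E \<and> (\<forall>x. E (x + 1) = E x + real l) \<and>
     1 < lam \<and> lam \<le> Lam \<and> (\<forall>x. lam \<le> deriv E x \<and> deriv E x \<le> Lam)"

definition torus :: "(real \<times> real) set" where
  "torus = {0..<1} \<times> {0..<1}"

definition skew :: "(real \<Rightarrow> real) \<Rightarrow> (real \<Rightarrow> real) \<Rightarrow> real \<times> real \<Rightarrow> real \<times> real" where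
  "skew E \<tau> z = (frac (E (fst z)), frac (snd z + \<tau> (fst z)))"

definition Dskew :: "(real \<Rightarrow> real) \<Rightarrow> (real \<Rightarrow> real) \<Rightarrow> real \<times> real \<Rightarrow> real^2^2" where
  "Dskew E \<tau> z = vector [vector [deriv E (fst z), 0], vector [deriv \<tau> (fst z), 1]]"

fun Dskew_pow :: "(real \<Rightarrow> real) \<Rightarrow> (real \<Rightarrow> real) \<Rightarrow> nat \<Rightarrow> real \<times> real \<Rightarrow> real^2^2" where
  "Dskew_pow E \<tau> 0 z = mat 1"
| "Dskew_pow E \<tau> (Suc n) z = Dskew_pow E \<tau> n (skew E \<tau> z) ** Dskew E \<tau> z"

definition cone :: "real \<Rightarrow> real \<Rightarrow> (real^2) set" where
  "cone lam R = {w. \<bar>w $ 2\<bar> \<le> (R / (lam - 1)) * \<bar>w $ 1\<bar>}"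

definition NR :: "(real \<Rightarrow> real) \<Rightarrow> real \<Rightarrow> (real \<Rightarrow> real) \<Rightarrow> real \<Rightarrow> nat \<Rightarrow> nat" where
  "NR E lam \<tau> R n = (SUP z\<in>torus. SUP v\<in>{v::real^2. norm v = 1}.
      card {\<zeta>\<in>torus. (skew E \<tau> ^^ n) \<zeta> = z \<and>
                    v \<in> (\<lambda>w. Dskew_pow E \<tau> n \<zeta> *v w) ` cone lam R})"

definition sup_norm_deriv :: "(real \<Rightarrow> real) \<Rightarrow> real" where
  "sup_norm_deriv \<tau> = (SUP x. \<bar>deriv \<tau> x\<bar>)"

text \<open>N(tau) = inf_n N(tau,R;n)^(1/n) (= lim), for the fixed choice
R = ||tau'||_inf + 1 (independent of R > ||tau'||_inf).\<close>
definition Ncap :: "(real \<Rightarrow> real) \<Rightarrow> real \<Rightarrow> (real \<Rightarrow> real) \<Rightarrow> real" where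
  "Ncap E lam \<tau> = (INF n\<in>{1..}. real (NR E lam \<tau> (sup_norm_deriv \<tau> + 1) n) powr (1 / real n))"

end

theory Submission
  imports Defs
begin

text \<open>A vector of slope \<open>v\<close> lies in the image of the cone at a preimage \<open>y\<close> under the \<open>n\<close>-th iterate iff
  \<open>\<bar>v D - T\<bar> \<le> \<theta>\<close>, where \<open>D\<close> is the derivative of the \<open>n\<close>-th iterate of \<open>E\<close> at \<open>y\<close> and
  \<open>T\<close> the twisted Birkhoff sum of \<open>\<tau>'\<close>. For fixed \<open>n\<close> this is an open condition on \<open>\<tau>\<close>, so everything
  rests on density, which is obtained by a counting argument over a finite family of perturbations of \<open>\<tau>\<close>.

  Perturb \<open>\<tau>'\<close> by a random combination of differences of bumps centred on a fine grid. Suppose that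
  \<open>\<sigma> ^ (2 p)\<close> preimages of order \<open>p\<close> survive for some slope. In the tree of preimages one finds a node \<open>z\<close>
  with many surviving descendants which are spread evenly over the preimages of \<open>z\<close> of order \<open>q\<close>, and
  hence many \<open>k\<close>-tuples of survivors such that each member owns a bump that the orbits of its
  successors avoid. The \<open>k\<close> survival conditions are then triangular in the random parameters, and bounded
  distortion gives \<open>\<Sum>1/D \<le> const\<close>, so the expected number of such tuples is at most \<open>(const ^ q) ^ k\<close>. This
  beats the exponential (in \<open>p\<close>) number of choices of \<open>z\<close> and of the slope if \<open>k\<close> is large, since \<open>p\<close> may be
  taken exponentially large in \<open>q\<close>. As the number of bumps is only exponential in \<open>q\<close>, the perturbation can
  be made small in \<open>C\<^sup>r\<close>.\<close>

text \<open>The first moment alone fails: the bound on \<open>\<Sum>1/D\<close> controls the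
  expected number of survivors for one root and one slope, but exponentially many (in
  \<open>p\<close>) of these have to be excluded at once. Passing to \<open>k\<close>-tuples raises
  the gain to the power \<open>k\<close> while the number of roots and slopes stays the same; the
  price is independence, that is, tuples whose members own bumps of their own. Hence the search for
  a node with evenly spread descendants: survivors concentrated over one preimage of order
  \<open>q\<close> would all own the same bump. Half of the exponent of
  \<open>\<sigma> ^ (2 p)\<close> pays for the search, the other half is what the node retains, so
  \<sigma> is the square root of the target rate \<rho>. Bumps enter as differences because a
  derivative on the circle has mean zero; the second bump of a pair is placed where no orbit of the
  tuple passes, so it has no effect there. Bumps sit \<open>q\<close> generations below the node:
  shallow enough that the loss is a power of \<open>Lam ^ q\<close> and not of
  \<open>Lam ^ p\<close>, deep enough that \<open>\<sigma> ^ q\<close> exceeds the number of orbit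
  points to be avoided.\<close>

lemma frac_eqE:
  fixes a b :: real
  assumes "frac a = frac b"
  obtains m :: int where "a = b + of_int m"
proof
  show "a = b + of_int (\<lfloor>a\<rfloor> - \<lfloor>b\<rfloor>)"
    using assms by (simp add: frac_def)
qed

lemma frac_add_of_int': "frac (x + of_int m) = frac (x :: real)"
  by (simp add: frac_def)

lemma periodic_of_int:
  fixes g :: "real \<Rightarrow> 'a"
  assumes "\<And>x. g (x + 1) = g x"
  shows "g (x + of_int m) = g x"
proof -
  have nat: "g (x + of_nat n) = g x" for x n
  proof (induction n)
    case (Suc n)
    have "g (x + of_nat (Suc n)) = g ((x + of_nat n) + 1)" by (simp add: algebra_simps)
    then show ?case using assms Suc by simp
  qed simp
  show ?thesis
  proof (cases m rule: int_cases2)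
    case (nonneg n)
    then show ?thesis using nat by simp
  next
    case (nonpos n)
    then show ?thesis using nat[of "x + of_int m" n] by simp
  qed
qed

section \<open>Iterates of an expanding circle map\<close>

text \<open>Second-order information on the map enters only through the Lipschitz constant
  \<open>L\<close> of \<open>dE\<close>, which controls distortion.\<close>

locale circle_expansion =
  fixes E :: "real \<Rightarrow> real" and dE :: "real \<Rightarrow> real" and l :: nat and lam Lam L :: real
  assumes deg: "E (x + 1) = E x + real l"
    and deriv_E: "(E has_real_derivative dE x) (at x)"
    and dE_periodic: "dE (x + 1) = dE x"
    and lam_gt_1: "1 < lam"
    and dE_ge: "lam \<le> dE x"
    and dE_le: "dE x \<le> Lam"
    and dE_Lipschitz: "\<bar>dE x - dE y\<bar> \<le> L * \<bar>x - y\<bar>"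
    and l_ge_2: "2 \<le> l"
begin

lemma Lam_gt_1: "1 < Lam"
  using lam_gt_1 dE_ge[of 0] dE_le[of 0] by linarith

lemma L_nonneg: "0 \<le> L"
  using dE_Lipschitz[of 1 0] by simp

lemma E_add_int: "E (x + of_int m) = E x + of_int (int l * m)"
proof -
  have "E (x + 1) - real l * (x + 1) = E x - real l * x" for x
    using deg[of x] by (simp add: algebra_simps)
  from periodic_of_int[of "\<lambda>x. E x - real l * x", OF this, of x m]
  show ?thesis by (simp add: algebra_simps)
qed

lemma iter_add_int: "(E ^^ n) (x + of_int m) = (E ^^ n) x + of_int (int l ^ n * m)"
proof (induction n)
  case (Suc n)
  show ?case
    by (simp only: funpow.simps o_apply Suc E_add_int) (simp add: mult.assoc)
qed simp

lemma frac_iter_frac: "frac ((E ^^ n) (frac x)) = frac ((E ^^ n) x)"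
proof -
  have "(E ^^ n) x = (E ^^ n) (frac x + of_int \<lfloor>x\<rfloor>)" by (simp add: frac_def)
  also have "\<dots> = (E ^^ n) (frac x) + of_int (int l ^ n * \<lfloor>x\<rfloor>)" by (rule iter_add_int)
  finally show ?thesis by (simp add: frac_add_of_int' del: of_int_mult of_int_power)
qed

definition jac :: "nat \<Rightarrow> real \<Rightarrow> real" where
  "jac n y = (\<Prod>j<n. dE ((E ^^ j) y))"

text \<open>For \<open>g\<close> the derivative of a function \<tau> this is the derivative of the
  Birkhoff sum of \<tau>, the lower left entry of the Jacobian of the \<open>n\<close>-th iterate of
  the skew product; \<open>jac\<close> is the upper left one.\<close>

definition twist :: "(real \<Rightarrow> real) \<Rightarrow> nat \<Rightarrow> real \<Rightarrow> real" where
  "twist g n y = (\<Sum>j<n. g ((E ^^ j) y) * jac j y)"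

lemma jac_0 [simp]: "jac 0 y = 1"
  by (simp add: jac_def)

lemma twist_0 [simp]: "twist g 0 y = 0"
  by (simp add: twist_def)

lemma jac_Suc: "jac (Suc n) y = jac n (E y) * dE y"
  by (simp add: jac_def prod.lessThan_Suc_shift funpow_swap1 del: prod.lessThan_Suc)

lemma twist_Suc: "twist g (Suc n) y = twist g n (E y) * dE y + g y"
  by (simp add: twist_def sum.lessThan_Suc_shift jac_Suc sum_distrib_right mult.assoc funpow_swap1
      del: sum.lessThan_Suc)

lemma jac_add: "jac (m + n) y = jac m ((E ^^ n) y) * jac n y"
proof (induction n arbitrary: y)
  case (Suc n)
  show ?case by (simp only: add_Suc_right jac_Suc Suc funpow_Suc_right o_apply mult.assoc)
qed simp

lemma twist_add: "twist g (m + n) y = twist g m ((E ^^ n) y) * jac n y + twist g n y"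
proof (induction n arbitrary: y)
  case (Suc n)
  show ?case
    by (simp only: add_Suc_right jac_Suc twist_Suc Suc funpow_Suc_right o_apply) (simp add: algebra_simps)
qed simp

lemma jac_periodic: "jac n (y + of_int m) = jac n y"
proof -
  have "dE ((E ^^ j) (y + of_int m)) = dE ((E ^^ j) y)" for j
    by (simp only: iter_add_int periodic_of_int[of dE, OF dE_periodic])
  then show ?thesis by (simp add: jac_def)
qed

lemma twist_periodic:
  assumes "\<And>x. g (x + 1) = g x"
  shows "twist g n (y + of_int m) = twist g n y"
proof -
  have "g ((E ^^ j) (y + of_int m)) = g ((E ^^ j) y)" for j
    by (simp only: iter_add_int periodic_of_int[of g, OF assms])
  then show ?thesis by (simp add: twist_def jac_periodic)
qed

lemma frac_conv_int: "frac x = x + of_int (- \<lfloor>x\<rfloor>)"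
  by (simp add: frac_def)

lemma jac_frac: "jac n (frac y) = jac n y"
  by (simp only: frac_conv_int jac_periodic)

lemma twist_frac: "(\<And>x. g (x + 1) = g x) \<Longrightarrow> twist g n (frac y) = twist g n y"
  by (simp only: frac_conv_int twist_periodic)

lemma jac_ge_power: "lam ^ n \<le> jac n y"
proof -
  have "(\<Prod>j<n. lam) \<le> jac n y"
    unfolding jac_def using dE_ge lam_gt_1 by (intro prod_mono) auto
  then show ?thesis by simp
qed

lemma jac_ge_1: "1 \<le> jac n y"
  using jac_ge_power[of n y] one_le_power[of lam n] lam_gt_1 by linarith

lemma jac_pos: "0 < jac n y"
  using jac_ge_1[of n y] by linarith

lemma jac_le_power: "jac n y \<le> Lam ^ n"
proof -
  have "0 \<le> dE x" for x using dE_ge[of x] lam_gt_1 by linarith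
  then have "jac n y \<le> (\<Prod>j<n. Lam)"
    unfolding jac_def using dE_le by (intro prod_mono) auto
  then show ?thesis by simp
qed

lemma deriv_iter: "((E ^^ n) has_real_derivative jac n y) (at y)"
proof (induction n arbitrary: y)
  case 0
  then show ?case by (simp add: id_def)
next
  case (Suc n)
  have "((\<lambda>y. (E ^^ n) (E y)) has_real_derivative jac n (E y) * dE y) (at y)"
    by (rule DERIV_chain2[OF Suc deriv_E])
  then show ?case by (simp add: jac_Suc funpow_swap1)
qed

lemma iter_mvt:
  assumes "x < y"
  obtains \<xi> where "x < \<xi>" "\<xi> < y" "(E ^^ n) y - (E ^^ n) x = (y - x) * jac n \<xi>"
  using MVT2[OF assms, of "E ^^ n" "jac n"] deriv_iter by blast

lemma iter_expands: "x \<le> y \<Longrightarrow> lam ^ n * (y - x) \<le> (E ^^ n) y - (E ^^ n) x"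
  and iter_contracts: "x \<le> y \<Longrightarrow> (E ^^ n) y - (E ^^ n) x \<le> Lam ^ n * (y - x)"
proof -
  have "lam ^ n * (y - x) \<le> (E ^^ n) y - (E ^^ n) x \<and> (E ^^ n) y - (E ^^ n) x \<le> Lam ^ n * (y - x)"
    if "x \<le> y"
  proof (cases "x = y")
    case False
    with that have "x < y" by simp
    then obtain \<xi> where "(E ^^ n) y - (E ^^ n) x = (y - x) * jac n \<xi>"
      by (rule iter_mvt[where n = n])
    then show ?thesis
      using jac_ge_power[of n \<xi>] jac_le_power[of n \<xi>] that
      by (simp add: mult.commute[of "y - x"] mult_right_mono)
  qed simp
  then show "x \<le> y \<Longrightarrow> lam ^ n * (y - x) \<le> (E ^^ n) y - (E ^^ n) x"
    and "x \<le> y \<Longrightarrow> (E ^^ n) y - (E ^^ n) x \<le> Lam ^ n * (y - x)" by auto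
qed

lemma iter_mono: "x \<le> y \<Longrightarrow> y - x \<le> (E ^^ n) y - (E ^^ n) x"
  using iter_expands[of x y n] one_le_power[of lam n] lam_gt_1
    mult_right_mono[of 1 "lam ^ n" "y - x"] by simp

lemma iter_less_iff: "(E ^^ n) x < (E ^^ n) y \<longleftrightarrow> x < y"
  using iter_mono[of x y n] iter_mono[of y x n] by linarith

lemma iter_inj: "(E ^^ n) x = (E ^^ n) y \<Longrightarrow> x = y"
  using iter_mono[of x y n] iter_mono[of y x n] by linarith

lemma iter_surj: "\<exists>y. (E ^^ n) y = u"
proof -
  define k where "k = \<lceil>\<bar>u\<bar> + \<bar>(E ^^ n) 0\<bar>\<rceil>"
  have k: "\<bar>u\<bar> + \<bar>(E ^^ n) 0\<bar> \<le> of_int k" "0 \<le> k" unfolding k_def by (rule le_of_int_ceiling, simp)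
  have "(E ^^ n) (of_int (-k)) \<le> u"
    using iter_mono[of "of_int (-k)" 0 n] k by simp
  moreover have "u \<le> (E ^^ n) (of_int k)"
    using iter_mono[of 0 "of_int k" n] k by simp
  moreover have "isCont (E ^^ n) x" for x
    using deriv_iter DERIV_isCont by blast
  ultimately show ?thesis
    using IVT[of "E ^^ n" "of_int (-k)" u "of_int k"] k by (metis of_int_le_iff neg_le_0_iff_le order_trans)
qed

text \<open>Since \<open>dE\<close> is at least 1, its logarithm is \<open>L\<close>-Lipschitz, and
  with \<open>n\<close> steps to go two orbits are at most \<open>lam ^ (- n)\<close> times their
  final distance apart. The geometric series sums to \<open>1 / (lam - 1)\<close>.\<close>

lemma jac_distortion:
  assumes "x \<le> y"
  shows "jac n y \<le> jac n x * exp (L / (lam - 1) * ((E ^^ n) y - (E ^^ n) x))"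
    and "jac n x \<le> jac n y * exp (L / (lam - 1) * ((E ^^ n) y - (E ^^ n) x))"
proof -
  \<comment> \<open>Partial sums instead of the limit: the induction step adds exactly the next term
    of the series.\<close>
  define c where "c n = L * (\<Sum>j<n. (1 / lam) ^ Suc j)" for n
  have c_le: "c n \<le> L / (lam - 1)" for n
  proof -
    have "(\<Sum>j<n. (1 / lam) ^ Suc j) \<le> (\<Sum>j. (1 / lam) ^ Suc j)"
      using lam_gt_1 summable_geometric[of "1/lam"]
      by (intro sum_le_suminf) (auto simp: summable_Suc_iff simp del: power_Suc)
    also have "\<dots> = 1 / lam * (\<Sum>j. (1 / lam) ^ j)"
      using lam_gt_1 summable_geometric[of "1/lam"] suminf_mult[of "\<lambda>j. (1/lam) ^ j" "1/lam"] by simp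
    also have "\<dots> = 1 / lam * (1 / (1 - 1 / lam))"
      using lam_gt_1 by (subst suminf_geometric) auto
    also have "\<dots> = 1 / (lam - 1)"
      using lam_gt_1 by (simp add: field_simps)
    finally show ?thesis unfolding c_def using L_nonneg mult_left_mono by fastforce
  qed
  have dE_dist: "dE x \<le> dE y * exp (L * \<bar>x - y\<bar>)" for x y
  proof -
    have "dE x \<le> dE y + L * \<bar>x - y\<bar>" using dE_Lipschitz[of x y] by linarith
    also have "\<dots> \<le> dE y * (1 + L * \<bar>x - y\<bar>)"
      using dE_ge[of y] lam_gt_1 L_nonneg mult_right_mono[of 1 "dE y" "L * \<bar>x - y\<bar>"]
      by (simp add: algebra_simps)
    also have "\<dots> \<le> dE y * exp (L * \<bar>x - y\<bar>)"
      using dE_ge[of y] lam_gt_1 by (intro mult_left_mono exp_ge_add_one_self) auto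
    finally show ?thesis .
  qed
  have main: "jac n y \<le> jac n x * exp (c n * ((E ^^ n) y - (E ^^ n) x)) \<and>
      jac n x \<le> jac n y * exp (c n * ((E ^^ n) y - (E ^^ n) x))" if "x \<le> y" for x y
    using that
  proof (induction n arbitrary: x y)
    case (Suc n)
    have le: "E x \<le> E y" using iter_mono[OF Suc.prems, of 1] Suc.prems by simp
    define d where "d = (E ^^ Suc n) y - (E ^^ Suc n) x"
    have d: "d = (E ^^ n) (E y) - (E ^^ n) (E x)" by (simp add: d_def funpow_swap1)
    have "lam ^ Suc n * (y - x) \<le> d" unfolding d_def by (rule iter_expands[OF Suc.prems])
    then have "y - x \<le> (1 / lam) ^ Suc n * d"
      using lam_gt_1 by (simp add: field_simps power_one_over)
    then have "L * (y - x) \<le> L * (1 / lam) ^ Suc n * d"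
      using L_nonneg by (simp only: mult.assoc mult_left_mono)
    then have cd: "c n * d + L * (y - x) \<le> c (Suc n) * d"
      by (simp add: c_def algebra_simps)
    have *: "jac (Suc n) u \<le> jac (Suc n) w * exp (c (Suc n) * d)"
      if "jac n (E u) \<le> jac n (E w) * exp (c n * d)" "\<bar>u - w\<bar> = y - x" for u w
    proof -
      have "jac (Suc n) u \<le> (jac n (E w) * exp (c n * d)) * (dE w * exp (L * (y - x)))"
        unfolding jac_Suc using that dE_dist[of u w] jac_pos[of n "E w"] dE_ge[of u] lam_gt_1
        by (intro mult_mono) auto
      also have "\<dots> = jac (Suc n) w * exp (c n * d + L * (y - x))"
        by (simp add: jac_Suc exp_add)
      also have "\<dots> \<le> jac (Suc n) w * exp (c (Suc n) * d)"
        using cd jac_pos[of "Suc n" w] by (intro mult_left_mono) auto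
      finally show ?thesis .
    qed
    show ?case
      unfolding d_def[symmetric]
      using Suc.IH[OF le] Suc.prems by (intro conjI *) (auto simp: d)
  qed (simp add: c_def)
  have "c n * ((E ^^ n) y - (E ^^ n) x) \<le> L / (lam - 1) * ((E ^^ n) y - (E ^^ n) x)"
    using iter_mono[OF assms, of n] assms by (intro mult_right_mono c_le) auto
  then have "jac n u * exp (c n * ((E ^^ n) y - (E ^^ n) x))
      \<le> jac n u * exp (L / (lam - 1) * ((E ^^ n) y - (E ^^ n) x))" for u
    using jac_pos[of n u] by (intro mult_left_mono) auto
  with main[OF assms]
  show "jac n y \<le> jac n x * exp (L / (lam - 1) * ((E ^^ n) y - (E ^^ n) x))"
    and "jac n x \<le> jac n y * exp (L / (lam - 1) * ((E ^^ n) y - (E ^^ n) x))"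
    by (meson order_trans)+
qed

definition preim :: "nat \<Rightarrow> real \<Rightarrow> real set" where
  "preim n x = {y \<in> {0..<1}. frac ((E ^^ n) y) = x}"

text \<open>Shifting \<open>y\<close> by an integer \<open>k\<close> moves its image by
  \<open>l ^ n * k\<close>, so residues modulo \<open>l ^ n\<close> suffice. Consecutive targets
  \<open>x + i\<close> are what makes sums over \<open>preim\<close> telescope.\<close>

lemma preim_subset_image:
  fixes G :: "real \<Rightarrow> real"
  assumes G: "\<And>u. (E ^^ n) (G u) = u"
  shows "preim n x \<subseteq> (\<lambda>i. frac (G (x + real i))) ` {..<l ^ n}"
proof
  fix y assume "y \<in> preim n x"
  then have y: "0 \<le> y" "y < 1" "frac ((E ^^ n) y) = x" by (auto simp: preim_def)
  define m where "m = \<lfloor>(E ^^ n) y\<rfloor>"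
  have m: "(E ^^ n) y = x + of_int m" using y by (auto simp: m_def frac_def)
  define i where "i = nat (m mod int (l ^ n))"
  have pos: "0 < int (l ^ n)" using l_ge_2 by simp
  have i: "int i = m mod int (l ^ n)" "i < l ^ n"
    using pos pos_mod_sign[of "int (l ^ n)" m] pos_mod_bound[of "int (l ^ n)" m]
    by (auto simp: i_def nat_less_iff simp del: of_nat_power)
  define k where "k = - (m div int (l ^ n))"
  have "int i = m + int l ^ n * k"
    using mult_div_mod_eq[of "int (l ^ n)" m] by (simp add: i(1) k_def minus_mult_div_eq_mod)
  then have "x + real i = x + of_int (m + int l ^ n * k)"
    by (metis of_int_of_nat_eq)
  also have "\<dots> = (E ^^ n) (y + of_int k)"
    by (simp only: iter_add_int m of_int_add add.assoc)
  finally have "(E ^^ n) (y + of_int k) = x + real i" by simp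
  then have "G (x + real i) = y + of_int k"
    using iter_inj[of n "y + of_int k" "G (x + real i)"] G by simp
  then have "frac (G (x + real i)) = y"
    using y by (simp add: frac_add_of_int' frac_eq)
  then show "y \<in> (\<lambda>i. frac (G (x + real i))) ` {..<l ^ n}"
    using i by auto
qed

lemma iter_right_inverse: obtains G where "\<And>u. (E ^^ n) (G u) = u"
  using iter_surj[of n] by metis

lemma finite_preim: "finite (preim n x)"
  and card_preim: "card (preim n x) \<le> l ^ n"
proof -
  obtain G where "\<And>u. (E ^^ n) (G u) = u" by (rule iter_right_inverse) blast
  from preim_subset_image[OF this]
  have s: "preim n x \<subseteq> (\<lambda>i. frac (G (x + real i))) ` {..<l ^ n}" .
  show "finite (preim n x)" by (rule finite_subset[OF s]) simp
  show "card (preim n x) \<le> l ^ n"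
    using card_mono[OF _ s] card_image_le[of "{..<l ^ n}" "\<lambda>i. frac (G (x + real i))"] by simp
qed

text \<open>The intervals from \<open>G u\<close> to \<open>G (u + 1)\<close> are mapped onto
  intervals of length 1, so by distortion their lengths are comparable to \<open>1 / jac\<close>;
  \<open>l ^ n\<close> consecutive ones fill one unit of length. This bounds the iterated transfer
  operator on the constant function 1.\<close>

lemma sum_inverse_jac_le:
  "(\<Sum>y\<in>preim n x. 1 / jac n y) \<le> exp (L / (lam - 1))"
proof -
  obtain G where G: "\<And>u. (E ^^ n) (G u) = u" by (rule iter_right_inverse) blast
  let ?C = "exp (L / (lam - 1))"
  have step: "1 / jac n (G u) \<le> ?C * (G (u + 1) - G u)" for u
  proof -
    have less: "G u < G (u + 1)" using iter_less_iff[of n "G u" "G (u + 1)"] by (simp add: G)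
    then obtain \<xi> where \<xi>: "G u < \<xi>" "\<xi> < G (u + 1)"
      "(E ^^ n) (G (u + 1)) - (E ^^ n) (G u) = (G (u + 1) - G u) * jac n \<xi>"
      by (rule iter_mvt)
    have "(E ^^ n) \<xi> - (E ^^ n) (G u) \<le> 1"
      using \<xi>(2) iter_less_iff[of n \<xi> "G (u + 1)"] by (simp add: G)
    then have "exp (L / (lam - 1) * ((E ^^ n) \<xi> - (E ^^ n) (G u))) \<le> ?C"
      using L_nonneg lam_gt_1 mult_left_mono[of "(E ^^ n) \<xi> - (E ^^ n) (G u)" 1 "L / (lam - 1)"] by simp
    then have "jac n \<xi> \<le> jac n (G u) * ?C"
      using jac_distortion(1)[of "G u" \<xi> n] \<xi>(1) jac_pos[of n "G u"]
      by (meson less_imp_le mult_left_mono order_trans)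
    then have "(G (u + 1) - G u) * jac n \<xi> \<le> (G (u + 1) - G u) * (jac n (G u) * ?C)"
      using less by (intro mult_left_mono) auto
    then have "1 \<le> (G (u + 1) - G u) * (jac n (G u) * ?C)" using \<xi>(3) by (simp add: G)
    then show ?thesis using jac_pos[of n "G u"] by (simp add: field_simps)
  qed
  have "(\<Sum>y\<in>preim n x. 1 / jac n y) \<le> (\<Sum>y\<in>(\<lambda>i. frac (G (x + real i))) ` {..<l ^ n}. 1 / jac n y)"
    using preim_subset_image[OF G] jac_pos by (intro sum_mono2) (auto simp: less_imp_le)
  also have "\<dots> \<le> (\<Sum>i<l ^ n. 1 / jac n (frac (G (x + real i))))"
    using sum_image_le[of "{..<l ^ n}" "\<lambda>y. 1 / jac n y" "\<lambda>i. frac (G (x + real i))"] jac_pos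
    by (simp add: less_imp_le o_def)
  also have "\<dots> = (\<Sum>i<l ^ n. 1 / jac n (G (x + real i)))"
    by (simp add: jac_frac)
  also have "\<dots> \<le> (\<Sum>i<l ^ n. ?C * (G (x + real (Suc i)) - G (x + real i)))"
    using step by (intro sum_mono) (simp add: add.assoc[symmetric] add.commute[of 1])
  also have "\<dots> = ?C * (G (x + real (l ^ n)) - G (x + real 0))"
    using sum_lessThan_telescope[of "\<lambda>i. G (x + real i)" "l ^ n"]
    by (simp only: sum_distrib_left[symmetric])
  also have "G (x + real (l ^ n)) = G x + 1"
  proof (rule iter_inj[of n])
    show "(E ^^ n) (G (x + real (l ^ n))) = (E ^^ n) (G x + 1)"
      using iter_add_int[of n "G x" 1] by (simp add: G)
  qed
  finally show ?thesis by simp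
qed

text \<open>The images of two preimages differ by an integer, and the \<open>q\<close>-th iterate
  stretches distances by at most \<open>Lam ^ q\<close>.\<close>

lemma preim_separated:
  assumes "w \<in> preim q z" "w' \<in> preim q z" "\<bar>w - w' - of_int m\<bar> * Lam ^ q < 1"
  shows "w = w'"
proof -
  have "frac ((E ^^ q) w) = frac ((E ^^ q) (w' + of_int m))"
    using assms(1,2) by (simp only: iter_add_int) (simp add: preim_def frac_add_of_int' del: of_int_mult of_int_power)
  then obtain k :: int where k: "(E ^^ q) w = (E ^^ q) (w' + of_int m) + of_int k"
    by (rule frac_eqE)
  have "\<bar>(E ^^ q) w - (E ^^ q) (w' + of_int m)\<bar> \<le> Lam ^ q * \<bar>w - (w' + of_int m)\<bar>"
    using iter_contracts[of w "w' + of_int m" q] iter_contracts[of "w' + of_int m" w q]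
      iter_mono[of w "w' + of_int m" q] iter_mono[of "w' + of_int m" w q]
    by (cases "w \<le> w' + of_int m") auto
  then have "\<bar>of_int k :: real\<bar> < 1" using k assms(3) by (simp add: algebra_simps)
  then have "k = 0" by linarith
  then have "w = w' + of_int m" using k iter_inj[of q] by simp
  then have "frac w = frac w'" by (simp add: frac_add_of_int')
  then show ?thesis using assms(1,2) by (simp add: preim_def frac_eq[THEN iffD2])
qed

lemma twist_linear: "twist (\<lambda>x. g x + c * h x) n y = twist g n y + c * twist h n y"
  by (simp add: twist_def sum.distrib sum_distrib_left algebra_simps)

lemma abs_twist_le:
  assumes "\<And>x. \<bar>g x\<bar> \<le> B"
  shows "\<bar>twist g n y\<bar> \<le> B / (lam - 1) * jac n y"
proof -
  have B: "0 \<le> B" using assms[of 0] by linarith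
  \<comment> \<open>Subtracting 1 makes the bound inductive: the new term, at most \<open>B\<close>,
    is paid for by \<open>B / (lam - 1) * (dE y - 1)\<close>.\<close>
  have "\<bar>twist g n y\<bar> \<le> B / (lam - 1) * (jac n y - 1)"
  proof (induction n arbitrary: y)
    case (Suc n)
    have "\<bar>twist g (Suc n) y\<bar> \<le> \<bar>twist g n (E y)\<bar> * dE y + B"
      using assms[of y] dE_ge[of y] lam_gt_1
      by (auto simp: twist_Suc abs_mult intro!: order_trans[OF abs_triangle_ineq])
    also have "\<dots> \<le> B / (lam - 1) * (jac n (E y) - 1) * dE y + B"
      using Suc[of "E y"] dE_ge[of y] lam_gt_1 by (intro add_right_mono mult_right_mono) auto
    also have "\<dots> = B / (lam - 1) * (jac (Suc n) y - 1) + (B - B / (lam - 1) * (dE y - 1))"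
      unfolding jac_Suc by algebra
    also have "\<dots> \<le> B / (lam - 1) * (jac (Suc n) y - 1)"
      using dE_ge[of y] lam_gt_1 mult_left_mono[of "lam - 1" "dE y - 1" "B / (lam - 1)"] B by simp
    finally show ?case .
  qed simp
  also have "\<dots> \<le> B / (lam - 1) * jac n y"
    using B lam_gt_1 by (intro mult_left_mono) auto
  finally show ?thesis .
qed

section \<open>Preimages surviving at a given slope\<close>

definition surv :: "(real \<Rightarrow> real) \<Rightarrow> real \<Rightarrow> nat \<Rightarrow> real \<Rightarrow> real \<Rightarrow> real set" where
  "surv g \<theta> n x v = {y \<in> preim n x. \<bar>v * jac n y - twist g n y\<bar> \<le> \<theta>}"

lemma surv_subset: "surv g \<theta> n x v \<subseteq> preim n x"
  by (auto simp: surv_def)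

lemma finite_surv: "finite (surv g \<theta> n x v)"
  using finite_subset[OF surv_subset finite_preim] .

lemma card_surv: "card (surv g \<theta> n x v) \<le> l ^ n"
  using card_mono[OF finite_preim surv_subset] card_preim order_trans by blast

text \<open>Confines the relevant slopes to a bounded interval that does not depend on
  \<open>n\<close>, so that a finite grid of slopes will do.\<close>

lemma surv_slope_bound:
  assumes "\<And>x. \<bar>g x\<bar> \<le> B" "0 \<le> \<theta>" "y \<in> surv g \<theta> n x v"
  shows "\<bar>v\<bar> \<le> \<theta> + B / (lam - 1)"
proof -
  have "\<bar>v * jac n y - twist g n y\<bar> \<le> \<theta>" using assms(3) by (simp add: surv_def)
  then have "\<bar>v\<bar> * jac n y \<le> \<theta> + \<bar>twist g n y\<bar>"
    using abs_mult_pos[of "jac n y" v] jac_pos[of n y] by linarith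
  also have "\<dots> \<le> \<theta> * jac n y + B / (lam - 1) * jac n y"
    using abs_twist_le[of g B n y, OF assms(1)] mult_left_mono[OF jac_ge_1[of n y] assms(2)] by simp
  also have "\<dots> = (\<theta> + B / (lam - 1)) * jac n y" by (simp add: algebra_simps)
  finally show ?thesis using jac_pos[of n y] by (simp add: mult_le_cancel_right)
qed

section \<open>Discretising the base point\<close>

text \<open>One step multiplies the Lipschitz constant of \<open>jac\<close> by at most
  \<open>Lam ^ 2 + L\<close>; the extra 1 accounts for the variation of \<open>g\<close> in the step
  for \<open>twist\<close>.\<close>

definition lipK :: real where "lipK = Lam ^ 2 + L + 1"

lemma lipK_ge: "Lam \<le> lipK" "1 \<le> lipK"
proof -
  have "Lam \<le> Lam ^ 2" using Lam_gt_1 self_le_power[of Lam 2] by simp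
  then show "Lam \<le> lipK" "1 \<le> lipK" using L_nonneg Lam_gt_1 by (auto simp: lipK_def)
qed

lemma E_Lipschitz: "\<bar>E x - E y\<bar> \<le> Lam * \<bar>x - y\<bar>"
  using iter_contracts[of x y 1] iter_contracts[of y x 1] iter_mono[of x y 1] iter_mono[of y x 1]
  by (cases "x \<le> y") auto

lemma lipK_power_ge_1: "1 \<le> lipK ^ n"
  using lipK_ge by simp

lemma jac_Lipschitz: "\<bar>jac n x - jac n y\<bar> \<le> lipK ^ n * \<bar>x - y\<bar>"
proof (induction n arbitrary: x y)
  case (Suc n)
  have "\<bar>jac (Suc n) x - jac (Suc n) y\<bar>
      = \<bar>(jac n (E x) - jac n (E y)) * dE x + jac n (E y) * (dE x - dE y)\<bar>"
    by (simp add: jac_Suc algebra_simps)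
  also have "\<dots> \<le> \<bar>jac n (E x) - jac n (E y)\<bar> * \<bar>dE x\<bar> + \<bar>jac n (E y)\<bar> * \<bar>dE x - dE y\<bar>"
    by (metis abs_mult abs_triangle_ineq)
  also have "\<dots> \<le> (lipK ^ n * (Lam * \<bar>x - y\<bar>)) * Lam + lipK ^ n * (L * \<bar>x - y\<bar>)"
  proof (intro add_mono mult_mono)
    show "\<bar>jac n (E x) - jac n (E y)\<bar> \<le> lipK ^ n * (Lam * \<bar>x - y\<bar>)"
      using Suc[of "E x" "E y"] mult_left_mono[OF E_Lipschitz[of x y], of "lipK ^ n"] lipK_power_ge_1[of n]
      by linarith
    show "\<bar>jac n (E y)\<bar> \<le> lipK ^ n"
      using jac_le_power[of n "E y"] jac_pos[of n "E y"] power_mono[of Lam lipK n] lipK_ge Lam_gt_1 by simp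
  qed (use dE_le[of x] dE_ge[of x] lam_gt_1 Lam_gt_1 lipK_ge dE_Lipschitz[of x y] in auto)
  also have "\<dots> = lipK ^ n * (Lam ^ 2 + L) * \<bar>x - y\<bar>" by (simp add: algebra_simps power2_eq_square)
  also have "\<dots> \<le> lipK ^ n * lipK * \<bar>x - y\<bar>"
    using lipK_ge by (intro mult_right_mono mult_left_mono) (auto simp: lipK_def)
  finally show ?case by (simp add: mult.commute)
qed simp

lemma twist_Lipschitz:
  assumes g: "\<And>x. \<bar>g x\<bar> \<le> B" and lip: "\<And>x y. \<bar>g x - g y\<bar> \<le> B * \<bar>x - y\<bar>"
  shows "\<bar>twist g n x - twist g n y\<bar> \<le> B * lipK ^ n * \<bar>x - y\<bar>"
proof -
  have B: "0 \<le> B" using g[of 0] by linarith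
  have pK: "1 \<le> lipK ^ n" for n using lipK_ge by simp
  have bound: "\<bar>twist g n y\<bar> \<le> B * lipK ^ n" for n y
  proof (induction n arbitrary: y)
    case (Suc n)
    have "\<bar>twist g (Suc n) y\<bar> \<le> \<bar>twist g n (E y)\<bar> * \<bar>dE y\<bar> + \<bar>g y\<bar>"
      by (auto simp: twist_Suc abs_mult intro!: order_trans[OF abs_triangle_ineq])
    also have "\<dots> \<le> (B * lipK ^ n) * Lam + B * lipK ^ n"
      using Suc[of "E y"] dE_ge[of y] dE_le[of y] lam_gt_1 B pK[of n] g[of y] lipK_ge
        mult_left_mono[OF pK[of n] B]
      by (intro add_mono mult_mono) auto
    also have "\<dots> = B * lipK ^ n * (Lam + 1)" by (simp add: algebra_simps)
    also have "\<dots> \<le> B * lipK ^ n * lipK"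
      using Lam_gt_1 L_nonneg self_le_power[of Lam 2] B lipK_ge
      by (intro mult_left_mono) (auto simp: lipK_def)
    finally show ?case by (simp add: algebra_simps)
  qed (use B in simp)
  show ?thesis
  proof (induction n arbitrary: x y)
    case (Suc n)
    have "\<bar>twist g (Suc n) x - twist g (Suc n) y\<bar>
        = \<bar>(twist g n (E x) - twist g n (E y)) * dE x + (twist g n (E y) * (dE x - dE y) + (g x - g y))\<bar>"
      by (simp add: twist_Suc algebra_simps)
    also have "\<dots> \<le> \<bar>twist g n (E x) - twist g n (E y)\<bar> * \<bar>dE x\<bar>
        + (\<bar>twist g n (E y)\<bar> * \<bar>dE x - dE y\<bar> + \<bar>g x - g y\<bar>)"
      unfolding abs_mult[symmetric] by linarith
    also have "\<dots> \<le> (B * lipK ^ n * (Lam * \<bar>x - y\<bar>)) * Lam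
        + (B * lipK ^ n * (L * \<bar>x - y\<bar>) + B * lipK ^ n * \<bar>x - y\<bar>)"
    proof (intro add_mono mult_mono)
      show "\<bar>twist g n (E x) - twist g n (E y)\<bar> \<le> B * lipK ^ n * (Lam * \<bar>x - y\<bar>)"
        using Suc[of "E x" "E y"] mult_left_mono[OF E_Lipschitz[of x y], of "B * lipK ^ n"] B
          mult_nonneg_nonneg[of B "lipK ^ n"] pK[of n] by linarith
      show "\<bar>g x - g y\<bar> \<le> B * lipK ^ n * \<bar>x - y\<bar>"
        using lip[of x y] mult_right_mono[OF mult_left_mono[OF pK[of n] B], of "\<bar>x - y\<bar>"] by simp
    qed (use dE_le[of x] dE_ge[of x] lam_gt_1 Lam_gt_1 lipK_ge dE_Lipschitz[of x y] B bound[of n "E y"] in auto)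
    also have "\<dots> = B * lipK ^ Suc n * \<bar>x - y\<bar>"
      by (simp add: lipK_def algebra_simps power2_eq_square)
    finally show ?case .
  qed (use B in simp)
qed

text \<open>Each survivor is transported along its inverse branch from \<open>x\<close> down to the
  nearest grid point on the left. Inverse branches do not increase distances, so the quantity tested
  against \<theta> changes by at most 1, with the slope kept fixed.\<close>

lemma surv_grid:
  assumes per: "\<And>x. g (x + 1) = g x"
    and g: "\<And>x. \<bar>g x\<bar> \<le> B" and lip: "\<And>x y. \<bar>g x - g y\<bar> \<le> B * \<bar>x - y\<bar>"
    and \<theta>: "0 \<le> \<theta>" and J: "(\<theta> + B / (lam - 1) + B) * lipK ^ n \<le> real J" "0 < J"
    and x: "0 \<le> x" "x < 1"
  shows "\<exists>i<J. card (surv g \<theta> n x v) \<le> card (surv g (\<theta> + 1) n (real i / real J) v)"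
proof -
  define i where "i = nat \<lfloor>real J * x\<rfloor>"
  have i0: "real i = of_int \<lfloor>real J * x\<rfloor>" using x by (simp add: i_def)
  have i: "real i \<le> real J * x" "real J * x < real i + 1" unfolding i0 by linarith+
  have iJ: "i < J"
  proof -
    have "real i < real J" using i(1) x J(2) by (smt (verit) mult_less_cancel_left2 of_nat_0_less_iff)
    then show ?thesis by simp
  qed
  define x' where "x' = real i / real J"
  have "x' * real J = real i" using J(2) by (simp add: x'_def)
  then have x': "x' \<le> x" "(x - x') * real J \<le> 1" "0 \<le> x'" "x' < 1"
    using i J(2) iJ by (auto simp: left_diff_distrib mult.commute[of "real J"]) (auto simp: x'_def mult.commute pos_divide_le_eq)
  obtain G where G: "\<And>u. (E ^^ n) (G u) = u" by (rule iter_right_inverse) blast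
  \<comment> \<open>Conjugated by the iterate, \<open>f\<close> is a translation; this gives
    injectivity on the circle.\<close>
  define f where "f y = G ((E ^^ n) y - (x - x'))" for y
  have near: "f y \<le> y" "\<bar>f y - y\<bar> \<le> x - x'" for y
  proof -
    have f: "(E ^^ n) (f y) = (E ^^ n) y - (x - x')" by (simp add: f_def G)
    show "f y \<le> y" "\<bar>f y - y\<bar> \<le> x - x'"
      using iter_mono[of "f y" y n] iter_mono[of y "f y" n] x'(1) unfolding f by linarith+
  qed
  have B: "0 \<le> B" using g[of 0] by linarith
  have inj: "inj_on (\<lambda>y. frac (f y)) {0..<1}"
  proof (rule inj_onI)
    fix y z :: real assume yz: "y \<in> {0..<1}" "z \<in> {0..<1}" "frac (f y) = frac (f z)"
    obtain m :: int where m: "f y = f z + of_int m" using yz(3) by (rule frac_eqE)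
    have "(E ^^ n) (f y) = (E ^^ n) (f z) + of_int (int l ^ n * m)" unfolding m by (rule iter_add_int)
    then have "(E ^^ n) y = (E ^^ n) z + of_int (int l ^ n * m)" by (simp add: f_def G)
    then have "(E ^^ n) y = (E ^^ n) (z + of_int m)" by (simp only: iter_add_int)
    then have "y = z + of_int m" by (rule iter_inj)
    then have "frac y = frac z" by (simp add: frac_add_of_int')
    then show "y = z" using yz by (simp add: frac_eq[THEN iffD2])
  qed
  have sub: "(\<lambda>y. frac (f y)) ` surv g \<theta> n x v \<subseteq> surv g (\<theta> + 1) n x' v"
  proof (intro image_subsetI)
    fix y assume y: "y \<in> surv g \<theta> n x v"
    then have yx: "frac ((E ^^ n) y) = x" and yv: "\<bar>v * jac n y - twist g n y\<bar> \<le> \<theta>"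
      by (auto simp: surv_def preim_def)
    have v: "\<bar>v\<bar> \<le> \<theta> + B / (lam - 1)" by (rule surv_slope_bound[OF g \<theta> y])
    have "(E ^^ n) (f y) = x' + of_int \<lfloor>(E ^^ n) y\<rfloor>"
      using yx by (simp add: f_def G frac_def)
    then have "frac ((E ^^ n) (frac (f y))) = x'"
      using x' by (simp add: frac_iter_frac frac_add_of_int' frac_eq)
    then have mem: "frac (f y) \<in> preim n x'"
      by (auto simp: preim_def frac_ge_0 frac_lt_1)
    have "\<bar>(v * jac n (f y) - twist g n (f y)) - (v * jac n y - twist g n y)\<bar>
        = \<bar>v * (jac n (f y) - jac n y) - (twist g n (f y) - twist g n y)\<bar>"
      by (simp add: algebra_simps)
    also have "\<dots> \<le> \<bar>v\<bar> * \<bar>jac n (f y) - jac n y\<bar> + \<bar>twist g n (f y) - twist g n y\<bar>"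
      by (simp add: abs_mult[symmetric])
    also have "\<dots> \<le> (\<theta> + B / (lam - 1)) * (lipK ^ n * \<bar>f y - y\<bar>) + B * lipK ^ n * \<bar>f y - y\<bar>"
      using v by (intro add_mono mult_mono jac_Lipschitz twist_Lipschitz g lip) auto
    also have "\<dots> = ((\<theta> + B / (lam - 1) + B) * lipK ^ n) * \<bar>f y - y\<bar>"
      by (simp add: algebra_simps)
    also have "\<dots> \<le> real J * (x - x')"
      using near[of y] J by (intro mult_mono) auto
    also have "\<dots> \<le> 1" using x' by (simp add: mult.commute)
    finally have "\<bar>v * jac n (f y) - twist g n (f y)\<bar> \<le> \<theta> + 1" using yv by linarith
    then show "frac (f y) \<in> surv g (\<theta> + 1) n x' v"
      using mem by (simp add: surv_def jac_frac twist_frac[of g, OF per])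
  qed
  have "card (surv g \<theta> n x v) = card ((\<lambda>y. frac (f y)) ` surv g \<theta> n x v)"
    by (rule card_image[symmetric], rule inj_on_subset[OF inj]) (auto simp: surv_def preim_def)
  also have "\<dots> \<le> card (surv g (\<theta> + 1) n x' v)" by (rule card_mono[OF finite_surv sub])
  finally show ?thesis using iJ by (auto simp: x'_def)
qed

section \<open>The tree of preimages\<close>

text \<open>The cocycle identities pull the slope back along the last \<open>p - n\<close> steps
  without changing \<theta>. The new slope depends on \<open>z\<close> alone, so all survivors
  passing through \<open>z\<close> share it.\<close>

lemma surv_descend:
  assumes per: "\<And>x. g (x + 1) = g x" and "n \<le> p" "y \<in> surv g \<theta> p x v"
  defines "z \<equiv> frac ((E ^^ n) y)"
  shows "z \<in> preim (p - n) x"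
    and "y \<in> surv g \<theta> n z (v * jac (p - n) z - twist g (p - n) z)"
proof -
  have p: "p = (p - n) + n" using assms(2) by simp
  have y: "0 \<le> y" "y < 1" "frac ((E ^^ p) y) = x" "\<bar>v * jac p y - twist g p y\<bar> \<le> \<theta>"
    using assms(3) by (auto simp: surv_def preim_def)
  have "frac ((E ^^ (p - n)) z) = frac ((E ^^ ((p - n) + n)) y)"
    unfolding z_def frac_iter_frac by (simp add: funpow_add)
  then show "z \<in> preim (p - n) x"
    using y assms(2) by (simp add: preim_def) (simp add: z_def frac_lt_1)
  have "jac p y = jac (p - n) z * jac n y" "twist g p y = twist g (p - n) z * jac n y + twist g n y"
    unfolding z_def jac_frac twist_frac[of g, OF per] using p jac_add[of "p - n" n y] twist_add[of g "p - n" n y]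
    by auto
  then have "v * jac p y - twist g p y = (v * jac (p - n) z - twist g (p - n) z) * jac n y - twist g n y"
    by (simp add: algebra_simps)
  then show "y \<in> surv g \<theta> n z (v * jac (p - n) z - twist g (p - n) z)"
    using y by (simp add: surv_def preim_def z_def)
qed

text \<open>The node is the lowest one that still carries \<open>\<sigma> ^ (p + n)\<close> descendants; its minimality is what
  spreads its descendants evenly over the generation \<open>q\<close> steps further down.\<close>

lemma spread_node:
  assumes A: "A \<subseteq> preim p x" and \<sigma>: "1 < \<sigma>" and card: "\<sigma> ^ (2 * p) \<le> real (card A)"
    and q: "0 < q" "real (l ^ q) \<le> \<sigma> ^ p"
  obtains n z where "q \<le> n" "n \<le> p"
    "\<sigma> ^ p \<le> real (card {y \<in> A. frac ((E ^^ n) y) = z})"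
    "\<And>w. real (card {y \<in> A. frac ((E ^^ n) y) = z \<and> frac ((E ^^ (n - q)) y) = w}) * \<sigma> ^ q
       \<le> real (card {y \<in> A. frac ((E ^^ n) y) = z})"
proof -
  define N where "N n z = real (card {y \<in> A. frac ((E ^^ n) y) = z})" for n z
  \<comment> \<open>At \<open>n = p\<close> the threshold is the hypothesis on
    \<open>card A\<close>. It drops by \<open>\<sigma> ^ q\<close> over \<open>q\<close> generations
    but never below \<open>\<sigma> ^ p\<close>.\<close>
  define Q where "Q n \<longleftrightarrow> (\<exists>z. \<sigma> ^ (p + n) \<le> N n z)" for n
  have finA: "finite A" using A finite_preim finite_subset by blast
  have "{y \<in> A. frac ((E ^^ p) y) = x} = A" using A by (auto simp: preim_def)
  then have Qp: "Q p" using card unfolding Q_def N_def by (intro exI[of _ x]) (simp add: mult_2)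
  define n where "n = (LEAST n. Q n)"
  have Qn: "Q n" and np: "n \<le> p" unfolding n_def using Qp by (auto intro: LeastI Least_le)
  then obtain z where z: "\<sigma> ^ (p + n) \<le> N n z" by (auto simp: Q_def)
  have "{y \<in> A. frac ((E ^^ n) y) = z} \<subseteq> preim n z" using A by (auto simp: preim_def)
  then have "card {y \<in> A. frac ((E ^^ n) y) = z} \<le> l ^ n"
    using card_mono[OF finite_preim] card_preim order_trans by blast
  then have "N n z \<le> real (l ^ n)" unfolding N_def by (rule of_nat_mono)
  moreover have sp: "\<sigma> ^ p \<le> \<sigma> ^ (p + n)" using \<sigma> by (intro power_increasing) auto
  ultimately have "real (l ^ q) \<le> real (l ^ n)" using q z by linarith
  \<comment> \<open>A node has at most \<open>l ^ n\<close> descendants, so one that carries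
    \<open>\<sigma> ^ p\<close> of them cannot lie within \<open>q\<close> generations of the bottom
    level.\<close>
  then have qn: "q \<le> n" using l_ge_2 by simp
  have "real (card {y \<in> A. frac ((E ^^ n) y) = z \<and> frac ((E ^^ (n - q)) y) = w}) * \<sigma> ^ q \<le> N n z" for w
  proof -
    have "\<not> Q (n - q)" using not_less_Least[of "n - q" Q] qn q by (simp add: n_def)
    then have "N (n - q) w < \<sigma> ^ (p + (n - q))" by (auto simp: Q_def not_le)
    moreover have "real (card {y \<in> A. frac ((E ^^ n) y) = z \<and> frac ((E ^^ (n - q)) y) = w}) \<le> N (n - q) w"
      unfolding N_def using finA by (intro of_nat_mono card_mono) auto
    ultimately have "real (card {y \<in> A. frac ((E ^^ n) y) = z \<and> frac ((E ^^ (n - q)) y) = w}) * \<sigma> ^ q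
        \<le> \<sigma> ^ (p + (n - q)) * \<sigma> ^ q" using \<sigma> by (intro mult_right_mono) auto
    also have "\<dots> = \<sigma> ^ (p + n)" using qn by (simp flip: power_add)
    finally show ?thesis using z by linarith
  qed
  then show ?thesis using that[of n z] qn np z sp unfolding N_def by auto
qed

end

section \<open>Counting perturbations\<close>

text \<open>Conditional probability in counting form: \<open>A\<close> does not depend on the
  coordinate at \<pi>, and on every line in that direction \<open>B\<close> holds with probability
  at most \<open>\<kappa> / G\<close>.\<close>

lemma card_fibre_le:
  fixes G :: nat and \<kappa> :: real
  assumes "finite P" "\<pi> \<in> P"
    and indep: "\<And>t s. t \<in> P \<rightarrow>\<^sub>E {..<G} \<Longrightarrow> s < G \<Longrightarrow> A t \<Longrightarrow> A (t(\<pi> := s))"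
    and fibre: "\<And>t. t \<in> P \<rightarrow>\<^sub>E {..<G} \<Longrightarrow> real (card {s \<in> {..<G}. B (t(\<pi> := s))}) \<le> \<kappa>"
  shows "real (card {t \<in> P \<rightarrow>\<^sub>E {..<G}. A t \<and> B t}) * real G
    \<le> real (card {t \<in> P \<rightarrow>\<^sub>E {..<G}. A t}) * \<kappa>"
proof -
  let ?\<Omega> = "P \<rightarrow>\<^sub>E {..<G}"
  have fin: "finite ?\<Omega>" using assms(1) by (intro finite_PiE) auto
  \<comment> \<open>\<open>F\<close> swaps the coordinate at \<pi> with a spare value and is its own
    inverse. The spare value then remembers the coordinate for which \<open>B\<close> held.\<close>
  define F :: "('a \<Rightarrow> nat) \<times> nat \<Rightarrow> ('a \<Rightarrow> nat) \<times> nat" where "F = (\<lambda>(t, s). (t(\<pi> := s), t \<pi>))"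
  let ?S = "{t \<in> ?\<Omega>. A t \<and> B t} \<times> {..<G}"
  let ?T = "SIGMA t:{t \<in> ?\<Omega>. A t}. {s \<in> {..<G}. B (t(\<pi> := s))}"
  have finT: "finite ?T" using fin by (intro finite_SigmaI) auto
  have inj: "inj_on F ?S"
  proof (rule inj_on_inverseI[where g = "\<lambda>(t, s). (t(\<pi> := s), t \<pi>)"])
  qed (auto simp: F_def)
  have sub: "F ` ?S \<subseteq> ?T"
  proof (intro image_subsetI)
    fix ts assume "ts \<in> ?S"
    then obtain t s where ts: "ts = (t, s)" "t \<in> ?\<Omega>" "A t" "B t" "s < G" by auto
    have "t(\<pi> := s) \<in> ?\<Omega>" using ts assms(2) by (auto simp: PiE_iff extensional_def)
    moreover have "t \<pi> < G" using ts assms(2) by auto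
    ultimately show "F ts \<in> ?T" using ts indep[of t s] by (simp add: F_def)
  qed
  have "card {t \<in> ?\<Omega>. A t \<and> B t} * G = card ?S" by (simp add: card_cartesian_product)
  also have "\<dots> = card (F ` ?S)" by (rule card_image[OF inj, symmetric])
  also have "\<dots> \<le> card ?T" by (rule card_mono[OF finT sub])
  also have "\<dots> = (\<Sum>t\<in>{t \<in> ?\<Omega>. A t}. card {s \<in> {..<G}. B (t(\<pi> := s))})"
    using fin by (intro card_SigmaI) auto
  finally have "real (card {t \<in> ?\<Omega>. A t \<and> B t}) * real G
      \<le> (\<Sum>t\<in>{t \<in> ?\<Omega>. A t}. real (card {s \<in> {..<G}. B (t(\<pi> := s))}))"
    by (simp only: of_nat_mult[symmetric] of_nat_sum[symmetric] of_nat_le_iff)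
  also have "\<dots> \<le> (\<Sum>t\<in>{t \<in> ?\<Omega>. A t}. \<kappa>)" using fibre by (intro sum_mono) auto
  finally show ?thesis by simp
qed

lemma card_affine_window_le:
  fixes a c \<theta> :: real
  assumes "0 < a" "0 \<le> \<theta>"
  shows "real (card {s \<in> {..<G::nat}. \<bar>c - a * real s\<bar> \<le> \<theta>}) \<le> 2 * \<theta> / a + 1"
proof (cases "{s \<in> {..<G}. \<bar>c - a * real s\<bar> \<le> \<theta>} = {}")
  case True
  then show ?thesis using assms by (simp only: card.empty) simp
next
  case False
  let ?S = "{s \<in> {..<G}. \<bar>c - a * real s\<bar> \<le> \<theta>}"
  define m where "m = Min ?S"
  have m: "m \<in> ?S" unfolding m_def using False by (intro Min_in) auto
  define D where "D = nat \<lfloor>2 * \<theta> / a\<rfloor>"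
  have sub: "?S \<subseteq> {m..m + D}"
  proof
    fix s assume s: "s \<in> ?S"
    then have ms: "m \<le> s" unfolding m_def by (intro Min_le) auto
    have "a * (real s - real m) \<le> 2 * \<theta>" using s m by (auto simp: algebra_simps)
    then have "real (s - m) \<le> 2 * \<theta> / a" using assms ms by (simp add: field_simps)
    then have "s - m \<le> D" unfolding D_def by (simp add: le_nat_floor)
    then show "s \<in> {m..m + D}" using ms by auto
  qed
  have "card ?S \<le> D + 1" using card_mono[OF _ sub] by simp
  then have "real (card ?S) \<le> real D + 1" by linarith
  also have "real D \<le> 2 * \<theta> / a" using assms by (simp add: D_def)
  finally show ?thesis by simp
qed

lemma sum_prod_lists:
  fixes f :: "'a \<Rightarrow> real"
  assumes "finite Y"
  shows "(\<Sum>ys | set ys \<subseteq> Y \<and> length ys = k. prod_list (map f ys)) = (\<Sum>y\<in>Y. f y) ^ k"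
proof (induction k)
  case 0
  have "{ys. set ys \<subseteq> Y \<and> length ys = 0} = {[]}" by auto
  then show ?case by simp
next
  case (Suc k)
  let ?L = "\<lambda>k. {ys. set ys \<subseteq> Y \<and> length ys = k}"
  have "(\<Sum>ys\<in>?L (Suc k). prod_list (map f ys))
      = (\<Sum>(y, ys)\<in>Y \<times> ?L k. f y * prod_list (map f ys))"
    by (rule sum.reindex_bij_witness[where i = "\<lambda>(y, ys). y # ys" and j = "\<lambda>ys. (hd ys, tl ys)"])
      (auto simp: length_Suc_conv)
  also have "\<dots> = (\<Sum>y\<in>Y. f y) * (\<Sum>ys\<in>?L k. prod_list (map f ys))"
    by (simp add: sum.cartesian_product[symmetric] sum_product)
  finally show ?case using Suc by simp
qed

text \<open>Lists grow at the head: an entry is tested against those chosen before it, which stand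
  behind it. With freshness as the test, this is the order in which the window conditions are
  triangular.\<close>

fun chained :: "('a \<Rightarrow> 'a list \<Rightarrow> bool) \<Rightarrow> 'a list \<Rightarrow> bool" where
  "chained ok [] \<longleftrightarrow> True"
| "chained ok (y # ys) \<longleftrightarrow> ok y ys \<and> chained ok ys"

lemma card_chained_ge:
  fixes M :: real
  assumes "finite A" "0 \<le> M"
    and "\<And>ys. set ys \<subseteq> A \<Longrightarrow> length ys < k \<Longrightarrow> M \<le> real (card {y \<in> A. ok y ys})"
  shows "M ^ k \<le> real (card {ys. set ys \<subseteq> A \<and> length ys = k \<and> chained ok ys})"
  using assms(3)
proof (induction k)
  case 0
  have "{ys. set ys \<subseteq> A \<and> length ys = 0 \<and> chained ok ys} = {[]}" by auto
  then show ?case by simp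
next
  case (Suc k)
  let ?L = "\<lambda>k. {ys. set ys \<subseteq> A \<and> length ys = k \<and> chained ok ys}"
  have fin: "finite (?L k)" for k
    by (rule finite_subset[OF _ finite_lists_length_eq[OF assms(1), of k]]) auto
  have "M ^ Suc k \<le> real (card (?L k)) * M"
    using Suc assms(2) by (simp add: mult.commute[of M] mult_right_mono)
  also have "\<dots> = (\<Sum>ys\<in>?L k. M)" by simp
  also have "\<dots> \<le> (\<Sum>ys\<in>?L k. real (card {y \<in> A. ok y ys}))"
    using Suc.prems by (intro sum_mono) auto
  also have "\<dots> = real (card (SIGMA ys:?L k. {y \<in> A. ok y ys}))"
    using fin assms(1) by (subst card_SigmaI) auto
  also have "(SIGMA ys:?L k. {y \<in> A. ok y ys}) = (\<lambda>ys. (tl ys, hd ys)) ` ?L (Suc k)"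
  proof (intro set_eqI iffI)
    fix a assume "a \<in> (SIGMA ys:?L k. {y \<in> A. ok y ys})"
    then show "a \<in> (\<lambda>ys. (tl ys, hd ys)) ` ?L (Suc k)"
      by (intro image_eqI[of _ _ "snd a # fst a"]) auto
  qed (auto simp: length_Suc_conv)
  also have "real (card \<dots>) \<le> real (card (?L (Suc k)))"
    using card_image_le[OF fin] by (intro of_nat_mono) 
  finally show ?case .
qed

section \<open>Perturbation by differences of bumps\<close>

text \<open>Roles of the numerical conditions: \<open>N'_Lam\<close> lets a point meet the bumps of
  only one preimage of order \<open>q\<close>; \<open>N'_kp\<close> leaves a bump that no orbit of a
  tuple meets; \<open>kp_\<sigma>\<close> makes at least half of the candidates fresh;
  \<open>l_\<sigma>\<close> keeps the node at least \<open>q\<close> generations above the bottom;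
  \<open>G_Lam\<close> makes the grid of parameters fine enough for every window.\<close>

locale bump_family = circle_expansion +
  fixes g :: "real \<Rightarrow> real" and \<beta> :: "nat \<Rightarrow> real \<Rightarrow> real"
    and N' q p k G :: nat and b \<eta> \<theta> \<sigma> :: real
  assumes g_periodic: "g (x + 1) = g x"
    and \<beta>_periodic: "\<beta> a (x + 1) = \<beta> a x"
    and \<beta>_nonneg: "0 \<le> \<beta> a x"
    and \<beta>_core: "0 \<le> w \<Longrightarrow> w < 1 \<Longrightarrow> b \<le> \<beta> (nat \<lfloor>4 * real N' * w\<rfloor>) w"
    and \<beta>_supp: "\<beta> a x \<noteq> 0 \<Longrightarrow> \<exists>m::int. \<bar>4 * real N' * x - real a - 4 * real N' * of_int m\<bar> < 2"
    and b_pos: "0 < b" and \<eta>_pos: "0 < \<eta>" and \<theta>_nonneg: "0 \<le> \<theta>" and \<sigma>_gt_1: "1 < \<sigma>"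
    and q_pos: "0 < q"
    and N'_Lam: "2 * Lam ^ q \<le> real N'"
    and N'_kp: "k * p < N'"
    and kp_\<sigma>: "2 * (real k * real p) \<le> \<sigma> ^ q"
    and l_\<sigma>: "real (l ^ q) \<le> \<sigma> ^ p"
    and G_Lam: "Lam ^ p \<le> real G"
begin

definition cells :: "(nat \<times> nat) set" where
  "cells = {..<4 * N'} \<times> {..<4 * N'}"

definition params :: "(nat \<times> nat \<Rightarrow> nat) set" where
  "params = cells \<rightarrow>\<^sub>E {..<G}"

text \<open>In the application \<open>g\<close> is the derivative of \<tau> and the \<beta> are
  translates of one bump, so a difference has a periodic primitive and \<open>pert t\<close> is
  again a derivative on the circle. The normalised coefficients lie between 0 and \<eta>.\<close>

definition pert :: "(nat \<times> nat \<Rightarrow> nat) \<Rightarrow> real \<Rightarrow> real" where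
  "pert t x = g x + \<eta> / real G * (\<Sum>\<pi>\<in>cells. real (t \<pi>) * (\<beta> (fst \<pi>) x - \<beta> (snd \<pi>) x))"

lemma finite_cells: "finite cells" by (simp add: cells_def)

lemma G_pos: "0 < real G"
proof -
  have "0 < Lam ^ p" using Lam_gt_1 by simp
  then show ?thesis using G_Lam by linarith
qed

lemma N'_pos: "0 < real N'"
proof -
  have "0 < Lam ^ q" using Lam_gt_1 by simp
  then show ?thesis using N'_Lam by linarith
qed

lemma pert_periodic: "pert t (x + 1) = pert t x"
  by (simp add: pert_def g_periodic \<beta>_periodic)

lemma twist_pert:
  "twist (pert t) n y = twist g n y
    + \<eta> / real G * (\<Sum>\<pi>\<in>cells. real (t \<pi>) * (twist (\<beta> (fst \<pi>)) n y - twist (\<beta> (snd \<pi>)) n y))"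
proof -
  have "(\<Sum>j<n. (\<Sum>\<pi>\<in>cells. real (t \<pi>) * (\<beta> (fst \<pi>) ((E ^^ j) y) - \<beta> (snd \<pi>) ((E ^^ j) y))) * jac j y)
     = (\<Sum>\<pi>\<in>cells. real (t \<pi>) * (twist (\<beta> (fst \<pi>)) n y - twist (\<beta> (snd \<pi>)) n y))"
    unfolding sum_distrib_right twist_def sum_subtractf[symmetric] sum_distrib_left
    by (subst sum.swap) (simp add: algebra_simps)
  moreover have "twist (pert t) n y = twist g n y + \<eta> / real G *
    (\<Sum>j<n. (\<Sum>\<pi>\<in>cells. real (t \<pi>) * (\<beta> (fst \<pi>) ((E ^^ j) y) - \<beta> (snd \<pi>) ((E ^^ j) y))) * jac j y)"
    unfolding twist_def pert_def sum_distrib_left[of "\<eta> / real G" _ "{..<n}"] sum.distrib[symmetric]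
    by (intro sum.cong refl) (simp add: algebra_simps)
  ultimately show ?thesis by simp
qed

text \<open>The index of the bump owned by \<open>y\<close>. It sits at the preimage of order
  \<open>q\<close> of the root through which the orbit of \<open>y\<close> passes, where
  \<open>jac (n - q)\<close> is smaller than \<open>jac n\<close> by a factor of at most
  \<open>Lam ^ q\<close>.\<close>

definition cell :: "nat \<Rightarrow> real \<Rightarrow> nat" where
  "cell n y = nat \<lfloor>4 * real N' * frac ((E ^^ (n - q)) y)\<rfloor>"

text \<open>As the bumps are nonnegative and \<open>jac\<close> is positive, the twist vanishes
  exactly if the orbit of \<open>y'\<close> before time \<open>n\<close> avoids the bump. In this
  form freshness can be inserted directly into \<open>twist_pert\<close>.\<close>

definition fresh :: "nat \<Rightarrow> real \<Rightarrow> real list \<Rightarrow> bool" where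
  "fresh n y ys \<longleftrightarrow> (\<forall>y'\<in>set ys. twist (\<beta> (cell n y)) n y' = 0)"

lemma cell_less: "cell n y < 4 * N'"
proof -
  have "4 * real N' * frac ((E ^^ (n - q)) y) < 4 * real N' * 1"
    using N'_pos frac_lt_1 by (intro mult_strict_left_mono) auto
  then have "\<lfloor>4 * real N' * frac ((E ^^ (n - q)) y)\<rfloor> < int (4 * N')"
    by (simp add: floor_less_iff)
  then show ?thesis unfolding cell_def using N'_pos by linarith
qed

lemma real_cell:
  "real (cell n y) \<le> 4 * real N' * frac ((E ^^ (n - q)) y)"
  "4 * real N' * frac ((E ^^ (n - q)) y) < real (cell n y) + 1"
proof -
  have "0 \<le> 4 * real N' * frac ((E ^^ (n - q)) y)" using frac_ge_0 by simp
  then have "real (cell n y) = of_int \<lfloor>4 * real N' * frac ((E ^^ (n - q)) y)\<rfloor>"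
    unfolding cell_def by simp
  then show "real (cell n y) \<le> 4 * real N' * frac ((E ^^ (n - q)) y)"
    "4 * real N' * frac ((E ^^ (n - q)) y) < real (cell n y) + 1" by linarith+
qed

text \<open>Only the term at time \<open>n - q\<close> is kept; nonnegativity rules out cancellation
  by the others.\<close>

lemma twist_cell_ge:
  assumes "q \<le> n"
  shows "b / Lam ^ q * jac n y \<le> twist (\<beta> (cell n y)) n y"
proof -
  have "b \<le> \<beta> (cell n y) (frac ((E ^^ (n - q)) y))"
    unfolding cell_def by (intro \<beta>_core frac_ge_0 frac_lt_1)
  also have "\<dots> = \<beta> (cell n y) ((E ^^ (n - q)) y)"
    by (simp only: frac_conv_int periodic_of_int[of "\<beta> _", OF \<beta>_periodic])
  finally have b: "b \<le> \<beta> (cell n y) ((E ^^ (n - q)) y)" .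
  have "jac n y = jac q ((E ^^ (n - q)) y) * jac (n - q) y"
    using jac_add[of q "n - q" y] assms by simp
  also have "\<dots> \<le> Lam ^ q * jac (n - q) y"
    using jac_le_power jac_pos by (intro mult_right_mono) (auto simp: less_imp_le)
  finally have j: "jac n y / Lam ^ q \<le> jac (n - q) y"
    using Lam_gt_1 by (simp add: field_simps)
  have "b / Lam ^ q * jac n y = b * (jac n y / Lam ^ q)" by simp
  also have "\<dots> \<le> \<beta> (cell n y) ((E ^^ (n - q)) y) * jac (n - q) y"
    using b j b_pos jac_pos[of n y] Lam_gt_1 by (intro mult_mono) auto
  also have "\<dots> \<le> twist (\<beta> (cell n y)) n y"
    unfolding twist_def using assms q_pos \<beta>_nonneg jac_pos
    by (intro member_le_sum[of "n - q" "{..<n}" "\<lambda>j. \<beta> (cell n y) ((E ^^ j) y) * jac j y"])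
      (auto simp: less_imp_le)
  finally show ?thesis .
qed

text \<open>Of the 2 units of slack, one pays for moving the base point to the grid and one for
  rounding the slope.\<close>

definition window :: "nat \<Rightarrow> real \<Rightarrow> (nat \<times> nat \<Rightarrow> nat) \<Rightarrow> real \<Rightarrow> bool" where
  "window n v t y \<longleftrightarrow> \<bar>v * jac n y - twist (pert t) n y\<bar> \<le> \<theta> + 2"

text \<open>The window length \<open>2 * (\<theta> + 2)\<close> divided by the sensitivity from
  \<open>twist_cell_ge\<close>, normalised by \<open>jac\<close> and \<open>G\<close>; the additive
  1 comes from counting grid points in an interval.\<close>

definition loss :: real where
  "loss = 2 * (\<theta> + 2) * Lam ^ q / (\<eta> * b) + 1"

text \<open>Freshness makes the system of window conditions triangular: the parameter at \<open>(cell n y, c)\<close>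
  moves the condition at \<open>y\<close> and none of the conditions at the points of \<open>ys\<close>.\<close>

lemma card_window_le:
  assumes n: "q \<le> n" "n \<le> p" and c: "c < 4 * N'"
  shows "chained (fresh n) ys \<Longrightarrow> \<forall>y\<in>set ys. twist (\<beta> c) n y = 0 \<Longrightarrow>
    real (card {t \<in> params. \<forall>y\<in>set ys. window n v t y})
      \<le> real (card params) * prod_list (map (\<lambda>y. loss / jac n y) ys)"
proof (induction ys)
  case (Cons y ys)
  \<comment> \<open>Since \<open>\<beta> c\<close> contributes to none of the conditions, varying
    \<open>t \<pi>\<close> acts only through the bump owned by \<open>y\<close>.\<close>
  define \<pi> where "\<pi> = (cell n y, c)"
  have \<pi>: "\<pi> \<in> cells" using cell_less c by (simp add: \<pi>_def cells_def)
  define a where "a = \<eta> / real G * twist (\<beta> (cell n y)) n y"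
  have a_ge: "\<eta> / real G * (b / Lam ^ q * jac n y) \<le> a"
    unfolding a_def using \<eta>_pos G_pos by (intro mult_left_mono twist_cell_ge n) auto
  have a_pos: "0 < a"
    using a_ge \<eta>_pos G_pos b_pos Lam_gt_1 jac_pos[of n y]
    by (smt (verit) divide_pos_pos mult_pos_pos zero_less_power)
  have split: "twist (pert (t(\<pi> := s))) n y'
      = twist (pert (t(\<pi> := 0))) n y'
        + \<eta> / real G * (real s * (twist (\<beta> (cell n y)) n y' - twist (\<beta> c) n y'))" for t s y'
  proof -
    have "(\<Sum>\<pi>'\<in>cells - {\<pi>}. real ((t(\<pi> := s)) \<pi>') * (twist (\<beta> (fst \<pi>')) n y' - twist (\<beta> (snd \<pi>')) n y'))
      = (\<Sum>\<pi>'\<in>cells - {\<pi>}. real ((t(\<pi> := 0)) \<pi>') * (twist (\<beta> (fst \<pi>')) n y' - twist (\<beta> (snd \<pi>')) n y'))"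
      by (intro sum.cong) auto
    then show ?thesis
      unfolding twist_pert sum.remove[OF finite_cells \<pi>] by (simp add: \<pi>_def algebra_simps)
  qed
  have "real (card {t \<in> params. (\<forall>y\<in>set ys. window n v t y) \<and> window n v t y}) * real G
      \<le> real (card {t \<in> params. \<forall>y\<in>set ys. window n v t y}) * (2 * (\<theta> + 2) / a + 1)"
    unfolding params_def
  proof (rule card_fibre_le[OF finite_cells \<pi>])
    fix t s assume "\<forall>y\<in>set ys. window n v t y"
    moreover have "twist (pert (t(\<pi> := s))) n y' = twist (pert t) n y'" if "y' \<in> set ys" for y'
    proof -
      have "twist (\<beta> (cell n y)) n y' = 0" "twist (\<beta> c) n y' = 0"
        using Cons.prems that by (auto simp: fresh_def)
      then show ?thesis using split[of t s y'] split[of t "t \<pi>" y'] by simp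
    qed
    ultimately show "\<forall>y\<in>set ys. window n v (t(\<pi> := s)) y" by (simp add: window_def)
  next
    fix t
    have "window n v (t(\<pi> := s)) y
        \<longleftrightarrow> \<bar>(v * jac n y - twist (pert (t(\<pi> := 0))) n y) - a * real s\<bar> \<le> \<theta> + 2" for s
      using Cons.prems split[of t s y] by (simp add: window_def a_def algebra_simps)
    then show "real (card {s \<in> {..<G}. window n v (t(\<pi> := s)) y}) \<le> 2 * (\<theta> + 2) / a + 1"
      using card_affine_window_le[OF a_pos, of "\<theta> + 2"] \<theta>_nonneg by simp
  qed
  also have "\<dots> \<le> real (card {t \<in> params. \<forall>y\<in>set ys. window n v t y}) * (real G * (loss / jac n y))"
  proof (intro mult_left_mono)
    have "2 * (\<theta> + 2) / a \<le> 2 * (\<theta> + 2) / (\<eta> / real G * (b / Lam ^ q * jac n y))"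
      using a_ge \<theta>_nonneg \<eta>_pos G_pos b_pos Lam_gt_1 jac_pos[of n y]
      by (intro divide_left_mono) (auto intro!: mult_pos_pos divide_pos_pos simp: a_pos)
    also have "\<dots> = real G * (2 * (\<theta> + 2) * Lam ^ q / (\<eta> * b)) / jac n y"
      using \<eta>_pos G_pos b_pos Lam_gt_1 jac_pos[of n y] by (simp add: field_simps)
    finally have "2 * (\<theta> + 2) / a \<le> real G * (2 * (\<theta> + 2) * Lam ^ q / (\<eta> * b)) / jac n y" .
    \<comment> \<open>The rounding term of the progression count is charged to the additive 1 in
      \<open>loss\<close>; this is where the parameter grid must be as fine as
      \<open>Lam ^ p\<close>.\<close>
    moreover have "1 \<le> real G / jac n y"
    proof -
      have "jac n y \<le> Lam ^ p"
        using jac_le_power[of n y] power_increasing[OF n(2), of Lam] Lam_gt_1 by linarith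
      then show ?thesis using G_Lam jac_pos[of n y] by simp
    qed
    ultimately show "2 * (\<theta> + 2) / a + 1 \<le> real G * (loss / jac n y)"
      by (simp add: loss_def distrib_left add_divide_distrib)
  qed auto
  also have "\<dots> = (real (card {t \<in> params. \<forall>y\<in>set ys. window n v t y}) * (loss / jac n y)) * real G"
    by simp
  finally have "real (card {t \<in> params. (\<forall>y\<in>set ys. window n v t y) \<and> window n v t y})
      \<le> real (card {t \<in> params. \<forall>y\<in>set ys. window n v t y}) * (loss / jac n y)"
    using G_pos by (rule mult_right_le_imp_le)
  also have "{t \<in> params. (\<forall>y\<in>set ys. window n v t y) \<and> window n v t y}
      = {t \<in> params. \<forall>y\<in>set (y # ys). window n v t y}" by auto
  finally have "real (card {t \<in> params. \<forall>y\<in>set (y # ys). window n v t y})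
      \<le> real (card {t \<in> params. \<forall>y\<in>set ys. window n v t y}) * (loss / jac n y)" .
  also have "\<dots> \<le> (real (card params) * prod_list (map (\<lambda>y. loss / jac n y) ys)) * (loss / jac n y)"
    using Cons \<theta>_nonneg \<eta>_pos b_pos Lam_gt_1 jac_pos[of n y] by (intro mult_right_mono) (auto simp: loss_def)
  finally show ?case by (simp add: algebra_simps)
qed simp

lemma twist_bump_nonzero:
  assumes "twist (\<beta> a) n y \<noteq> 0"
  obtains j where "j < n" "\<beta> a ((E ^^ j) y) \<noteq> 0"
  using assms unfolding twist_def by (metis (no_types, lifting) lessThan_iff mult_eq_0_iff sum.neutral)

text \<open>A bump reaches less than two cells to either side, so the \<open>N'\<close> bumps with
  index divisible by 4 have disjoint supports. Each orbit point meets at most one of them, and there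
  are at most \<open>k * p < N'\<close> orbit points.\<close>

lemma unvisited_cell:
  assumes "n \<le> p" "length ys \<le> k"
  obtains c where "c < 4 * N'" "\<forall>y\<in>set ys. twist (\<beta> c) n y = 0"
proof (rule ccontr)
  note sol = that
  assume no: "\<not> thesis"
  have "\<exists>u\<in>set ys \<times> {..<n}. \<beta> (4 * i) ((E ^^ snd u) (fst u)) \<noteq> 0" if i: "i < N'" for i
  proof -
    have "4 * i < 4 * N'" using i by simp
    then obtain y where y: "y \<in> set ys" "twist (\<beta> (4 * i)) n y \<noteq> 0" using no sol by blast
    obtain j where "j < n" "\<beta> (4 * i) ((E ^^ j) y) \<noteq> 0" using y(2) by (rule twist_bump_nonzero)
    then show ?thesis using y(1) by (intro bexI[of _ "(y, j)"]) auto
  qed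
  then obtain f where f: "\<And>i. i < N' \<Longrightarrow> f i \<in> set ys \<times> {..<n} \<and> \<beta> (4 * i) ((E ^^ snd (f i)) (fst (f i))) \<noteq> 0"
    by metis
  have "inj_on f {..<N'}"
  proof (rule inj_onI)
    fix i i' assume i: "i \<in> {..<N'}" "i' \<in> {..<N'}" "f i = f i'"
    define u where "u = (E ^^ snd (f i)) (fst (f i))"
    obtain m m' :: int where m: "\<bar>4 * real N' * u - real (4 * i) - 4 * real N' * of_int m\<bar> < 2"
      "\<bar>4 * real N' * u - real (4 * i') - 4 * real N' * of_int m'\<bar> < 2"
      using \<beta>_supp f[of i] f[of i'] i unfolding u_def by (metis lessThan_iff)
    have "\<bar>real (4 * i) - real (4 * i') + 4 * real N' * of_int m - 4 * real N' * of_int m'\<bar> < 4"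
      using m by linarith
    then have 1: "\<bar>of_int (int i - int i' + int N' * (m - m')) :: real\<bar> < 1"
      by (simp add: algebra_simps abs_less_iff)
    have "int i - int i' + int N' * (m - m') = 0" using 1 by linarith
    then have eq: "int i - int i' = int N' * (m' - m)" by (simp add: algebra_simps)
    have "\<bar>int N' * (m' - m)\<bar> < int N'" using i eq by auto
    then have "\<bar>m' - m\<bar> < 1" using N'_pos by (simp add: abs_mult)
    then show "i = i'" using eq by simp
  qed
  then have "card {..<N'} \<le> card (set ys \<times> {..<n})"
    by (rule card_inj_on_le) (use f in blast, simp)
  also have "\<dots> \<le> k * p"
    using assms card_length[of ys] by (simp add: card_cartesian_product) (meson le_trans mult_le_mono)
  finally show False using N'_kp by simp
qed

text \<open>All candidates whose bump contains a given point \<open>u\<close> pass through the same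
  preimage of order \<open>q\<close>, by separation, so by the spread hypothesis they form a
  fraction of at most \<open>\<sigma> ^ (- q)\<close>. At most \<open>k * p\<close> points
  \<open>u\<close> have to be avoided, which spoils no more than half of \<open>A\<close>.\<close>

lemma card_fresh_ge:
  assumes n: "q \<le> n" "n \<le> p" and A: "A \<subseteq> preim n z"
    and spread: "\<And>w. real (card {y \<in> A. frac ((E ^^ (n - q)) y) = w}) * \<sigma> ^ q \<le> real (card A)"
    and ys: "length ys \<le> k"
  shows "real (card A) / 2 \<le> real (card {y \<in> A. fresh n y ys})"
proof -
  have finA: "finite A" using A finite_preim finite_subset by blast
  define bad where "bad u = {y \<in> A. \<beta> (cell n y) u \<noteq> 0}" for u
  have bad_card: "real (card (bad u)) * \<sigma> ^ q \<le> real (card A)" for u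
  proof (cases "bad u = {}")
    case False
    then obtain y0 where y0: "y0 \<in> bad u" by auto
    define w where "w y = frac ((E ^^ (n - q)) y)" for y
    have w: "w y \<in> preim q z" if "y \<in> A" for y
    proof -
      have "frac ((E ^^ q) (w y)) = frac ((E ^^ (q + (n - q))) y)"
        unfolding w_def frac_iter_frac by (simp add: funpow_add)
      then show ?thesis using that A n by (auto simp: preim_def) (auto simp: w_def frac_lt_1)
    qed
    \<comment> \<open>Two cells for the reach of the bump and one for rounding \<open>w y\<close>
      down to its cell. Two such points are then less than six cells of width
      \<open>1 / (4 N')\<close> apart, below the separation of preimages of order
      \<open>q\<close>.\<close>
    have near: "\<exists>m::int. \<bar>4 * real N' * (u - w y - of_int m)\<bar> < 3" if y: "y \<in> bad u" for y
    proof -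
      obtain m :: int where "\<bar>4 * real N' * u - real (cell n y) - 4 * real N' * of_int m\<bar> < 2"
        using y \<beta>_supp by (auto simp: bad_def)
      then show ?thesis using real_cell[of n y] unfolding w_def
        by (intro exI[of _ m]) (simp add: algebra_simps abs_less_iff)
    qed
    have "w y = w y0" if y: "y \<in> bad u" for y
    proof -
      obtain m m0 :: int where m: "\<bar>4 * real N' * (u - w y - of_int m)\<bar> < 3"
        "\<bar>4 * real N' * (u - w y0 - of_int m0)\<bar> < 3" using near y y0 by meson
      have "\<bar>4 * real N' * (w y - w y0 - of_int (m0 - m))\<bar> < 6"
        using m by (simp add: algebra_simps abs_less_iff)
      then have 1: "2 * real N' * \<bar>w y - w y0 - of_int (m0 - m)\<bar> < 3"
        using N'_pos by (simp add: abs_mult)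
      have "2 * (\<bar>w y - w y0 - of_int (m0 - m)\<bar> * (2 * Lam ^ q)) \<le> 2 * (\<bar>w y - w y0 - of_int (m0 - m)\<bar> * real N')"
        using N'_Lam by (intro mult_left_mono) auto
      then have "\<bar>w y - w y0 - of_int (m0 - m)\<bar> * Lam ^ q < 1" using 1 by (simp add: mult.commute mult.left_commute)
      then show ?thesis using w y y0 by (intro preim_separated[of _ q z _ "m0 - m"]) (auto simp: bad_def)
    qed
    then have "bad u \<subseteq> {y \<in> A. frac ((E ^^ (n - q)) y) = w y0}" by (auto simp: bad_def w_def)
    then have "card (bad u) \<le> card {y \<in> A. frac ((E ^^ (n - q)) y) = w y0}"
      using finA by (intro card_mono) auto
    then have "real (card (bad u)) * \<sigma> ^ q \<le> real (card {y \<in> A. frac ((E ^^ (n - q)) y) = w y0}) * \<sigma> ^ q"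
      using \<sigma>_gt_1 by (intro mult_right_mono) auto
    then show ?thesis using spread[of "w y0"] by linarith
  qed simp
  define U where "U = (\<lambda>(y, j). (E ^^ j) y) ` (set ys \<times> {..<n})"
  have U: "finite U" "card U \<le> k * p"
  proof -
    show "finite U" by (simp add: U_def)
    have "card U \<le> card (set ys \<times> {..<n})" unfolding U_def by (intro card_image_le) auto
    also have "\<dots> \<le> k * p"
      using n ys card_length[of ys] by (simp add: card_cartesian_product) (meson le_trans mult_le_mono)
    finally show "card U \<le> k * p" .
  qed
  have sub: "{y \<in> A. \<not> fresh n y ys} \<subseteq> (\<Union>u\<in>U. bad u)"
  proof
    fix y assume y: "y \<in> {y \<in> A. \<not> fresh n y ys}"
    then obtain y' where y': "y' \<in> set ys" "twist (\<beta> (cell n y)) n y' \<noteq> 0" by (auto simp: fresh_def)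
    obtain j where "j < n" "\<beta> (cell n y) ((E ^^ j) y') \<noteq> 0" using y'(2) by (rule twist_bump_nonzero)
    then show "y \<in> (\<Union>u\<in>U. bad u)" using y y'(1) by (force simp: U_def bad_def)
  qed
  have "real (card {y \<in> A. \<not> fresh n y ys}) \<le> (\<Sum>u\<in>U. real (card (bad u)))"
  proof -
    have "card {y \<in> A. \<not> fresh n y ys} \<le> card (\<Union>u\<in>U. bad u)"
      using U finA by (intro card_mono sub) (auto simp: bad_def)
    also have "\<dots> \<le> (\<Sum>u\<in>U. card (bad u))" using U by (intro card_UN_le)
    finally show ?thesis by (simp flip: of_nat_sum)
  qed
  then have "real (card {y \<in> A. \<not> fresh n y ys}) * \<sigma> ^ q \<le> (\<Sum>u\<in>U. real (card (bad u)) * \<sigma> ^ q)"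
    using \<sigma>_gt_1 by (simp add: sum_distrib_right[symmetric])
  also have "\<dots> \<le> real (card U) * real (card A)" using bad_card by (intro sum_bounded_above)
  also have "\<dots> \<le> (real k * real p) * real (card A)"
    using U(2) by (intro mult_right_mono) (simp_all flip: of_nat_mult)
  also have "\<dots> \<le> (\<sigma> ^ q / 2) * real (card A)" using kp_\<sigma> by (intro mult_right_mono) auto
  finally have "real (card {y \<in> A. \<not> fresh n y ys}) \<le> real (card A) / 2"
    using \<sigma>_gt_1 by (simp add: field_simps)
  moreover have "card A = card {y \<in> A. fresh n y ys} + card {y \<in> A. \<not> fresh n y ys}"
    using finA by (subst card_Un_disjoint[symmetric]) (auto intro: arg_cong[where f = card])
  ultimately show ?thesis by (simp add: field_simps)
qed

text \<open>Replaces the continuum of base points and slopes by finitely many triples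
  \<open>(n, z, m)\<close>, so that a union bound becomes possible.\<close>

lemma survivors_give_windows:
  assumes bound: "\<And>x. \<bar>pert t x\<bar> \<le> B"
    and lip: "\<And>x y. \<bar>pert t x - pert t y\<bar> \<le> B * \<bar>x - y\<bar>"
    and J: "(\<theta> + B / (lam - 1) + B) * lipK ^ p \<le> real J" "0 < J"
    and M: "(\<theta> + 1 + B / (lam - 1)) * Lam ^ p + 1 \<le> of_int M"
    and x: "0 \<le> x" "x < 1" and many: "\<sigma> ^ (2 * p) \<le> real (card (surv (pert t) \<theta> p x v))"
  obtains n z m where "q \<le> n" "n \<le> p" "z \<in> (\<Union>i<J. preim (p - n) (real i / real J))" "\<bar>m\<bar> \<le> M"
    "(\<sigma> ^ p / 2) ^ k \<le> real (card {ys. set ys \<subseteq> preim n z \<and> length ys = k \<and> chained (fresh n) ys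
        \<and> (\<forall>y\<in>set ys. window n (of_int m / Lam ^ p) t y)})"
proof -
  obtain i where i: "i < J" "card (surv (pert t) \<theta> p x v) \<le> card (surv (pert t) (\<theta> + 1) p (real i / real J) v)"
    using surv_grid[of "pert t", OF pert_periodic bound lip \<theta>_nonneg J x] by blast
  define A where "A = surv (pert t) (\<theta> + 1) p (real i / real J) v"
  have A: "A \<subseteq> preim p (real i / real J)" by (simp add: A_def surv_subset)
  have cA: "\<sigma> ^ (2 * p) \<le> real (card A)" using many i(2) by (simp add: A_def)
  obtain n z where n: "q \<le> n" "n \<le> p"
    and big: "\<sigma> ^ p \<le> real (card {y \<in> A. frac ((E ^^ n) y) = z})"
    and spread: "\<And>w. real (card {y \<in> A. frac ((E ^^ n) y) = z \<and> frac ((E ^^ (n - q)) y) = w}) * \<sigma> ^ q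
       \<le> real (card {y \<in> A. frac ((E ^^ n) y) = z})"
    using spread_node[OF A \<sigma>_gt_1 cA q_pos l_\<sigma>] by blast
  define Az where "Az = {y \<in> A. frac ((E ^^ n) y) = z}"
  define v' where "v' = v * jac (p - n) z - twist (pert t) (p - n) z"
  have desc: "z \<in> preim (p - n) (real i / real J)" "y \<in> surv (pert t) (\<theta> + 1) n z v'" if "y \<in> Az" for y
    using surv_descend[of "pert t", OF pert_periodic n(2), of y "\<theta> + 1" "real i / real J" v] that
    by (auto simp: Az_def A_def v'_def)
  have "0 < \<sigma> ^ p" using \<sigma>_gt_1 by simp
  then have "0 < real (card Az)" using big by (simp add: Az_def)
  then obtain y0 where y0: "y0 \<in> Az" by (metis card.empty equals0I of_nat_0 order_less_irrefl)
  have Azsub: "Az \<subseteq> preim n z" using desc surv_subset by blast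
  have finAz: "finite Az" using Azsub finite_preim finite_subset by blast
  have v': "\<bar>v'\<bar> \<le> \<theta> + 1 + B / (lam - 1)"
    using surv_slope_bound[OF bound _ desc(2)[OF y0]] \<theta>_nonneg by simp
  \<comment> \<open>Rounding at scale \<open>Lam ^ (- p)\<close> shifts the condition by at most 1,
    because \<open>jac n y\<close> is at most \<open>Lam ^ p\<close>.\<close>
  define m where "m = \<lfloor>v' * Lam ^ p\<rfloor>"
  have Lp: "0 < Lam ^ p" using Lam_gt_1 by simp
  have mM: "\<bar>m\<bar> \<le> M"
  proof -
    have "\<bar>v' * Lam ^ p\<bar> \<le> (\<theta> + 1 + B / (lam - 1)) * Lam ^ p"
      using v' Lp by (simp add: abs_mult mult_right_mono)
    then have "\<bar>v' * Lam ^ p\<bar> + 1 \<le> of_int M" using M by linarith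
    then show ?thesis unfolding m_def by linarith
  qed
  have win: "window n (of_int m / Lam ^ p) t y" if "y \<in> Az" for y
  proof -
    have 1: "\<bar>v' * jac n y - twist (pert t) n y\<bar> \<le> \<theta> + 1" using desc(2)[OF that] by (simp add: surv_def)
    have "\<bar>of_int m - v' * Lam ^ p\<bar> \<le> 1" unfolding m_def by linarith
    then have "\<bar>of_int m / Lam ^ p - v'\<bar> * Lam ^ p \<le> 1"
      using Lp abs_mult_pos[of "Lam ^ p" "of_int m / Lam ^ p - v'"] Lam_gt_1 by (simp add: left_diff_distrib)
    moreover have "jac n y \<le> Lam ^ p"
      using jac_le_power[of n y] power_increasing[OF n(2), of Lam] Lam_gt_1 by linarith
    ultimately have "\<bar>of_int m / Lam ^ p - v'\<bar> * jac n y \<le> 1"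
      by (meson abs_ge_zero mult_left_mono order_trans)
    then have "\<bar>(of_int m / Lam ^ p - v') * jac n y\<bar> \<le> 1" using jac_pos[of n y] by (simp add: abs_mult)
    then show ?thesis using 1 unfolding window_def left_diff_distrib by linarith
  qed
  have "(\<sigma> ^ p / 2) ^ k \<le> (real (card Az) / 2) ^ k"
    using big \<sigma>_gt_1 by (intro power_mono) (auto simp: Az_def)
  also have "\<dots> \<le> real (card {ys. set ys \<subseteq> Az \<and> length ys = k \<and> chained (fresh n) ys})"
  proof (rule card_chained_ge[OF finAz])
    fix ys :: "real list" assume "length ys < k"
    have "real (card {y \<in> Az. frac ((E ^^ (n - q)) y) = w}) * \<sigma> ^ q \<le> real (card Az)" for w
      using spread[of w] by (simp add: Az_def conj_assoc)
    then show "real (card Az) / 2 \<le> real (card {y \<in> Az. fresh n y ys})"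
      using \<open>length ys < k\<close> by (intro card_fresh_ge[OF n Azsub]) auto
  qed simp
  also have "\<dots> \<le> real (card {ys. set ys \<subseteq> preim n z \<and> length ys = k \<and> chained (fresh n) ys
        \<and> (\<forall>y\<in>set ys. window n (of_int m / Lam ^ p) t y)})"
    using Azsub win
    by (intro of_nat_mono card_mono finite_subset[OF _ finite_lists_length_eq[OF finite_preim, of n z k]]) auto
  finally show ?thesis using that[OF n _ mM] desc(1)[OF y0] i(1) by blast
qed

text \<open>Double counting of pairs of a parameter and a tuple. Were every parameter bad, each
  would account for \<open>(\<sigma> ^ p / 2) ^ k\<close> tuples at some index in \<open>I\<close>;
  summed over parameters first, a fixed tuple is bounded by a product of factors
  \<open>loss / jac\<close>.\<close>

lemma exists_param:
  assumes bound: "\<And>t x. t \<in> params \<Longrightarrow> \<bar>pert t x\<bar> \<le> B"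
    and lip: "\<And>t x y. t \<in> params \<Longrightarrow> \<bar>pert t x - pert t y\<bar> \<le> B * \<bar>x - y\<bar>"
    and J: "(\<theta> + B / (lam - 1) + B) * lipK ^ p \<le> real J" "0 < J"
    and M: "(\<theta> + 1 + B / (lam - 1)) * Lam ^ p + 1 \<le> real M"
    and small: "real (p + 1) * (real J * real (l ^ p)) * real (2 * M + 1) * (loss * exp (L / (lam - 1))) ^ k
      < (\<sigma> ^ p / 2) ^ k"
  shows "\<exists>t\<in>params. \<forall>x\<in>{0..<1}. \<forall>v. real (card (surv (pert t) \<theta> p x v)) < \<sigma> ^ (2 * p)"
proof (rule ccontr)
  assume no: "\<not> ?thesis"
  define I where "I = (SIGMA n:{q..p}. (\<Union>i<J. preim (p - n) (real i / real J)) \<times> {- int M..int M})"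
  define Ls where "Ls n z = {ys. set ys \<subseteq> preim n z \<and> length ys = k \<and> chained (fresh n) ys}" for n z
  define C where "C = (\<lambda>t (n, z :: real, m :: int) ys. \<forall>y\<in>set ys. window n (of_int m / Lam ^ p) t y)"
  have finLs: "finite (Ls n z)" for n z
    unfolding Ls_def by (rule finite_subset[OF _ finite_lists_length_eq[OF finite_preim, of n z k]]) auto
  have fin: "finite params" unfolding params_def using finite_cells by (intro finite_PiE) auto
  have finU: "finite (\<Union>i<J. preim (p - n) (real i / real J))" for n by (simp add: finite_preim)
  have finI: "finite I" unfolding I_def using finU by (intro finite_SigmaI finite_cartesian_product) auto
  have params_pos: "0 < real (card params)"
  proof -
    have "(\<lambda>\<pi>\<in>cells. 0) \<in> params" using G_pos by (auto simp: params_def)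
    then show ?thesis using fin card_gt_0_iff by auto
  qed
  have loss_pos: "0 < loss"
    using \<theta>_nonneg \<eta>_pos b_pos Lam_gt_1 by (auto simp: loss_def intro!: add_nonneg_pos divide_nonneg_pos)
  have cardI: "real (card I) \<le> real (p + 1) * (real J * real (l ^ p)) * real (2 * M + 1)"
  proof -
    have "card I = (\<Sum>n\<in>{q..p}. card ((\<Union>i<J. preim (p - n) (real i / real J)) \<times> {- int M..int M}))"
      unfolding I_def using finU by (intro card_SigmaI) auto
    also have "\<dots> \<le> (\<Sum>n\<in>{q..p}. (J * l ^ p) * (2 * M + 1))"
    proof (intro sum_mono)
      fix n assume "n \<in> {q..p}"
      have "card (\<Union>i<J. preim (p - n) (real i / real J)) \<le> (\<Sum>i<J. card (preim (p - n) (real i / real J)))"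
        by (intro card_UN_le) simp
      also have "\<dots> \<le> (\<Sum>i<J. l ^ p)"
      proof (intro sum_mono)
        fix i
        have "l ^ (p - n) \<le> l ^ p" using l_ge_2 by (intro power_increasing) auto
        then show "card (preim (p - n) (real i / real J)) \<le> l ^ p" using card_preim le_trans by blast
      qed
      finally have "card (\<Union>i<J. preim (p - n) (real i / real J)) \<le> J * l ^ p" by simp
      moreover have "card {- int M..int M} = 2 * M + 1" by simp
      ultimately show "card ((\<Union>i<J. preim (p - n) (real i / real J)) \<times> {- int M..int M}) \<le> (J * l ^ p) * (2 * M + 1)"
        unfolding card_cartesian_product by (metis mult_le_mono1)
    qed
    also have "\<dots> \<le> (p + 1) * ((J * l ^ p) * (2 * M + 1))"
      unfolding sum_constant of_nat_id by (intro mult_le_mono1) simp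
    finally have "real (card I) \<le> real ((p + 1) * ((J * l ^ p) * (2 * M + 1)))" by (rule of_nat_mono)
    then show ?thesis by (simp only: of_nat_mult mult.assoc)
  qed
  have "real (card params) * (\<sigma> ^ p / 2) ^ k = (\<Sum>t\<in>params. (\<sigma> ^ p / 2) ^ k)" by simp
  also have "\<dots> \<le> (\<Sum>t\<in>params. \<Sum>i\<in>I. real (card {ys \<in> Ls (fst i) (fst (snd i)). C t i ys}))"
  proof (intro sum_mono)
    fix t assume t: "t \<in> params"
    then obtain x v where x: "0 \<le> x" "x < 1" "\<sigma> ^ (2 * p) \<le> real (card (surv (pert t) \<theta> p x v))"
      using no by (force simp: not_less)
    obtain n z m where nzm: "q \<le> n" "n \<le> p" "z \<in> (\<Union>i<J. preim (p - n) (real i / real J))" "\<bar>m\<bar> \<le> int M"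
      "(\<sigma> ^ p / 2) ^ k \<le> real (card {ys. set ys \<subseteq> preim n z \<and> length ys = k \<and> chained (fresh n) ys
        \<and> (\<forall>y\<in>set ys. window n (of_int m / Lam ^ p) t y)})"
      by (rule survivors_give_windows[of t B J "int M" x v, OF bound[OF t] lip[OF t] J _ x]) (use M in auto)
    have "(n, z, m) \<in> I" using nzm by (auto simp: I_def)
    moreover have "{ys. set ys \<subseteq> preim n z \<and> length ys = k \<and> chained (fresh n) ys
        \<and> (\<forall>y\<in>set ys. window n (of_int m / Lam ^ p) t y)} = {ys \<in> Ls n z. C t (n, z, m) ys}"
      by (auto simp: Ls_def C_def)
    ultimately show "(\<sigma> ^ p / 2) ^ k \<le> (\<Sum>i\<in>I. real (card {ys \<in> Ls (fst i) (fst (snd i)). C t i ys}))"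
      using nzm(5) member_le_sum[OF _ _ finI, of "(n, z, m)" "\<lambda>i. real (card {ys \<in> Ls (fst i) (fst (snd i)). C t i ys})"]
      by auto
  qed
  also have "\<dots> = (\<Sum>i\<in>I. \<Sum>t\<in>params. \<Sum>ys\<in>Ls (fst i) (fst (snd i)). if C t i ys then 1 else 0)"
    by (subst sum.swap) (simp add: finLs flip: sum.inter_filter)
  also have "\<dots> = (\<Sum>i\<in>I. \<Sum>ys\<in>Ls (fst i) (fst (snd i)). real (card {t \<in> params. C t i ys}))"
    by (subst sum.swap) (simp add: fin flip: sum.inter_filter)
  also have "\<dots> \<le> (\<Sum>i\<in>I. real (card params) * (loss * exp (L / (lam - 1))) ^ k)"
  proof (intro sum_mono)
    fix i assume "i \<in> I"
    then obtain n z m where i: "i = (n, z, m)" "q \<le> n" "n \<le> p" by (auto simp: I_def)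
    have "(\<Sum>ys\<in>Ls n z. real (card {t \<in> params. C t i ys}))
        \<le> (\<Sum>ys\<in>Ls n z. real (card params) * prod_list (map (\<lambda>y. loss / jac n y) ys))"
    proof (intro sum_mono)
      fix ys assume ys: "ys \<in> Ls n z"
      obtain c where "c < 4 * N'" "\<forall>y\<in>set ys. twist (\<beta> c) n y = 0"
        using unvisited_cell[OF i(3), of ys] ys by (auto simp: Ls_def)
      then show "real (card {t \<in> params. C t i ys}) \<le> real (card params) * prod_list (map (\<lambda>y. loss / jac n y) ys)"
        using card_window_le[OF i(2,3)] ys by (simp add: Ls_def C_def i(1))
    qed
    \<comment> \<open>The chain condition has served its purpose in the bound for a single tuple.
      Over unrestricted lists the sum factorises into a \<open>k\<close>-th power.\<close>
    also have "\<dots> \<le> (\<Sum>ys | set ys \<subseteq> preim n z \<and> length ys = k. real (card params) * prod_list (map (\<lambda>y. loss / jac n y) ys))"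
    proof (intro sum_mono2 finite_lists_length_eq finite_preim)
      show "0 \<le> real (card params) * prod_list (map (\<lambda>y. loss / jac n y) ys)" for ys
        using loss_pos jac_pos by (intro mult_nonneg_nonneg prod_list_nonneg) (auto simp: less_imp_le)
    qed (auto simp: Ls_def)
    also have "\<dots> = real (card params) * (\<Sum>y\<in>preim n z. loss / jac n y) ^ k"
      by (simp add: sum_distrib_left[symmetric] sum_prod_lists[OF finite_preim])
    also have "(\<Sum>y\<in>preim n z. loss / jac n y) = loss * (\<Sum>y\<in>preim n z. 1 / jac n y)"
      by (simp add: sum_distrib_left)
    also have "real (card params) * (loss * (\<Sum>y\<in>preim n z. 1 / jac n y)) ^ k
        \<le> real (card params) * (loss * exp (L / (lam - 1))) ^ k"
      using loss_pos sum_inverse_jac_le[of n z] jac_pos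
      by (intro mult_left_mono power_mono mult_nonneg_nonneg sum_nonneg) (auto simp: less_imp_le)
    finally show "(\<Sum>ys\<in>Ls (fst i) (fst (snd i)). real (card {t \<in> params. C t i ys}))
        \<le> real (card params) * (loss * exp (L / (lam - 1))) ^ k" by (simp add: i(1))
  qed
  also have "\<dots> = real (card params) * (real (card I) * (loss * exp (L / (lam - 1))) ^ k)" by simp
  finally have "(\<sigma> ^ p / 2) ^ k \<le> real (card I) * (loss * exp (L / (lam - 1))) ^ k"
    using params_pos by (rule mult_left_le_imp_le)
  also have "\<dots> \<le> real (p + 1) * (real J * real (l ^ p)) * real (2 * M + 1) * (loss * exp (L / (lam - 1))) ^ k"
    using cardI loss_pos by (intro mult_right_mono) auto
  finally show False using small by linarith
qed

end

section \<open>Differentiable functions and bumps\<close>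

lemma Cr_0: "Cr 0 g \<longleftrightarrow> continuous_on UNIV g"
  by (simp add: Cr_def)

lemma Cr_Suc: "Cr (Suc r) g \<longleftrightarrow> (\<forall>x. g differentiable (at x)) \<and> Cr r (deriv g)"
  by (simp add: Cr_def All_less_Suc2 funpow_swap1 conj_assoc)

lemma deriv_linear:
  fixes f g :: "real \<Rightarrow> real"
  assumes "\<And>x. f differentiable (at x)" "\<And>x. g differentiable (at x)"
  shows "deriv (\<lambda>x. a * f x + b * g x) = (\<lambda>x. a * deriv f x + b * deriv g x)"
proof (rule ext, rule DERIV_imp_deriv)
  fix x
  show "((\<lambda>x. a * f x + b * g x) has_field_derivative a * deriv f x + b * deriv g x) (at x)"
    using assms by (intro DERIV_add DERIV_cmult) (auto simp: DERIV_deriv_iff_real_differentiable)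
qed

lemma Cr_linear: "Cr r f \<Longrightarrow> Cr r g \<Longrightarrow> Cr r (\<lambda>x. a * f x + b * g x)"
proof (induction r arbitrary: f g)
  case 0
  then show ?case by (auto simp: Cr_0 intro!: continuous_intros)
next
  case (Suc r)
  then show ?case by (auto simp: Cr_Suc deriv_linear intro!: derivative_intros)
qed

lemma iterated_deriv_linear:
  "Cr r f \<Longrightarrow> Cr r g \<Longrightarrow> k \<le> r \<Longrightarrow>
    (deriv ^^ k) (\<lambda>x. a * f x + b * g x) = (\<lambda>x. a * (deriv ^^ k) f x + b * (deriv ^^ k) g x)"
proof (induction r arbitrary: f g k)
  case (Suc r)
  then show ?case by (cases k) (auto simp: Cr_Suc deriv_linear funpow_swap1)
qed simp

lemma CrS1_linear: "f \<in> CrS1 r \<Longrightarrow> g \<in> CrS1 r \<Longrightarrow> (\<lambda>x. a * f x + b * g x) \<in> CrS1 r"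
  by (auto simp: CrS1_def periodic1_def Cr_linear)

text \<open>Pointwise bounds recurse along \<open>deriv\<close>, whereas the suprema in
  \<open>Cr_norm\<close> are meaningful only once boundedness is known.\<close>

definition Cr_bounded :: "nat \<Rightarrow> real \<Rightarrow> (real \<Rightarrow> real) \<Rightarrow> bool" where
  "Cr_bounded r C g \<longleftrightarrow> Cr r g \<and> (\<forall>k\<le>r. \<forall>x. \<bar>(deriv ^^ k) g x\<bar> \<le> C)"

lemma Cr_bounded_Suc:
  "Cr_bounded (Suc r) C g \<longleftrightarrow>
    (\<forall>x. g differentiable (at x)) \<and> (\<forall>x. \<bar>g x\<bar> \<le> C) \<and> Cr_bounded r C (deriv g)"
proof -
  have "(\<forall>k\<le>Suc r. \<forall>x. \<bar>(deriv ^^ k) g x\<bar> \<le> C) \<longleftrightarrow>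
    (\<forall>x. \<bar>g x\<bar> \<le> C) \<and> (\<forall>k\<le>r. \<forall>x. \<bar>(deriv ^^ k) (deriv g) x\<bar> \<le> C)"
    unfolding less_Suc_eq_le[symmetric] by (simp add: All_less_Suc2 funpow_swap1)
  then show ?thesis by (auto simp: Cr_bounded_def Cr_Suc)
qed

lemma Cr_bounded_SucI:
  assumes "\<And>x. (g has_real_derivative g' x) (at x)" "\<And>x. \<bar>g x\<bar> \<le> C" "Cr_bounded r C g'"
  shows "Cr_bounded (Suc r) C g"
proof -
  have "deriv g = g'" using assms(1) by (intro ext DERIV_imp_deriv)
  moreover have "g differentiable (at x)" for x
    using assms(1) real_differentiable_def by blast
  ultimately show ?thesis using assms by (simp add: Cr_bounded_Suc)
qed

lemma Cr_bounded_mono: "Cr_bounded r C g \<Longrightarrow> C \<le> D \<Longrightarrow> Cr_bounded r D g"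
  unfolding Cr_bounded_def by (meson order_trans)

lemma Cr_bounded_0: "Cr_bounded r 0 (\<lambda>x. 0)"
  by (induction r) (auto simp: Cr_bounded_def[of 0] Cr_0 intro!: Cr_bounded_SucI)

lemma Cr_bounded_linear:
  assumes "Cr_bounded r C f" "Cr_bounded r D g"
  shows "Cr_bounded r (\<bar>a\<bar> * C + \<bar>b\<bar> * D) (\<lambda>x. a * f x + b * g x)"
proof -
  have "\<bar>a * (deriv ^^ k) f x + b * (deriv ^^ k) g x\<bar> \<le> \<bar>a\<bar> * C + \<bar>b\<bar> * D" if "k \<le> r" for k x
  proof -
    have "\<bar>a * (deriv ^^ k) f x\<bar> \<le> \<bar>a\<bar> * C" "\<bar>b * (deriv ^^ k) g x\<bar> \<le> \<bar>b\<bar> * D"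
      using assms that by (auto simp: Cr_bounded_def abs_mult intro!: mult_left_mono)
    then show ?thesis by linarith
  qed
  then show ?thesis
    using assms by (auto simp: Cr_bounded_def Cr_linear iterated_deriv_linear[of r])
qed

lemma Cr_bounded_sum:
  assumes "finite S" "\<And>i. i \<in> S \<Longrightarrow> Cr_bounded r (c i) (f i)"
  shows "Cr_bounded r (\<Sum>i\<in>S. c i) (\<lambda>x. \<Sum>i\<in>S. f i x)"
  using assms
proof (induction S)
  case (insert i S)
  then show ?case using Cr_bounded_linear[of r "c i" "f i" "sum c S" "\<lambda>x. \<Sum>i\<in>S. f i x" 1 1] by simp
qed (simp add: Cr_bounded_0)

lemma deriv_shift:
  fixes g :: "real \<Rightarrow> real"
  assumes "\<And>x. g differentiable (at x)"
  shows "deriv (\<lambda>x. g (x - a)) = (\<lambda>x. deriv g (x - a))"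
    and "(\<lambda>x. g (x - a)) differentiable (at x)"
proof -
  have *: "((\<lambda>x. g (x - a)) has_real_derivative deriv g (x - a)) (at x)" for x
  proof -
    have "(g has_real_derivative deriv g (x - a)) (at (x - a))"
      using assms DERIV_deriv_iff_real_differentiable by blast
    then have "((\<lambda>x. g (x - a)) has_real_derivative deriv g (x - a) * 1) (at x)"
      by (rule DERIV_chain2) (auto intro!: derivative_eq_intros)
    then show ?thesis by simp
  qed
  show "deriv (\<lambda>x. g (x - a)) = (\<lambda>x. deriv g (x - a))" by (intro ext DERIV_imp_deriv *)
  show "(\<lambda>x. g (x - a)) differentiable (at x)" using * real_differentiable_def by blast
qed

lemma Cr_bounded_shift: "Cr_bounded r C g \<Longrightarrow> Cr_bounded r C (\<lambda>x. g (x - a))"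
proof (induction r arbitrary: g)
  case 0
  then show ?case
    by (auto simp: Cr_bounded_def Cr_0 intro!: continuous_on_compose2[of UNIV g] continuous_intros)
next
  case (Suc r)
  then show ?case by (auto simp: Cr_bounded_Suc deriv_shift)
qed

lemma Cr_norm_le:
  assumes "Cr_bounded r C g"
  shows "Cr_norm r g \<le> real (r + 1) * C"
proof -
  have "Cr_norm r g \<le> (\<Sum>k\<le>r. C)"
    unfolding Cr_norm_def using assms by (intro sum_mono cSUP_least) (auto simp: Cr_bounded_def)
  then show ?thesis by (simp add: add.commute)
qed

text \<open>\<open>deriv\<close> is chosen from the derivative relation, which is invariant under
  translation; the argument therefore also covers points where no derivative exists.\<close>

lemma periodic1_iterated_deriv:
  assumes "periodic1 g"
  shows "periodic1 ((deriv ^^ k) g)"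
proof (induction k)
  case (Suc k)
  define h where "h = (deriv ^^ k) g"
  have "h (x + 1) = h x" for x using Suc by (simp add: periodic1_def h_def)
  then have h: "h = (\<lambda>x. h (x + 1))" by auto
  have "(h has_real_derivative D) (at (x + 1)) \<longleftrightarrow> (h has_real_derivative D) (at x)" for D x
    using DERIV_shift[of h D x 1] h by simp
  then have "deriv h (x + 1) = deriv h x" for x by (simp add: deriv_def)
  then show ?case by (simp add: periodic1_def h_def)
qed (use assms in simp)

lemma periodic1_bounded:
  assumes "periodic1 g" "continuous_on UNIV g"
  shows "\<exists>C. \<forall>x. \<bar>g x\<bar> \<le> C"
proof -
  have "compact (g ` {0..1})"
    using assms(2) by (intro compact_continuous_image) (auto intro: continuous_on_subset)
  then obtain C where C: "\<And>x. x \<in> {0..1} \<Longrightarrow> \<bar>g x\<bar> \<le> C"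
    using compact_imp_bounded bounded_iff by (metis image_eqI real_norm_def)
  have "g (frac x + of_int \<lfloor>x\<rfloor>) = g (frac x)" for x
    using assms(1) by (intro periodic_of_int) (simp add: periodic1_def)
  then have "g x = g (frac x)" for x by (simp add: frac_def)
  then have "\<bar>g x\<bar> \<le> C" for x
    using C[of "frac x"] frac_ge_0[of x] frac_lt_1[of x] by simp
  then show ?thesis by blast
qed

lemma Cr_imp_continuous: "Cr r g \<Longrightarrow> k \<le> r \<Longrightarrow> continuous_on UNIV ((deriv ^^ k) g)"
  unfolding Cr_def
  by (cases "k = r") (auto intro!: differentiable_imp_continuous_on simp: differentiable_on_def differentiable_at_withinI)

lemma CrS1_bdd_above:
  assumes "g \<in> CrS1 r" "k \<le> r"
  shows "bdd_above (range (\<lambda>x. \<bar>(deriv ^^ k) g x\<bar>))"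
proof -
  have "periodic1 ((deriv ^^ k) g)" "continuous_on UNIV ((deriv ^^ k) g)"
    using assms by (auto simp: CrS1_def periodic1_iterated_deriv Cr_imp_continuous)
  then obtain C where "\<forall>x. \<bar>(deriv ^^ k) g x\<bar> \<le> C" using periodic1_bounded by blast
  then show ?thesis by (intro bdd_aboveI2[where M = C]) auto
qed

lemma iterated_deriv_le_Cr_norm:
  assumes "g \<in> CrS1 r" "k \<le> r"
  shows "\<bar>(deriv ^^ k) g x\<bar> \<le> Cr_norm r g"
proof -
  have nonneg: "0 \<le> (SUP x. \<bar>(deriv ^^ j) g x\<bar>)" if "j \<le> r" for j
    using cSUP_upper[OF UNIV_I CrS1_bdd_above[OF assms(1) that], of 0] by linarith
  have "\<bar>(deriv ^^ k) g x\<bar> \<le> (SUP x. \<bar>(deriv ^^ k) g x\<bar>)"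
    by (rule cSUP_upper[OF UNIV_I CrS1_bdd_above[OF assms]])
  also have "\<dots> \<le> Cr_norm r g"
    unfolding Cr_norm_def using assms(2) nonneg
    by (intro member_le_sum[of k "{..r}" "\<lambda>k. SUP x. \<bar>(deriv ^^ k) g x\<bar>"]) auto
  finally show ?thesis .
qed

text \<open>Bumps on the circle: truncating a cosine keeps all derivatives bounded uniformly in the
  width of the bump, at the price of a height that decays polynomially in it.\<close>

definition trunc_cos :: "nat \<Rightarrow> real \<Rightarrow> nat \<Rightarrow> nat \<Rightarrow> real \<Rightarrow> real" where
  "trunc_cos m s a b x = max 0 (cos (2 * pi * x) - s) ^ m * sin (2 * pi * x) ^ a * cos (2 * pi * x) ^ b"

lemma deriv_pos_part_power:
  "((\<lambda>u::real. max 0 u ^ Suc (Suc m)) has_real_derivative real (Suc (Suc m)) * max 0 u ^ Suc m) (at u)"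
proof -
  consider "u > 0" | "u < 0" | "u = 0" by linarith
  then show ?thesis
  proof cases
    case 1
    have "((\<lambda>u::real. u ^ Suc (Suc m)) has_real_derivative real (Suc (Suc m)) * u ^ Suc m) (at u)"
      using DERIV_pow[of "Suc (Suc m)" u] by simp
    then have "((\<lambda>u::real. max 0 u ^ Suc (Suc m)) has_real_derivative real (Suc (Suc m)) * u ^ Suc m) (at u)"
      by (rule has_field_derivative_transform_within_open[of _ _ _ "{0<..}"]) (use 1 in auto)
    then show ?thesis using 1 by simp
  next
    case 2
    have "((\<lambda>u::real. 0) has_real_derivative 0) (at u)" by simp
    then have "((\<lambda>u::real. max 0 u ^ Suc (Suc m)) has_real_derivative 0) (at u)"
      by (rule has_field_derivative_transform_within_open[of _ _ _ "{..<0}"]) (use 2 in auto)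
    then show ?thesis using 2 by simp
  next
    case 3
    have "((\<lambda>h. max 0 h ^ Suc (Suc m) / h) \<longlongrightarrow> (0::real)) (at 0)"
    proof (rule Lim_null_comparison)
      show "\<forall>\<^sub>F h in at 0. norm (max 0 h ^ Suc (Suc m) / h) \<le> \<bar>h :: real\<bar>"
      proof (rule eventually_at_ball'[of 1 0 UNIV, THEN eventually_mono])
        fix h :: real assume h: "h \<in> ball 0 1 \<and> h \<noteq> 0 \<and> h \<in> UNIV"
        have "max 0 h ^ Suc (Suc m) \<le> \<bar>h\<bar> * \<bar>h\<bar>"
        proof (cases "h > 0")
          case True
          then have "h ^ m \<le> 1" using h by (intro power_le_one) auto
          then show ?thesis using True mult_left_mono[of "h ^ m" 1 "h * h"] by (simp add: mult.assoc)
        qed simp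
        then show "norm (max 0 h ^ Suc (Suc m) / h) \<le> \<bar>h\<bar>" using h by (simp add: field_simps)
      qed simp
      show "((\<lambda>h::real. \<bar>h\<bar>) \<longlongrightarrow> 0) (at 0)" by (rule tendsto_eq_intros | simp)+
    qed
    then show ?thesis by (simp add: has_field_derivative_iff 3)
  qed
qed

text \<open>The factors \<open>sin ^ a\<close> and \<open>cos ^ b\<close> close the family under
  differentiation, with \<open>m\<close> dropping by at most 1. The truncated exponents
  \<open>a - 1\<close> and \<open>b - 1\<close> are harmless at 0, where their coefficients
  vanish.\<close>

lemma deriv_trunc_cos:
  "(trunc_cos (Suc (Suc m)) s a b has_real_derivative
      (- (2 * pi * real (Suc (Suc m)))) * trunc_cos (Suc m) s (Suc a) b x
    + 1 * ((2 * pi * real a) * trunc_cos (Suc (Suc m)) s (a - 1) (Suc b) x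
      + (- (2 * pi * real b)) * trunc_cos (Suc (Suc m)) s (Suc a) (b - 1) x)) (at x)"
proof -
  let ?u = "\<lambda>x. cos (2 * pi * x) - s"
  have "(?u has_real_derivative - (2 * pi) * sin (2 * pi * x)) (at x)"
    by (auto intro!: derivative_eq_intros)
  from DERIV_chain2[OF deriv_pos_part_power this]
  have 1: "((\<lambda>x. max 0 (?u x) ^ Suc (Suc m)) has_real_derivative
      real (Suc (Suc m)) * max 0 (?u x) ^ Suc m * (- (2 * pi) * sin (2 * pi * x))) (at x)" .
  have 2: "((\<lambda>x. sin (2 * pi * x) ^ a) has_real_derivative
      real a * sin (2 * pi * x) ^ (a - 1) * (2 * pi * cos (2 * pi * x))) (at x)"
    by (auto intro!: derivative_eq_intros)
  have 3: "((\<lambda>x. cos (2 * pi * x) ^ b) has_real_derivative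
      real b * cos (2 * pi * x) ^ (b - 1) * (- (2 * pi) * sin (2 * pi * x))) (at x)"
    by (auto intro!: derivative_eq_intros)
  show ?thesis
    unfolding trunc_cos_def
    by (rule DERIV_cong[OF DERIV_mult[OF DERIV_mult[OF 1 2] 3]]) (simp only: power_Suc, algebra)
qed

lemma abs_trunc_cos_le:
  assumes "\<bar>s\<bar> \<le> 1"
  shows "\<bar>trunc_cos m s a b x\<bar> \<le> 2 ^ m"
proof -
  have "\<bar>max 0 (cos (2 * pi * x) - s)\<bar> \<le> 2"
    using assms cos_le_one[of "2 * pi * x"] by linarith
  then have "\<bar>max 0 (cos (2 * pi * x) - s)\<bar> ^ m * \<bar>sin (2 * pi * x)\<bar> ^ a * \<bar>cos (2 * pi * x)\<bar> ^ b \<le> 2 ^ m * 1 * 1"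
    by (intro mult_mono power_mono power_le_one) auto
  then show ?thesis by (simp add: trunc_cos_def abs_mult power_abs)
qed

text \<open>The constant precedes the threshold \<open>s\<close>, hence is uniform in the width of
  the bump. This is essential because the number of bumps is chosen only later.\<close>

lemma Cr_bounded_trunc_cos:
  "j < m \<Longrightarrow> \<exists>C. \<forall>s. \<bar>s\<bar> \<le> 1 \<longrightarrow> Cr_bounded j C (trunc_cos m s a b)"
proof (induction j arbitrary: m a b)
  case 0
  have "continuous_on UNIV (trunc_cos m s a b)" for s
    unfolding trunc_cos_def by (intro continuous_intros)
  then show ?case using abs_trunc_cos_le by (intro exI[of _ "2 ^ m"]) (auto simp: Cr_bounded_def Cr_0)
next
  case (Suc j)
  then obtain m' where m: "m = Suc (Suc m')" by (cases m; cases "m - 1") auto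
  obtain C1 where C1: "\<forall>s. \<bar>s\<bar> \<le> 1 \<longrightarrow> Cr_bounded j C1 (trunc_cos (Suc m') s (Suc a) b)"
    using Suc.IH[of "Suc m'" "Suc a" b] Suc.prems m by blast
  obtain C2 where C2: "\<forall>s. \<bar>s\<bar> \<le> 1 \<longrightarrow> Cr_bounded j C2 (trunc_cos m s (a - 1) (Suc b))"
    using Suc.IH[of m "a - 1" "Suc b"] Suc.prems Suc_lessD by blast
  obtain C3 where C3: "\<forall>s. \<bar>s\<bar> \<le> 1 \<longrightarrow> Cr_bounded j C3 (trunc_cos m s (Suc a) (b - 1))"
    using Suc.IH[of m "Suc a" "b - 1"] Suc.prems Suc_lessD by blast
  define C where "C = \<bar>- (2 * pi * real m)\<bar> * C1 + \<bar>1\<bar> * (\<bar>2 * pi * real a\<bar> * C2 + \<bar>- (2 * pi * real b)\<bar> * C3)"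
  show ?case
  proof (intro exI[of _ "max C (2 ^ m)"] allI impI)
    fix s :: real assume s: "\<bar>s\<bar> \<le> 1"
    have "Cr_bounded j C (\<lambda>x. (- (2 * pi * real m)) * trunc_cos (Suc m') s (Suc a) b x
      + 1 * ((2 * pi * real a) * trunc_cos m s (a - 1) (Suc b) x
        + (- (2 * pi * real b)) * trunc_cos m s (Suc a) (b - 1) x))"
      unfolding C_def using s C1 C2 C3 by (intro Cr_bounded_linear) auto
    then have "Cr_bounded j (max C (2 ^ m)) (\<lambda>x. (- (2 * pi * real m)) * trunc_cos (Suc m') s (Suc a) b x
      + 1 * ((2 * pi * real a) * trunc_cos m s (a - 1) (Suc b) x
        + (- (2 * pi * real b)) * trunc_cos m s (Suc a) (b - 1) x))"
      by (rule Cr_bounded_mono) simp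
    moreover have "\<bar>trunc_cos m s a b x\<bar> \<le> max C (2 ^ m)" for x
      using abs_trunc_cos_le[OF s, of m a b x] by (rule max.coboundedI2)
    ultimately show "Cr_bounded (Suc j) (max C (2 ^ m)) (trunc_cos m s a b)"
      unfolding m by (intro Cr_bounded_SucI[OF deriv_trunc_cos]) auto
  qed
qed

text \<open>The height of a bump at half its radius. With \<open>A\<close> the smaller angle, the
  gap is \<open>(1 - cos A) * (1 + 2 * cos A)\<close>, which is at least \<open>1 - cos A\<close>,
  and so of order \<open>A ^ 2\<close>.\<close>

lemma cos_pi_gap:
  assumes "1 \<le> N"
  shows "1 / (4 * real N ^ 2) \<le> cos (pi / (2 * real N)) - cos (pi / real N)"
proof -
  define A where "A = pi / (2 * real N)"
  have N: "1 \<le> real N" using assms by simp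
  have A: "0 < A" "A \<le> pi / 2" unfolding A_def using N pi_gt_zero by (auto simp: field_simps)
  have "0 < A / 2" using A by simp
  then obtain z where z: "0 < z" "z < A / 2" "sin (A / 2) - sin 0 = (A / 2 - 0) * cos z"
    using MVT2[of 0 "A / 2" sin cos] by (auto intro: DERIV_sin)
  have "cos (pi / 3) \<le> cos z" using z A by (intro cos_monotone_0_pi_le) auto
  then have "A / 2 * (1 / 2) \<le> A / 2 * cos z" using A by (intro mult_left_mono) (auto simp: cos_60)
  then have "A / 4 \<le> sin (A / 2)" using z(3) by (simp only: sin_zero diff_0_right)
  then have "(A / 4) ^ 2 \<le> sin (A / 2) ^ 2" using A by (intro power_mono) auto
  moreover have "cos A = 1 - 2 * sin (A / 2) ^ 2" using cos_double_sin[of "A / 2"] by simp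
  ultimately have 1: "A ^ 2 / 8 \<le> 1 - cos A" by (simp add: power2_eq_square)
  have "3 ^ 2 \<le> pi ^ 2" using pi_gt3 by (intro power_mono) auto
  then have "1 / (4 * real N ^ 2) \<le> A ^ 2 / 8"
    unfolding A_def using N by (simp add: power_divide power_mult_distrib field_simps)
  also have "\<dots> \<le> (1 - cos A) * 1" using 1 by simp
  also have "\<dots> \<le> (1 - cos A) * (1 + 2 * cos A)"
    using A cos_ge_zero[of A] by (intro mult_left_mono) auto
  also have "\<dots> = cos A - cos (2 * A)" unfolding cos_double_cos by (simp add: algebra_simps power2_eq_square)
  also have "2 * A = pi / real N" by (simp add: A_def)
  finally show ?thesis by (simp add: A_def)
qed

lemma cos_2pi_of_int: "cos (2 * pi * (x + of_int m)) = cos (2 * pi * x)"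
proof -
  have "cos (2 * pi * x + 2 * pi * of_int m) = cos (2 * pi * x)"
    using sin_cos_eq_iff by blast
  then show ?thesis by (simp add: algebra_simps)
qed

text \<open>Centred at \<open>a / (4 N)\<close> with radius \<open>1 / (2 N)\<close>, two cells:
  every point of the cell starting at the centre lies within half the radius, where the bump is not
  small.\<close>

definition bump :: "nat \<Rightarrow> nat \<Rightarrow> nat \<Rightarrow> real \<Rightarrow> real" where
  "bump r N a x = trunc_cos (Suc r) (cos (pi / real N)) 0 0 (x - real a / (4 * real N))"

lemma bump_periodic: "bump r N a (x + 1) = bump r N a x"
proof -
  have "x + 1 - real a / (4 * real N) = (x - real a / (4 * real N)) + of_int 1" by simp
  then show ?thesis unfolding bump_def trunc_cos_def by (simp only: cos_2pi_of_int power_0)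
qed

lemma bump_nonneg: "0 \<le> bump r N a x"
  by (simp add: bump_def trunc_cos_def)

lemma bump_core:
  assumes "1 \<le> N" "0 \<le> w" "w < 1"
  shows "(1 / (4 * real N ^ 2)) ^ Suc r \<le> bump r N (nat \<lfloor>4 * real N * w\<rfloor>) w"
proof -
  define a where "a = nat \<lfloor>4 * real N * w\<rfloor>"
  have N: "1 \<le> real N" using assms by simp
  have "0 \<le> 4 * real N * w" using assms by simp
  then have "real a = of_int \<lfloor>4 * real N * w\<rfloor>" by (simp add: a_def)
  then have a: "real a \<le> 4 * real N * w" "4 * real N * w < real a + 1" by linarith+
  define y where "y = w - real a / (4 * real N)"
  have "y * (4 * real N) = 4 * real N * w - real a" using N by (simp add: y_def field_simps)
  then have "0 \<le> y * (4 * real N)" "y * (4 * real N) \<le> 1" using a by linarith+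
  then have y: "0 \<le> y" "y \<le> 1 / (4 * real N)"
    using N by (simp_all add: zero_le_mult_iff pos_le_divide_eq)
  have "2 * pi * y \<le> 2 * pi * (1 / (4 * real N))" using y by (intro mult_left_mono) auto
  then have "2 * pi * y \<le> pi / (2 * real N)" by simp
  moreover have "pi / (2 * real N) \<le> pi" using N pi_gt_zero by (simp add: divide_le_eq)
  ultimately have "cos (pi / (2 * real N)) \<le> cos (2 * pi * y)"
    using y by (intro cos_monotone_0_pi_le) auto
  then have "1 / (4 * real N ^ 2) \<le> max 0 (cos (2 * pi * y) - cos (pi / real N))"
    using cos_pi_gap[OF assms(1)] by simp
  then have "(1 / (4 * real N ^ 2)) ^ Suc r \<le> max 0 (cos (2 * pi * y) - cos (pi / real N)) ^ Suc r"
    by (intro power_mono) auto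
  then show ?thesis by (simp add: bump_def trunc_cos_def y_def a_def del: power_Suc)
qed

lemma bump_supp:
  assumes "1 \<le> N" "bump r N a x \<noteq> 0"
  shows "\<exists>m::int. \<bar>4 * real N * x - real a - 4 * real N * of_int m\<bar> < 2"
proof -
  define y where "y = x - real a / (4 * real N)"
  define m where "m = round y"
  define d where "d = \<bar>y - of_int m\<bar>"
  have N: "1 \<le> real N" using assms by simp
  have d: "0 \<le> d" "d \<le> 1 / 2"
    using of_int_round_abs_le[of y] by (auto simp: d_def m_def abs_minus_commute)
  have "cos (2 * pi * y) = cos (2 * pi * (y - of_int m))"
    using cos_2pi_of_int[of "y - of_int m" m] by simp
  also have "\<dots> = cos (2 * pi * d)" 
  proof (cases "0 \<le> y - of_int m")
    case False
    then have "2 * pi * d = - (2 * pi * (y - of_int m))" by (simp add: d_def algebra_simps)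
    then show ?thesis by (simp only: cos_minus)
  qed (simp add: d_def)
  finally have cd: "cos (2 * pi * y) = cos (2 * pi * d)" .
  have "\<not> cos (2 * pi * y) \<le> cos (pi / real N)"
    using assms(2) by (auto simp: bump_def trunc_cos_def y_def)
  moreover have "2 * pi * d \<le> 2 * pi * (1 / 2)" using d by (intro mult_left_mono) auto
  moreover have "0 \<le> pi / real N" by simp
  ultimately have "2 * pi * d < pi / real N"
    using cos_monotone_0_pi_le[of "pi / real N" "2 * pi * d"] cd by fastforce
  then have "pi * (2 * d) < pi * (1 / real N)" by simp
  then have "2 * d < 1 / real N" using pi_gt_zero by (simp only: mult_less_cancel_left_pos)
  then have "4 * real N * d < 2" using N by (simp add: field_simps)
  moreover have "4 * real N * d = \<bar>4 * real N * (y - of_int m)\<bar>" using N by (simp add: d_def abs_mult)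
  moreover have "4 * real N * (y - of_int m) = 4 * real N * x - real a - 4 * real N * of_int m"
    using N by (simp add: y_def algebra_simps)
  ultimately show ?thesis by auto
qed

lemma continuous_antiderivative:
  fixes f :: "real \<Rightarrow> real"
  assumes "continuous_on UNIV f"
  obtains F where "\<And>x. (F has_real_derivative f x) (at x)"
proof -
  have "isCont f x" for x using assms by (simp add: continuous_on_eq_continuous_at)
  then obtain F where "\<forall>x::real. - \<infinity> < ereal x \<longrightarrow> ereal x < \<infinity> \<longrightarrow> (F has_vector_derivative f x) (at x)"
    using einterval_antiderivative[of "- \<infinity>" \<infinity> f] by auto
  then show ?thesis using that by (auto simp: has_real_derivative_iff_has_vector_derivative)
qed

lemma Lipschitz_of_deriv_bound:
  fixes f :: "real \<Rightarrow> real"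
  assumes "\<And>x. (f has_real_derivative f' x) (at x)" "\<And>x. \<bar>f' x\<bar> \<le> C"
  shows "\<bar>f x - f y\<bar> \<le> C * \<bar>x - y\<bar>"
proof -
  have *: "\<bar>f v - f u\<bar> \<le> C * (v - u)" if uv: "u < v" for u v
  proof -
    obtain z where "f v - f u = (v - u) * f' z" using MVT2[of u v f f'] uv assms(1) by blast
    then show ?thesis using assms(2)[of z] uv by (simp add: abs_mult mult.commute mult_right_mono)
  qed
  then show ?thesis using *[of x y] *[of y x] by (cases x y rule: linorder_cases) (auto simp: abs_minus_commute)
qed

text \<open>A primitive of one bump grows by a fixed amount per period, the integral of the bump.
  Translates share this amount, so it cancels in a difference. \<open>C\<close> does not depend on
  \<open>N\<close>.\<close>

lemma bump_primitive:
  assumes "2 \<le> r"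
  shows "\<exists>C>0. \<forall>N\<ge>1. \<exists>\<phi>.
    (\<forall>a x. bump r N a x \<le> C) \<and>
    (\<forall>a x y. \<bar>bump r N a x - bump r N a y\<bar> \<le> C * \<bar>x - y\<bar>) \<and>
    (\<forall>a<4 * N. \<forall>c<4 * N. periodic1 (\<phi> a c) \<and> Cr_bounded r C (\<phi> a c) \<and>
      (\<forall>x. (\<phi> a c has_real_derivative bump r N a x - bump r N c x) (at x)))"
proof -
  obtain r' where r': "r = Suc (Suc r')" using assms by (metis add_2_eq_Suc le_Suc_ex)
  obtain C0 where C0: "\<And>s. \<bar>s\<bar> \<le> 1 \<Longrightarrow> Cr_bounded (Suc r') C0 (trunc_cos (Suc r) s 0 0)"
    using Cr_bounded_trunc_cos[of "Suc r'" "Suc r" 0 0] r' by auto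
  define C where "C = 2 * \<bar>C0\<bar> + 1"
  have bumpC0: "Cr_bounded (Suc r') C0 (bump r N a)" for N a
    using Cr_bounded_shift[OF C0] unfolding bump_def[abs_def] by simp
  have C0': "0 \<le> C0" "\<And>N a x. bump r N a x \<le> C0"
  proof -
    have *: "\<bar>bump r N a x\<bar> \<le> C0" for N a x using bumpC0[of N a] by (simp add: Cr_bounded_Suc)
    show "0 \<le> C0" using *[of 0 0 0] by linarith
    show "\<And>N a x. bump r N a x \<le> C0" using * abs_le_D1 by blast
  qed
  have lip: "\<bar>bump r N a x - bump r N a y\<bar> \<le> C * \<bar>x - y\<bar>" for N a x y
  proof -
    have "(bump r N a has_real_derivative deriv (bump r N a) x) (at x)" "\<bar>deriv (bump r N a) x\<bar> \<le> C0" for x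
      using bumpC0[of N a] Cr_bounded_Suc[of r' C0 "bump r N a"]
      by (auto simp: DERIV_deriv_iff_real_differentiable Cr_bounded_def[of r'])
    then have "\<bar>bump r N a x - bump r N a y\<bar> \<le> C0 * \<bar>x - y\<bar>" by (rule Lipschitz_of_deriv_bound)
    also have "\<dots> \<le> C * \<bar>x - y\<bar>" by (intro mult_right_mono) (auto simp: C_def)
    finally show ?thesis .
  qed
  have "\<exists>\<phi>. \<forall>a<4 * N. \<forall>c<4 * N. periodic1 (\<phi> a c) \<and> Cr_bounded r C (\<phi> a c) \<and>
      (\<forall>x. (\<phi> a c has_real_derivative bump r N a x - bump r N c x) (at x))" if N: "1 \<le> N" for N
  proof -
    define f where "f = trunc_cos (Suc r) (cos (pi / real N)) 0 0"
    have "Cr_bounded (Suc r') C0 f" unfolding f_def by (intro C0) auto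
    then have f_bound: "\<bar>f x\<bar> \<le> C0" and "Cr (Suc r') f" for x
      by (simp add: Cr_bounded_Suc, simp add: Cr_bounded_def)
    then have "continuous_on UNIV f" using Cr_imp_continuous[of "Suc r'" f 0] by simp
    then obtain F where F: "\<And>x. (F has_real_derivative f x) (at x)" by (rule continuous_antiderivative) blast
    have f_per: "f (x + 1) = f x" for x using bump_periodic[of r N 0 x] by (simp add: bump_def f_def)
    have "((\<lambda>x. F (x + 1) - F x) has_real_derivative 0) (at x)" for x
    proof -
      have "((\<lambda>x. F (x + 1)) has_real_derivative f (x + 1)) (at x)"
        using F[of "x + 1"] DERIV_shift[of F "f (x + 1)" x 1] by simp
      from DERIV_diff[OF this F[of x]] show ?thesis by (simp add: f_per)
    qed
    then have Fconst: "F (x + 1) - F x = F (0 + 1) - F 0" for x by (intro DERIV_isconst_all) auto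
    define \<phi> where "\<phi> a c x = F (x - real a / (4 * real N)) - F (x - real c / (4 * real N))" for a c :: nat and x
    have \<phi>': "(\<phi> a c has_real_derivative bump r N a x - bump r N c x) (at x)" for a c x
    proof -
      have "((\<lambda>x. F (x - real a / (4 * real N))) has_real_derivative bump r N a x) (at x)" for a
      proof -
        have "((\<lambda>x. x - real a / (4 * real N)) has_real_derivative 1) (at x)"
          by (auto intro!: derivative_eq_intros)
        from DERIV_chain2[OF F this] show ?thesis by (simp add: bump_def f_def)
      qed
      then show ?thesis unfolding \<phi>_def[abs_def] by (intro DERIV_diff)
    qed
    have per: "periodic1 (\<phi> a c)" for a c
      unfolding periodic1_def
    proof
      fix x
      show "\<phi> a c (x + 1) = \<phi> a c x"
        using Fconst[of "x - real a / (4 * real N)"] Fconst[of "x - real c / (4 * real N)"]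
        by (simp add: \<phi>_def algebra_simps)
    qed
    \<comment> \<open>Both terms are values of the same primitive at points at most 1 apart, which
      gives a bound free of \<open>N\<close>.\<close>
    have small: "\<bar>\<phi> a c x\<bar> \<le> C" if "a < 4 * N" "c < 4 * N" for a c x
    proof -
      have "\<bar>\<phi> a c x\<bar> \<le> C0 * \<bar>(x - real a / (4 * real N)) - (x - real c / (4 * real N))\<bar>"
        unfolding \<phi>_def by (rule Lipschitz_of_deriv_bound[OF F f_bound])
      also have "\<dots> \<le> C0 * 1"
      proof (intro mult_left_mono C0')
        have "real a / (4 * real N) \<le> 1" "real c / (4 * real N) \<le> 1" using that N by (auto simp: divide_le_eq)
        moreover have "0 \<le> real a / (4 * real N)" "0 \<le> real c / (4 * real N)" by auto
        ultimately show "\<bar>(x - real a / (4 * real N)) - (x - real c / (4 * real N))\<bar> \<le> 1" by linarith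
      qed
      finally show ?thesis by (simp add: C_def)
    qed
    have "Cr_bounded r C (\<phi> a c)" if "a < 4 * N" "c < 4 * N" for a c
      unfolding r'
    proof (rule Cr_bounded_SucI)
      show "Cr_bounded (Suc r') C (\<lambda>x. bump r N a x - bump r N c x)"
      proof (rule Cr_bounded_mono)
        show "Cr_bounded (Suc r') (2 * C0) (\<lambda>x. bump r N a x - bump r N c x)"
          using Cr_bounded_linear[OF bumpC0[of N a] bumpC0[of N c], of 1 "-1"] by simp
      qed (simp add: C_def)
    qed (use \<phi>' small[OF that] in auto)
    then show ?thesis using per \<phi>' by blast
  qed
  note prim = this
  have le: "bump r N a x \<le> C" for N a x using C0'(2)[of N a x] by (simp add: C_def)
  show ?thesis
  proof (intro exI[of _ C] conjI allI impI)
    fix N :: nat assume "1 \<le> N"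
    then obtain \<phi> where "\<forall>a<4 * N. \<forall>c<4 * N. periodic1 (\<phi> a c) \<and> Cr_bounded r C (\<phi> a c) \<and>
      (\<forall>x. (\<phi> a c has_real_derivative bump r N a x - bump r N c x) (at x))" using prim by blast
    then show "\<exists>\<phi>. (\<forall>a x. bump r N a x \<le> C) \<and>
      (\<forall>a x y. \<bar>bump r N a x - bump r N a y\<bar> \<le> C * \<bar>x - y\<bar>) \<and>
      (\<forall>a<4 * N. \<forall>c<4 * N. periodic1 (\<phi> a c) \<and> Cr_bounded r C (\<phi> a c) \<and>
        (\<forall>x. (\<phi> a c has_real_derivative bump r N a x - bump r N c x) (at x)))"
      using lip le by (intro exI[of _ \<phi>] conjI) auto
  qed (simp add: C_def)
qed

section \<open>Choice of the parameters\<close>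

lemma eventually_le_exp_floor:
  fixes \<sigma> c :: real
  assumes "1 < \<sigma>" "0 < c"
  shows "\<forall>\<^sub>F q in sequentially. m\<^sub>1 + m\<^sub>2 * q \<le> nat \<lfloor>\<sigma> ^ q / c\<rfloor>"
proof -
  have s: "norm (1 / \<sigma>) < 1" using assms by simp
  have "(\<lambda>q. c * (real m\<^sub>1 * (1 / \<sigma>) ^ q + real m\<^sub>2 * (real q * (1 / \<sigma>) ^ q))) \<longlonglongrightarrow> c * (real m\<^sub>1 * 0 + real m\<^sub>2 * 0)"
    by (intro tendsto_intros powser_times_n_limit_0 LIMSEQ_power_zero s)
  then have "(\<lambda>q. c * (real m\<^sub>1 * (1 / \<sigma>) ^ q + real m\<^sub>2 * (real q * (1 / \<sigma>) ^ q))) \<longlonglongrightarrow> 0" by simp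
  then have "\<forall>\<^sub>F q in sequentially. c * (real m\<^sub>1 * (1 / \<sigma>) ^ q + real m\<^sub>2 * (real q * (1 / \<sigma>) ^ q)) < 1"
    by (rule order_tendstoD) simp
  then show ?thesis
  proof eventually_elim
    case (elim q)
    have "c * (real m\<^sub>1 * (1 / \<sigma>) ^ q + real m\<^sub>2 * (real q * (1 / \<sigma>) ^ q)) = c * real (m\<^sub>1 + m\<^sub>2 * q) / \<sigma> ^ q"
      by (simp add: power_one_over distrib_left add_divide_distrib)
    then have "c * real (m\<^sub>1 + m\<^sub>2 * q) < \<sigma> ^ q" using elim assms by (simp add: pos_divide_less_eq)
    then have "real (m\<^sub>1 + m\<^sub>2 * q) \<le> \<sigma> ^ q / c" using assms by (simp add: pos_le_divide_eq mult.commute)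
    then show ?case by (rule le_nat_floor)
  qed
qed

context circle_expansion
begin

text \<open>The order of choices matters: \<open>k\<close> beats the exponential number of roots and slopes per
  generation, and \<open>p\<close> is exponentially large in \<open>q\<close>, so that \<open>2 ^ p\<close> absorbs the loss, which is
  only exponential in \<open>q\<close>.\<close>

lemma parameter_choice:
  fixes \<sigma> D\<^sub>1 D\<^sub>2 D\<^sub>3 D\<^sub>4 :: real and s :: nat
  assumes \<sigma>: "1 < \<sigma>" and D: "0 \<le> D\<^sub>1" "0 \<le> D\<^sub>2" "0 \<le> D\<^sub>3" "0 \<le> D\<^sub>4"
  obtains N q p k G J M :: nat where
    "0 < q" "1 \<le> p" "2 * Lam ^ q \<le> real N" "k * p < N" "2 * (real k * real p) \<le> \<sigma> ^ q"
    "real (l ^ q) \<le> \<sigma> ^ p" "Lam ^ p \<le> real G" "D\<^sub>1 * lipK ^ p \<le> real J" "0 < J"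
    "D\<^sub>2 * Lam ^ p + 1 \<le> real M"
    "real (p + 1) * (real J * real (l ^ p)) * real (2 * M + 1) * ((D\<^sub>3 * Lam ^ q * real N ^ s + 1) * D\<^sub>4) ^ k
      < (\<sigma> ^ p / 2) ^ k"
proof -
  \<comment> \<open>The exponential rate of the union bound: \<open>lipK\<close> for the grid of
    base points, \<open>l\<close> for the nodes, \<open>Lam\<close> for the slopes.\<close>
  define H where "H = lipK * real l * Lam"
  \<comment> \<open>One factor 2 covers \<open>p + 1 \<le> 2 ^ p\<close>; the other provides the
    \<open>2 ^ p\<close> that absorbs the loss.\<close>
  obtain k0 where k0: "4 * H < \<sigma> ^ k0" using real_arch_pow[OF \<sigma>] by blast
  define k where "k = Suc k0"
  have H: "0 < H" unfolding H_def using lipK_ge l_ge_2 Lam_gt_1 by simp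
  have k: "4 * H \<le> \<sigma> ^ k"
    using k0 \<sigma> power_increasing[of k0 k \<sigma>] unfolding k_def by linarith
  \<comment> \<open>A common base, since \<open>N\<close> has to dominate both
    \<open>Lam ^ q\<close>, for separation, and \<open>k * p\<close>, which is of order
    \<open>\<sigma> ^ q\<close>.\<close>
  define W where "W = Lam + \<sigma>"
  have W: "1 \<le> W" "Lam \<le> W" "\<sigma> \<le> W" using Lam_gt_1 \<sigma> by (auto simp: W_def)
  define P where "P = (D\<^sub>3 * 3 ^ s + 1) * D\<^sub>4"
  define Q where "Q = W ^ Suc s"
  have P: "0 \<le> P" using D by (simp add: P_def)
  have Q: "1 \<le> Q" unfolding Q_def using W by (intro one_le_power)
  \<comment> \<open>\<open>m\<^sub>1\<close> takes care of the constants, \<open>m\<^sub>2\<close>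
    of the part of the loss exponential in \<open>q\<close>, and \<open>m\<^sub>3\<close> of
    \<open>l ^ q \<le> \<sigma> ^ p\<close>.\<close>
  obtain m\<^sub>1 where m1: "(D\<^sub>1 + 2) * (2 * D\<^sub>2 + 5) * P ^ k * 2 ^ k < 2 ^ m\<^sub>1"
    using real_arch_pow[of 2] by auto
  obtain m\<^sub>2 where m2: "Q ^ k < 2 ^ m\<^sub>2" using real_arch_pow[of 2] by auto
  obtain m\<^sub>3 where m3: "real l < \<sigma> ^ m\<^sub>3" using real_arch_pow[OF \<sigma>] by blast
  have "\<forall>\<^sub>F q in sequentially. Suc m\<^sub>1 + (m\<^sub>2 + m\<^sub>3) * q \<le> nat \<lfloor>\<sigma> ^ q / (2 * real k)\<rfloor> \<and> 0 < q"
    by (intro eventually_conj eventually_le_exp_floor \<sigma> eventually_gt_at_top) (simp add: k_def)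
  then obtain q where q: "Suc m\<^sub>1 + (m\<^sub>2 + m\<^sub>3) * q \<le> nat \<lfloor>\<sigma> ^ q / (2 * real k)\<rfloor>" "0 < q"
    by (metis (mono_tags, lifting) eventually_sequentially order_refl)
  \<comment> \<open>The largest value compatible with
    \<open>2 * (k * p) \<le> \<sigma> ^ q\<close>.\<close>
  define p where "p = nat \<lfloor>\<sigma> ^ q / (2 * real k)\<rfloor>"
  have p: "1 \<le> p" "m\<^sub>1 + m\<^sub>2 * q \<le> p" "m\<^sub>3 * q \<le> p"
    using q unfolding p_def[symmetric] by (auto simp: algebra_simps)
  have "real p \<le> \<sigma> ^ q / (2 * real k)" unfolding p_def using \<sigma> by simp
  then have kp: "2 * (real k * real p) \<le> \<sigma> ^ q" by (simp add: k_def field_simps)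
  have pows: "1 \<le> W ^ q" "Lam ^ q \<le> W ^ q" "\<sigma> ^ q \<le> W ^ q" "1 \<le> lipK ^ p" "1 \<le> Lam ^ p"
    using W Lam_gt_1 \<sigma> lipK_ge by (auto intro!: one_le_power power_mono)
  define N where "N = nat \<lceil>2 * W ^ q\<rceil>"
  have N: "2 * W ^ q \<le> real N" "real N \<le> 3 * W ^ q"
    using pows(1) unfolding N_def by linarith+
  define J where "J = nat \<lceil>D\<^sub>1 * lipK ^ p\<rceil> + 1"
  have D1: "0 \<le> D\<^sub>1 * lipK ^ p" using D pows by simp
  have J: "D\<^sub>1 * lipK ^ p \<le> real J" "real J \<le> (D\<^sub>1 + 2) * lipK ^ p" "0 < J"
    using D1 pows(4) unfolding J_def distrib_right by (simp_all) linarith+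
  define M where "M = nat \<lceil>D\<^sub>2 * Lam ^ p + 1\<rceil>"
  have D2: "0 \<le> D\<^sub>2 * Lam ^ p" using D pows by simp
  have M: "D\<^sub>2 * Lam ^ p + 1 \<le> real M" "real (2 * M + 1) \<le> (2 * D\<^sub>2 + 5) * Lam ^ p"
    using D2 pows(5) unfolding M_def distrib_right by (simp_all) linarith+
  have kpN: "k * p < N"
  proof -
    have "real k * real p < real N" using kp N pows by linarith
    then show ?thesis by (metis of_nat_less_iff of_nat_mult)
  qed
  have lq: "real (l ^ q) \<le> \<sigma> ^ p"
  proof -
    have "real l ^ q \<le> (\<sigma> ^ m\<^sub>3) ^ q" using m3 by (intro power_mono) auto
    also have "\<dots> = \<sigma> ^ (m\<^sub>3 * q)" by (simp add: power_mult)
    also have "\<dots> \<le> \<sigma> ^ p" using \<sigma> p by (intro power_increasing) auto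
    finally show ?thesis by simp
  qed
  obtain G :: nat where G: "Lam ^ p \<le> real G" using real_arch_simple by blast
  have loss: "(D\<^sub>3 * Lam ^ q * real N ^ s + 1) * D\<^sub>4 \<le> P * Q ^ q"
  proof -
    have "D\<^sub>3 * Lam ^ q * real N ^ s \<le> D\<^sub>3 * W ^ q * (3 * W ^ q) ^ s"
      using D N pows Lam_gt_1 W by (intro mult_mono power_mono) auto
    also have "\<dots> = D\<^sub>3 * 3 ^ s * Q ^ q"
      by (simp add: Q_def power_mult_distrib mult.commute mult.left_commute flip: power_mult)
    finally have "D\<^sub>3 * Lam ^ q * real N ^ s + 1 \<le> (D\<^sub>3 * 3 ^ s + 1) * Q ^ q"
      using one_le_power[OF Q, of q] by (simp add: distrib_right)
    then have "(D\<^sub>3 * Lam ^ q * real N ^ s + 1) * D\<^sub>4 \<le> (D\<^sub>3 * 3 ^ s + 1) * Q ^ q * D\<^sub>4"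
      using D by (intro mult_right_mono)
    then show ?thesis by (simp add: P_def mult.commute mult.left_commute)
  qed
  have "real (p + 1) \<le> 2 ^ p"
  proof -
    have "p + 1 \<le> 2 ^ p" using less_exp[of p] by linarith
    then show ?thesis by (metis of_nat_le_iff of_nat_numeral of_nat_power)
  qed
  moreover define X where "X = (D\<^sub>3 * Lam ^ q * real N ^ s + 1) * D\<^sub>4"
  moreover have "0 \<le> X" "X \<le> P * Q ^ q" using D Lam_gt_1 loss by (auto simp: X_def)
  ultimately have "real (p + 1) * (real J * real (l ^ p)) * real (2 * M + 1) * X ^ k
      \<le> 2 ^ p * (((D\<^sub>1 + 2) * lipK ^ p) * real (l ^ p)) * ((2 * D\<^sub>2 + 5) * Lam ^ p) * (P * Q ^ q) ^ k"
    using J M D D1 D2 Lam_gt_1 lipK_ge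
    by (intro mult_mono power_mono) (auto intro!: mult_nonneg_nonneg add_nonneg_nonneg)
  also have "\<dots> = (2 * H) ^ p * ((D\<^sub>1 + 2) * (2 * D\<^sub>2 + 5) * P ^ k * (Q ^ k) ^ q)"
    by (simp add: H_def power_mult_distrib mult.commute mult.left_commute flip: power_mult)
  also have "\<dots> < (2 * H) ^ p * (2 ^ p / 2 ^ k)"
  proof (intro mult_strict_left_mono)
    have "(D\<^sub>1 + 2) * (2 * D\<^sub>2 + 5) * P ^ k * 2 ^ k * (Q ^ k) ^ q < 2 ^ m\<^sub>1 * (Q ^ k) ^ q"
      using m1 Q by (intro mult_strict_right_mono) auto
    also have "\<dots> \<le> 2 ^ m\<^sub>1 * (2 ^ m\<^sub>2) ^ q"
      using m2 Q by (intro mult_left_mono power_mono) auto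
    also have "\<dots> = 2 ^ (m\<^sub>1 + m\<^sub>2 * q)" by (simp add: power_add power_mult)
    also have "\<dots> \<le> (2::real) ^ p" using p by (intro power_increasing) auto
    finally show "(D\<^sub>1 + 2) * (2 * D\<^sub>2 + 5) * P ^ k * (Q ^ k) ^ q < 2 ^ p / 2 ^ k"
      by (simp add: pos_less_divide_eq mult.commute mult.left_commute)
  qed (use H in simp)
  also have "\<dots> = (4 * H) ^ p / 2 ^ k"
  proof -
    have "(2 * H) ^ p * 2 ^ p = (2 * H * 2) ^ p" by (rule power_mult_distrib[symmetric])
    then show ?thesis by (simp add: mult.commute)
  qed
  also have "\<dots> \<le> (\<sigma> ^ k) ^ p / 2 ^ k"
    using k H by (intro divide_right_mono power_mono) auto
  also have "\<dots> = (\<sigma> ^ p / 2) ^ k"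
    by (simp add: power_divide power_commutes mult.commute[of p k] flip: power_mult)
  finally show ?thesis
    using that[of q p N k G J M] q p N pows J M kp kpN lq G unfolding X_def by linarith
qed

end

lemma expanding_circle_expansion:
  assumes "2 \<le> r" "2 \<le> l" "expanding r E l lam Lam"
  obtains L where "circle_expansion E (deriv E) l lam Lam L"
proof -
  obtain r' where r': "r = Suc (Suc r')" using assms(1) by (metis add_2_eq_Suc le_Suc_ex)
  have E: "Cr r E" "\<And>x. E (x + 1) = E x + real l" "1 < lam"
    "\<And>x. lam \<le> deriv E x" "\<And>x. deriv E x \<le> Lam"
    using assms(3) by (auto simp: expanding_def)
  have diff: "(E has_real_derivative deriv E x) (at x)" for x
    using E(1) r' by (simp add: Cr_Suc DERIV_deriv_iff_real_differentiable)
  have per: "deriv E (x + 1) = deriv E x" for x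
  proof -
    have "((\<lambda>x. E (x + 1)) has_real_derivative deriv E (x + 1)) (at x)"
      using diff[of "x + 1"] DERIV_shift[of E _ x 1] by simp
    moreover have "((\<lambda>x. E (x + 1)) has_real_derivative deriv E x) (at x)"
      unfolding E(2) using diff[of x] by (auto intro!: derivative_eq_intros)
    ultimately show ?thesis by (rule DERIV_unique)
  qed
  then have S: "deriv E \<in> CrS1 (Suc r')" using E(1) r' by (simp add: CrS1_def periodic1_def Cr_Suc)
  have "(deriv E has_real_derivative deriv (deriv E) x) (at x)" for x
    using E(1) r' by (simp add: Cr_Suc DERIV_deriv_iff_real_differentiable)
  moreover have "\<bar>deriv (deriv E) x\<bar> \<le> Cr_norm (Suc r') (deriv E)" for x
    using iterated_deriv_le_Cr_norm[OF S, of 1] by simp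
  ultimately have "\<bar>deriv E x - deriv E y\<bar> \<le> Cr_norm (Suc r') (deriv E) * \<bar>x - y\<bar>" for x y
    by (rule Lipschitz_of_deriv_bound)
  then show ?thesis
    using that diff per E assms(2) unfolding circle_expansion_def by blast
qed

section \<open>From cones to slopes\<close>

locale circle_cocycle = circle_expansion E "deriv E" l lam Lam L
  for E :: "real \<Rightarrow> real" and l :: nat and lam Lam L :: real +
  fixes r :: nat
  assumes r_ge_2: "2 \<le> r"
begin

lemma frac_frac_add: "frac (frac a + b) = frac (a + b :: real)"
proof -
  have "frac a + b = (a + b) + of_int (- \<lfloor>a\<rfloor>)" by (simp add: frac_def)
  then show ?thesis by (simp only: frac_add_of_int')
qed

lemma periodic1_frac: "periodic1 g \<Longrightarrow> g (frac x) = g x"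
  unfolding frac_conv_int periodic1_def by (rule periodic_of_int) simp

lemma deriv_periodic1: "periodic1 \<tau> \<Longrightarrow> deriv \<tau> (x + 1) = deriv \<tau> x"
  using periodic1_iterated_deriv[of \<tau> 1] by (simp add: periodic1_def)

lemma fst_skew_iter: "z \<in> torus \<Longrightarrow> fst ((skew E \<tau> ^^ n) z) = frac ((E ^^ n) (fst z))"
proof (induction n)
  case 0
  then show ?case by (auto simp: torus_def frac_eq)
next
  case (Suc n)
  then show ?case using frac_iter_frac[of 1 "(E ^^ n) (fst z)"] by (simp add: skew_def)
qed

lemma snd_skew_iter:
  assumes "periodic1 \<tau>" "z \<in> torus"
  shows "snd ((skew E \<tau> ^^ n) z) = frac (snd z + (\<Sum>j<n. \<tau> ((E ^^ j) (fst z))))"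
proof (induction n)
  case 0
  then show ?case using assms by (auto simp: torus_def frac_eq)
next
  case (Suc n)
  have "snd ((skew E \<tau> ^^ Suc n) z)
      = frac (frac (snd z + (\<Sum>j<n. \<tau> ((E ^^ j) (fst z)))) + \<tau> (frac ((E ^^ n) (fst z))))"
    using fst_skew_iter[OF assms(2), of n \<tau>] Suc by (simp add: skew_def[of _ _ "(skew E \<tau> ^^ n) z"])
  then show ?case by (simp add: frac_frac_add periodic1_frac[OF assms(1)] add.assoc)
qed

lemma Dskew_pow_eq:
  assumes "periodic1 \<tau>"
  shows "Dskew_pow E \<tau> n z
    = vector [vector [jac n (fst z), 0], vector [twist (deriv \<tau>) n (fst z), 1]]"
proof (induction n arbitrary: z)
  case 0
  show ?case by (simp add: vec_eq_iff forall_2 mat_def)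
next
  case (Suc n)
  have j: "jac n (frac (E (fst z))) = jac n (E (fst z))" by (rule jac_frac)
  have t: "twist (deriv \<tau>) n (frac (E (fst z))) = twist (deriv \<tau>) n (E (fst z))"
    by (rule twist_frac) (rule deriv_periodic1[OF assms])
  show ?case
    by (simp add: Suc skew_def Dskew_def j t vec_eq_iff forall_2 matrix_matrix_mult_def sum_2 jac_Suc twist_Suc)
qed

lemma Dskew_pow_mult:
  assumes "periodic1 \<tau>"
  shows "(Dskew_pow E \<tau> n z *v w) $ 1 = jac n (fst z) * w $ 1"
    and "(Dskew_pow E \<tau> n z *v w) $ 2 = twist (deriv \<tau>) n (fst z) * w $ 1 + w $ 2"
  by (simp_all add: Dskew_pow_eq[OF assms] matrix_vector_mult_def sum_2)

definition cone_fibre :: "(real \<Rightarrow> real) \<Rightarrow> real \<Rightarrow> nat \<Rightarrow> real \<times> real \<Rightarrow> real ^ 2 \<Rightarrow> (real \<times> real) set" where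
  "cone_fibre \<tau> R n z v = {\<zeta>\<in>torus. (skew E \<tau> ^^ n) \<zeta> = z \<and>
     v \<in> (\<lambda>w. Dskew_pow E \<tau> n \<zeta> *v w) ` cone lam R}"

text \<open>The skew product acts on the second coordinate by rotations, so the image point and the
  first coordinate determine the second.\<close>

lemma cone_fibre_inj:
  assumes "periodic1 \<tau>"
  shows "inj_on fst (cone_fibre \<tau> R n z v)"
proof (rule inj_onI)
  fix a b assume ab: "a \<in> cone_fibre \<tau> R n z v" "b \<in> cone_fibre \<tau> R n z v" "fst a = fst b"
  then have t: "a \<in> torus" "b \<in> torus" "snd ((skew E \<tau> ^^ n) a) = snd ((skew E \<tau> ^^ n) b)"
    by (auto simp: cone_fibre_def)
  then have "frac (snd a + (\<Sum>j<n. \<tau> ((E ^^ j) (fst a)))) = frac (snd b + (\<Sum>j<n. \<tau> ((E ^^ j) (fst a))))"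
    using ab(3) by (simp add: snd_skew_iter[OF assms])
  then obtain m :: int where "snd a = snd b + of_int m" by (rule frac_eqE) auto
  then have "frac (snd a) = frac (snd b)" by (simp add: frac_add_of_int')
  then have "snd a = snd b" using t by (auto simp: torus_def frac_eq[THEN iffD2])
  then show "a = b" using ab(3) by (simp add: prod_eq_iff)
qed

lemma cone_fibre_subset:
  assumes "periodic1 \<tau>" "norm v = 1"
  shows "fst ` cone_fibre \<tau> R n z v \<subseteq> surv (deriv \<tau>) (R / (lam - 1)) n (fst z) (v $ 2 / v $ 1)"
proof (intro image_subsetI)
  fix \<zeta> assume \<zeta>: "\<zeta> \<in> cone_fibre \<tau> R n z v"
  then have t: "\<zeta> \<in> torus" "fst ((skew E \<tau> ^^ n) \<zeta>) = fst z" by (auto simp: cone_fibre_def)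
  then have mem: "fst \<zeta> \<in> preim n (fst z)"
    using fst_skew_iter[OF t(1), of n \<tau>] by (auto simp: preim_def torus_def)
  define D where "D = jac n (fst \<zeta>)"
  define T where "T = twist (deriv \<tau>) n (fst \<zeta>)"
  obtain w where w: "w \<in> cone lam R" "v = Dskew_pow E \<tau> n \<zeta> *v w" using \<zeta> by (auto simp: cone_fibre_def)
  have v: "v $ 1 = D * w $ 1" "v $ 2 = T * w $ 1 + w $ 2"
    unfolding w(2) D_def T_def by (rule Dskew_pow_mult[OF assms(1)])+
  have c: "\<bar>w $ 2\<bar> \<le> R / (lam - 1) * \<bar>w $ 1\<bar>" using w(1) by (simp add: cone_def)
  have D: "0 < D" by (simp add: D_def jac_pos)
  \<comment> \<open>A cone vector with vanishing first coordinate is zero. Thus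
    \<open>v $ 2 / v $ 1\<close> is a genuine slope whenever the fibre is nonempty, and division by
    zero does not interfere.\<close>
  have "w $ 1 \<noteq> 0"
  proof
    assume "w $ 1 = 0"
    then have "v $ 1 = 0" "v $ 2 = 0" using v c by auto
    then have "v = 0" by (simp add: vec_eq_iff forall_2)
    then show False using assms(2) by simp
  qed
  then have "v $ 2 / v $ 1 * D - T = w $ 2 / w $ 1" using v D by (simp add: field_simps)
  then have "\<bar>v $ 2 / v $ 1 * D - T\<bar> \<le> R / (lam - 1)"
    using c \<open>w $ 1 \<noteq> 0\<close> by (simp add: abs_divide pos_divide_le_eq)
  then show "fst \<zeta> \<in> surv (deriv \<tau>) (R / (lam - 1)) n (fst z) (v $ 2 / v $ 1)"
    using mem by (simp add: surv_def D_def T_def)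
qed

lemma card_cone_fibre_le:
  assumes "periodic1 \<tau>" "norm v = 1"
  shows "card (cone_fibre \<tau> R n z v) \<le> card (surv (deriv \<tau>) (R / (lam - 1)) n (fst z) (v $ 2 / v $ 1))"
  by (rule card_inj_on_le[OF cone_fibre_inj[OF assms(1)] cone_fibre_subset[OF assms] finite_surv])

lemma NR_eq: "NR E lam \<tau> R n = (SUP z\<in>torus. SUP v\<in>{v. norm v = 1}. card (cone_fibre \<tau> R n z v))"
  by (simp add: NR_def cone_fibre_def)

lemma unit_vector_exists: "{v :: real ^ 2. norm v = 1} \<noteq> {}"
  using norm_axis_1[of 1] by blast

lemma torus_nonempty: "torus \<noteq> {}"
  by (auto simp: torus_def)

text \<open>A strict bound survives the supremum because the counts are integers: all of them are at
  most \<open>K\<close>, which is still below \<open>a\<close>.\<close>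

lemma NR_less:
  assumes "periodic1 \<tau>"
    and less: "\<And>x v. 0 \<le> x \<Longrightarrow> x < 1 \<Longrightarrow> real (card (surv (deriv \<tau>) (R / (lam - 1)) n x v)) < a"
  shows "real (NR E lam \<tau> R n) < a"
proof -
  define K where "K = nat (\<lceil>a\<rceil> - 1)"
  have a: "0 < a" using less[of 0 0] by (simp add: order.strict_trans1[OF of_nat_0_le_iff])
  have "card (cone_fibre \<tau> R n z v) \<le> K" if "z \<in> torus" "norm v = 1" for z v
  proof -
    have "real (card (cone_fibre \<tau> R n z v)) < a"
      using card_cone_fibre_le[OF assms(1) that(2), of R n z] less[of "fst z" "v $ 2 / v $ 1"] that(1)
      by (auto simp: torus_def intro: order.strict_trans1[OF of_nat_mono])
    then show ?thesis unfolding K_def by linarith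
  qed
  then have "NR E lam \<tau> R n \<le> K"
    unfolding NR_eq using unit_vector_exists torus_nonempty by (intro cSUP_least) auto
  moreover have "real K < a" using a unfolding K_def by linarith
  ultimately show ?thesis by linarith
qed

text \<open>The bound \<open>l ^ n\<close> makes both suprema genuine; the normalised image of a
  horizontal vector at the origin then witnesses a nonempty fibre.\<close>

lemma NR_ge_1:
  assumes "periodic1 \<tau>" "0 \<le> R"
  shows "1 \<le> NR E lam \<tau> R n"
proof -
  have card: "card (cone_fibre \<tau> R n z v) \<le> l ^ n" if "norm v = 1" for z v
    using card_cone_fibre_le[OF assms(1) that] card_surv order_trans by blast
  then have bdd1: "bdd_above ((\<lambda>v. card (cone_fibre \<tau> R n z v)) ` {v. norm v = 1})" for z
    by (intro bdd_aboveI2[where M = "l ^ n"]) auto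
  have "(SUP v\<in>{v. norm v = 1}. card (cone_fibre \<tau> R n z v)) \<le> l ^ n" for z
    using unit_vector_exists card by (intro cSUP_least) auto
  then have bdd2: "bdd_above ((\<lambda>z. SUP v\<in>{v. norm v = 1}. card (cone_fibre \<tau> R n z v)) ` torus)"
    by (intro bdd_aboveI2[where M = "l ^ n"]) auto
  define z where "z = (skew E \<tau> ^^ n) (0, 0)"
  have zero: "(0, 0) \<in> torus" by (simp add: torus_def)
  have z: "z \<in> torus"
    using fst_skew_iter[OF zero, of n \<tau>] snd_skew_iter[OF assms(1) zero, of n]
    by (simp add: z_def torus_def mem_Times_iff frac_lt_1)
  define u where "u = Dskew_pow E \<tau> n (0, 0) *v axis 1 1"
  have u0: "u \<noteq> 0"
  proof
    assume "u = 0"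
    then have "u $ 1 = 0" by simp
    moreover have "u $ 1 = jac n 0" unfolding u_def by (simp add: Dskew_pow_mult[OF assms(1)])
    ultimately show False using jac_pos[of n 0] by simp
  qed
  define v where "v = u /\<^sub>R norm u"
  have v: "norm v = 1" using u0 by (simp add: v_def)
  have "(1 / norm u) *\<^sub>R axis 1 1 \<in> cone lam R"
    using assms(2) lam_gt_1 by (simp add: cone_def axis_def)
  moreover have "v = Dskew_pow E \<tau> n (0, 0) *v ((1 / norm u) *\<^sub>R axis 1 1)"
    by (simp add: v_def u_def matrix_vector_mult_scaleR divide_inverse)
  ultimately have "(0, 0) \<in> cone_fibre \<tau> R n z v"
    using zero by (auto simp: cone_fibre_def z_def)
  moreover have "finite (cone_fibre \<tau> R n z v)"
    using finite_subset[OF cone_fibre_subset[OF assms(1) v] finite_surv]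
    by (rule finite_imageD) (rule cone_fibre_inj[OF assms(1)])
  ultimately have "1 \<le> card (cone_fibre \<tau> R n z v)"
    by (metis card_0_eq empty_iff less_one not_le)
  also have "\<dots> \<le> (SUP v\<in>{v. norm v = 1}. card (cone_fibre \<tau> R n z v))"
    using v by (intro cSUP_upper bdd1) auto
  also have "\<dots> \<le> NR E lam \<tau> R n" unfolding NR_eq by (intro cSUP_upper bdd2 z)
  finally show ?thesis .
qed

section \<open>Open and dense sets of functions\<close>

text \<open>\<open>Ncap\<close> uses the cone with \<open>R\<close> equal to
  \<open>sup_norm_deriv \<tau> + 1\<close>. Asking for a strictly wider cone leaves the room that
  makes the condition open, and a single \<open>n\<close> suffices since \<open>Ncap\<close> is an
  infimum.\<close>

definition slopes_split :: "real \<Rightarrow> (real \<Rightarrow> real) set" where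
  "slopes_split \<rho> = {\<tau> \<in> CrS1 r. \<exists>n\<ge>1. \<exists>R>sup_norm_deriv \<tau> + 1. \<forall>x v. 0 \<le> x \<longrightarrow> x < 1 \<longrightarrow>
     real (card (surv (deriv \<tau>) (R / (lam - 1)) n x v)) < \<rho> ^ n}"

lemma abs_deriv_le_sup_norm: "\<tau> \<in> CrS1 r \<Longrightarrow> \<bar>deriv \<tau> x\<bar> \<le> sup_norm_deriv \<tau>"
  unfolding sup_norm_deriv_def using CrS1_bdd_above[of \<tau> r 1] r_ge_2
  by (intro cSUP_upper) auto

lemma sup_norm_deriv_nonneg: "\<tau> \<in> CrS1 r \<Longrightarrow> 0 \<le> sup_norm_deriv \<tau>"
  using abs_deriv_le_sup_norm[of \<tau> 0] by linarith

lemma surv_mono: "\<theta> \<le> \<theta>' \<Longrightarrow> surv g \<theta> n x v \<subseteq> surv g \<theta>' n x v"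
  by (auto simp: surv_def)

lemma Ncap_less:
  assumes "\<tau> \<in> slopes_split \<rho>" "1 < \<rho>"
  shows "Ncap E lam \<tau> < \<rho>"
proof -
  obtain n R where \<tau>: "\<tau> \<in> CrS1 r" and n: "1 \<le> n" and R: "sup_norm_deriv \<tau> + 1 < R"
    and less: "\<And>x v. 0 \<le> x \<Longrightarrow> x < 1 \<Longrightarrow> real (card (surv (deriv \<tau>) (R / (lam - 1)) n x v)) < \<rho> ^ n"
    using assms(1) by (auto simp: slopes_split_def)
  let ?R = "sup_norm_deriv \<tau> + 1"
  have "real (card (surv (deriv \<tau>) (?R / (lam - 1)) n x v)) < \<rho> ^ n" if "0 \<le> x" "x < 1" for x v
  proof -
    have "surv (deriv \<tau>) (?R / (lam - 1)) n x v \<subseteq> surv (deriv \<tau>) (R / (lam - 1)) n x v"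
      using R lam_gt_1 by (intro surv_mono divide_right_mono) auto
    then have "card (surv (deriv \<tau>) (?R / (lam - 1)) n x v) \<le> card (surv (deriv \<tau>) (R / (lam - 1)) n x v)"
      by (intro card_mono finite_surv)
    then show ?thesis using less[OF that, of v] by linarith
  qed
  then have lt: "real (NR E lam \<tau> ?R n) < \<rho> ^ n"
    using \<tau> by (intro NR_less) (auto simp: CrS1_def)
  have "Ncap E lam \<tau> \<le> real (NR E lam \<tau> ?R n) powr (1 / real n)"
    unfolding Ncap_def using n by (intro cINF_lower bdd_belowI2[where m = 0]) auto
  also have "\<dots> < (\<rho> ^ n) powr (1 / real n)"
    using lt n by (intro powr_less_mono2) auto
  also have "\<dots> = \<rho>"
    using assms(2) n by (simp add: powr_powr flip: powr_realpow)
  finally show ?thesis .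
qed

lemma Ncap_ge_1:
  assumes "\<tau> \<in> CrS1 r"
  shows "1 \<le> Ncap E lam \<tau>"
  unfolding Ncap_def
proof (rule cINF_greatest)
  fix n :: nat
  have "1 \<le> NR E lam \<tau> (sup_norm_deriv \<tau> + 1) n"
    using assms sup_norm_deriv_nonneg[OF assms] by (intro NR_ge_1) (auto simp: CrS1_def)
  then show "1 \<le> real (NR E lam \<tau> (sup_norm_deriv \<tau> + 1) n) powr (1 / real n)"
    by (intro ge_one_powr_ge_zero) auto
qed auto

lemma abs_deriv_diff_le_Cr_dist:
  assumes "f \<in> CrS1 r" "g \<in> CrS1 r"
  shows "\<bar>deriv f x - deriv g x\<bar> \<le> Cr_dist r f g"
proof -
  have "(\<lambda>x. 1 * f x + (-1) * g x) \<in> CrS1 r" using assms by (rule CrS1_linear)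
  then have "\<bar>(deriv ^^ 1) (\<lambda>x. 1 * f x + (-1) * g x) x\<bar> \<le> Cr_norm r (\<lambda>x. 1 * f x + (-1) * g x)"
    using r_ge_2 by (intro iterated_deriv_le_Cr_norm) auto
  moreover have "(deriv ^^ 1) (\<lambda>x. 1 * f x + (-1) * g x) x = 1 * (deriv ^^ 1) f x + (-1) * (deriv ^^ 1) g x"
    using assms r_ge_2 by (subst iterated_deriv_linear[of r]) (auto simp: CrS1_def)
  ultimately show ?thesis by (simp add: Cr_dist_def)
qed

lemma slopes_split_open: "Cr_open r (slopes_split \<rho>)"
  unfolding Cr_open_def
proof (intro conjI ballI)
  show "slopes_split \<rho> \<subseteq> CrS1 r" by (auto simp: slopes_split_def)
next
  fix \<tau> assume "\<tau> \<in> slopes_split \<rho>"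
  then obtain n R where \<tau>: "\<tau> \<in> CrS1 r" and n: "1 \<le> n" and R: "sup_norm_deriv \<tau> + 1 < R"
    and less: "\<And>x v. 0 \<le> x \<Longrightarrow> x < 1 \<Longrightarrow> real (card (surv (deriv \<tau>) (R / (lam - 1)) n x v)) < \<rho> ^ n"
    by (auto simp: slopes_split_def)
  define d where "d = R - sup_norm_deriv \<tau> - 1"
  \<comment> \<open>The slack \<open>d\<close> is shared out: the cone for \<open>h\<close> gives up
    \<open>d / 2\<close>, the sup norm of the derivative moves by at most \<open>d / 4\<close>, and
    the twist by at most \<open>(d / 4) / (lam - 1)\<close>.\<close>
  define e where "e = d / (4 * Lam ^ n)"
  have d: "0 < d" using R by (simp add: d_def)
  have Ln: "1 \<le> Lam ^ n" using Lam_gt_1 by simp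
  have e: "0 < e" "e * Lam ^ n = d / 4" "e \<le> d / 4"
  proof -
    show "0 < e" "e * Lam ^ n = d / 4" using d Lam_gt_1 by (auto simp: e_def)
    then show "e \<le> d / 4" using mult_left_mono[OF Ln, of e] by linarith
  qed
  have "h \<in> slopes_split \<rho>" if h: "h \<in> CrS1 r" "Cr_dist r h \<tau> < e" for h
  proof -
    have diff: "\<bar>deriv h x - deriv \<tau> x\<bar> \<le> e" for x
      using abs_deriv_diff_le_Cr_dist[OF h(1) \<tau>, of x] h(2) by linarith
    have "sup_norm_deriv h \<le> sup_norm_deriv \<tau> + e"
      unfolding sup_norm_deriv_def[of h]
    proof (rule cSUP_least)
      fix x show "\<bar>deriv h x\<bar> \<le> sup_norm_deriv \<tau> + e"
        using diff[of x] abs_deriv_le_sup_norm[OF \<tau>, of x] by linarith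
    qed simp
    then have R': "sup_norm_deriv h + 1 < R - d / 2" using e d unfolding d_def by argo
    have "surv (deriv h) ((R - d / 2) / (lam - 1)) n x v \<subseteq> surv (deriv \<tau>) (R / (lam - 1)) n x v" for x v
    proof
      fix y assume y: "y \<in> surv (deriv h) ((R - d / 2) / (lam - 1)) n x v"
      have "\<bar>twist (\<lambda>x. deriv h x + (-1) * deriv \<tau> x) n y\<bar> \<le> e / (lam - 1) * jac n y"
        using diff by (intro abs_twist_le) simp
      then have "\<bar>twist (deriv h) n y - twist (deriv \<tau>) n y\<bar> \<le> e / (lam - 1) * jac n y"
        unfolding twist_linear by simp
      also have "\<dots> \<le> e / (lam - 1) * Lam ^ n"
        using e lam_gt_1 by (intro mult_left_mono jac_le_power) auto
      also have "\<dots> = (d / 4) / (lam - 1)" by (simp only: times_divide_eq_left e(2))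
      finally have 1: "\<bar>twist (deriv h) n y - twist (deriv \<tau>) n y\<bar> \<le> (d / 4) / (lam - 1)" .
      have "\<bar>v * jac n y - twist (deriv h) n y\<bar> \<le> (R - d / 2) / (lam - 1)"
        using y by (simp add: surv_def)
      then have "\<bar>v * jac n y - twist (deriv \<tau>) n y\<bar> \<le> (R - d / 2) / (lam - 1) + (d / 4) / (lam - 1)"
        using 1 by linarith
      also have "\<dots> \<le> R / (lam - 1)"
        unfolding add_divide_distrib[symmetric] using d lam_gt_1 by (intro divide_right_mono) auto
      finally show "y \<in> surv (deriv \<tau>) (R / (lam - 1)) n x v" using y by (simp add: surv_def)
    qed
    then have "real (card (surv (deriv h) ((R - d / 2) / (lam - 1)) n x v)) < \<rho> ^ n"
      if "0 \<le> x" "x < 1" for x v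
      using less[OF that, of v] card_mono[OF finite_surv] by (smt (verit) of_nat_mono)
    then show ?thesis using h(1) n R' unfolding slopes_split_def by blast
  qed
  then show "\<exists>e>0. \<forall>h\<in>CrS1 r. Cr_dist r h \<tau> < e \<longrightarrow> h \<in> slopes_split \<rho>" using e(1) by blast
qed

end

context bump_family
begin

lemma card_cells: "real (card cells) = 16 * real N' ^ 2"
  by (simp add: cells_def power2_eq_square)

text \<open>Serves three times in the density proof: for the size of the perturbed derivative, for
  its Lipschitz constant, and for the coefficients of the primitive.\<close>

lemma weighted_sum_cells_le:
  assumes "t \<in> params" "0 \<le> c" "\<And>\<pi>. \<pi> \<in> cells \<Longrightarrow> \<bar>f \<pi>\<bar> \<le> c"
  shows "\<bar>\<eta> / real G * (\<Sum>\<pi>\<in>cells. real (t \<pi>) * f \<pi>)\<bar> \<le> 16 * real N' ^ 2 * \<eta> * c"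
proof -
  have "\<bar>\<Sum>\<pi>\<in>cells. real (t \<pi>) * f \<pi>\<bar> \<le> (\<Sum>\<pi>\<in>cells. real G * c)"
  proof (rule order_trans[OF sum_abs], intro sum_mono)
    fix \<pi> assume \<pi>: "\<pi> \<in> cells"
    then have "t \<pi> < G" using assms(1) by (auto simp: params_def)
    then show "\<bar>real (t \<pi>) * f \<pi>\<bar> \<le> real G * c"
      unfolding abs_mult using assms(2) assms(3)[OF \<pi>] by (intro mult_mono) auto
  qed
  then have "\<eta> / real G * \<bar>\<Sum>\<pi>\<in>cells. real (t \<pi>) * f \<pi>\<bar> \<le> \<eta> / real G * (real (card cells) * (real G * c))"
    using \<eta>_pos by (intro mult_left_mono) auto
  also have "\<dots> = 16 * real N' ^ 2 * \<eta> * c" using G_pos by (simp add: card_cells)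
  finally show ?thesis using \<eta>_pos G_pos by (simp add: abs_mult)
qed

end

lemma Cr_bounded_cmult: "Cr_bounded r C f \<Longrightarrow> 0 \<le> a \<Longrightarrow> Cr_bounded r (a * C) (\<lambda>x. a * f x)"
  using Cr_bounded_linear[of r C f 0 "\<lambda>x. 0" a 0] Cr_bounded_0 by simp

context circle_cocycle
begin

lemma slopes_split_dense:
  assumes \<rho>: "1 < \<rho>"
  shows "Cr_dense r (slopes_split \<rho>)"
  unfolding Cr_dense_def
proof (intro conjI ballI allI impI)
  show "slopes_split \<rho> \<subseteq> CrS1 r" by (auto simp: slopes_split_def)
next
  fix \<tau> and e :: real assume \<tau>: "\<tau> \<in> CrS1 r" and "0 < e"
  obtain r' where r': "r = Suc (Suc r')" using r_ge_2 by (metis add_2_eq_Suc le_Suc_ex)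
  define \<sigma> where "\<sigma> = sqrt \<rho>"
  have \<sigma>: "1 < \<sigma>" "\<sigma> ^ (2 * p) = \<rho> ^ p" for p using \<rho> by (simp_all add: \<sigma>_def power_mult)
  obtain C where Cp: "0 < C \<and> (\<forall>N\<ge>1. \<exists>\<phi>. (\<forall>a x. bump r N a x \<le> C) \<and>
      (\<forall>a x y. \<bar>bump r N a x - bump r N a y\<bar> \<le> C * \<bar>x - y\<bar>) \<and>
      (\<forall>a<4 * N. \<forall>c<4 * N. periodic1 (\<phi> a c) \<and> Cr_bounded r C (\<phi> a c) \<and>
        (\<forall>x. (\<phi> a c has_real_derivative bump r N a x - bump r N c x) (at x))))"
    using bump_primitive[OF r_ge_2] by (elim exE)
  then have C: "0 < C" by (rule conjunct1)
  define e' where "e' = min e 1"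
  have e': "0 < e'" "e' \<le> e" "e' \<le> 1" using \<open>0 < e\<close> by (auto simp: e'_def)
  define B0 where "B0 = Cr_norm r \<tau>"
  have d1: "\<bar>deriv \<tau> x\<bar> \<le> B0" and d2: "\<bar>deriv (deriv \<tau>) x\<bar> \<le> B0" for x
    using iterated_deriv_le_Cr_norm[OF \<tau>, of 1 x] iterated_deriv_le_Cr_norm[OF \<tau>, of 2 x] r_ge_2
    by (auto simp: B0_def numeral_2_eq_2)
  have \<tau>': "(\<tau> has_real_derivative deriv \<tau> x) (at x)"
    and \<tau>'': "(deriv \<tau> has_real_derivative deriv (deriv \<tau>) x) (at x)" for x
    using \<tau> by (auto simp: CrS1_def r' Cr_Suc DERIV_deriv_iff_real_differentiable)
  have d1_lip: "\<bar>deriv \<tau> x - deriv \<tau> y\<bar> \<le> B0 * \<bar>x - y\<bar>" for x y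
    by (rule Lipschitz_of_deriv_bound[OF \<tau>'' d2])
  have B0: "0 \<le> B0" using d1[of 0] by linarith
  \<comment> \<open>Valid for all perturbations and fixed before \<open>N\<close> and \<eta>: as
    \<open>e'\<close> is at most 1, the perturbation adds at most 1/2 to the derivative and at most
    1 to its Lipschitz constant.\<close>
  define B where "B = B0 + 1"
  \<comment> \<open>Belongs to the cone with \<open>R = B + 2\<close>, which exceeds
    \<open>sup_norm_deriv h + 1\<close> for every perturbed function \<open>h\<close>.\<close>
  define \<theta> where "\<theta> = (B + 2) / (lam - 1)"
  have B: "0 \<le> B" "0 \<le> B / (lam - 1)" "0 \<le> \<theta>" using B0 lam_gt_1 by (auto simp: B_def \<theta>_def)
  \<comment> \<open>Chosen so that with \<open>\<eta> = 1 / (K * N ^ 2)\<close> the total weight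
    \<open>16 * N ^ 2 * \<eta> * C\<close> is \<open>e' / (2 * (r + 1))\<close>; summing
    \<open>r + 1\<close> derivatives then gives at most \<open>e' / 2\<close>.\<close>
  define K where "K = 32 * real (r + 1) * C / e'"
  have K: "0 < K" using C e' by (simp add: K_def)
  have Lexp: "0 \<le> exp (L / (lam - 1))" by simp
  have D: "0 \<le> \<theta> + B / (lam - 1) + B" "0 \<le> \<theta> + 1 + B / (lam - 1)" "0 \<le> 2 * (\<theta> + 2) * (K * 4 ^ (r + 1))"
    using B K by auto
  obtain N q p k G J M :: nat where
    par: "0 < q" "1 \<le> p" "2 * Lam ^ q \<le> real N" "k * p < N" "2 * (real k * real p) \<le> \<sigma> ^ q"
    "real (l ^ q) \<le> \<sigma> ^ p" "Lam ^ p \<le> real G"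
    and J: "(\<theta> + B / (lam - 1) + B) * lipK ^ p \<le> real J" "0 < J"
    and M: "(\<theta> + 1 + B / (lam - 1)) * Lam ^ p + 1 \<le> real M"
    and small: "real (p + 1) * (real J * real (l ^ p)) * real (2 * M + 1)
        * ((2 * (\<theta> + 2) * (K * 4 ^ (r + 1)) * Lam ^ q * real N ^ (2 * r + 4) + 1) * exp (L / (lam - 1))) ^ k
      < (\<sigma> ^ p / 2) ^ k"
    by (rule parameter_choice[OF \<sigma>(1) D Lexp])
  have N: "1 \<le> N" using par(4) by simp
  obtain \<phi> where all: "(\<forall>a x. bump r N a x \<le> C) \<and>
      (\<forall>a x y. \<bar>bump r N a x - bump r N a y\<bar> \<le> C * \<bar>x - y\<bar>) \<and>
      (\<forall>a<4 * N. \<forall>c<4 * N. periodic1 (\<phi> a c) \<and> Cr_bounded r C (\<phi> a c) \<and>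
        (\<forall>x. (\<phi> a c has_real_derivative bump r N a x - bump r N c x) (at x)))"
    using Cp[THEN conjunct2, rule_format, OF N] by (elim exE)
  then have bump_le: "bump r N a x \<le> C"
    and bump_lip: "\<bar>bump r N a x - bump r N a y\<bar> \<le> C * \<bar>x - y\<bar>" for a x y by simp_all
  have \<phi>: "periodic1 (\<phi> a c)" "Cr_bounded r C (\<phi> a c)"
    "(\<phi> a c has_real_derivative bump r N a x - bump r N c x) (at x)" if "a < 4 * N" "c < 4 * N" for a c x
    using all that by simp_all
  define \<eta> where "\<eta> = 1 / (K * real N ^ 2)"
  define b where "b = (1 / (4 * real N ^ 2)) ^ Suc r"
  have \<eta>: "0 < \<eta>" and b: "0 < b" using K N by (auto simp: \<eta>_def b_def simp del: power_Suc)
  interpret bf: bump_family E "deriv E" l lam Lam L "deriv \<tau>" "bump r N" N q p k G b \<eta> \<theta> \<sigma>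
  proof unfold_locales
    show "deriv \<tau> (x + 1) = deriv \<tau> x" for x using \<tau> by (intro deriv_periodic1) (simp add: CrS1_def)
    show "b \<le> bump r N (nat \<lfloor>4 * real N * w\<rfloor>) w" if "0 \<le> w" "w < 1" for w
      unfolding b_def by (rule bump_core[OF N that])
  qed (use bump_periodic bump_nonneg bump_supp[OF N] \<eta> b B \<sigma> par in auto)
  have total: "16 * real N ^ 2 * \<eta> * C = e' / (2 * real (r + 1))"
  proof -
    have "16 * real N ^ 2 * \<eta> * C = 16 * C / K" using N K by (simp add: \<eta>_def)
    also have "K = 2 * real (r + 1) / e' * (16 * C)" by (simp add: K_def)
    finally show ?thesis using C by simp
  qed
  have total_le: "e' / (2 * real (r + 1)) \<le> 1 / 2"
    using e' by (intro frac_le) auto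
  \<comment> \<open>The exponent \<open>2 * r + 4\<close> collects 2 from \<eta> and
    \<open>2 * (r + 1)\<close> from the height \<open>b\<close>: a loss polynomial in
    \<open>N\<close>, hence exponential only in \<open>q\<close>.\<close>
  have loss: "bf.loss = 2 * (\<theta> + 2) * (K * 4 ^ (r + 1)) * Lam ^ q * real N ^ (2 * r + 4) + 1"
  proof -
    have "1 / (\<eta> * b) = K * real N ^ 2 * (4 * real N ^ 2) ^ Suc r"
      using N K by (simp add: \<eta>_def b_def power_one_over del: power_Suc)
    also have "\<dots> = K * 4 ^ (r + 1) * real N ^ (2 * r + 4)"
      by (simp add: power_mult_distrib power_mult power_add power2_eq_square power4_eq_xxxx)
    finally have *: "1 / (\<eta> * b) = K * 4 ^ (r + 1) * real N ^ (2 * r + 4)" .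
    have "bf.loss = 2 * (\<theta> + 2) * Lam ^ q * (1 / (\<eta> * b)) + 1" by (simp add: bf.loss_def)
    then show ?thesis unfolding * by (simp only: mult_ac)
  qed
  have cells: "fst \<pi> < 4 * N" "snd \<pi> < 4 * N" if "\<pi> \<in> bf.cells" for \<pi>
    using that by (auto simp: bf.cells_def)
  have bound: "\<bar>bf.pert t x\<bar> \<le> B" if t: "t \<in> bf.params" for t x
  proof -
    have "\<bar>\<eta> / real G * (\<Sum>\<pi>\<in>bf.cells. real (t \<pi>) * (bump r N (fst \<pi>) x - bump r N (snd \<pi>) x))\<bar>
        \<le> 16 * real N ^ 2 * \<eta> * C"
    proof (rule bf.weighted_sum_cells_le[OF t])
      show "\<bar>bump r N (fst \<pi>) x - bump r N (snd \<pi>) x\<bar> \<le> C" for \<pi> :: "nat \<times> nat"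
        using bump_le[of "fst \<pi>" x] bump_le[of "snd \<pi>" x] bump_nonneg[of r N "fst \<pi>" x] bump_nonneg[of r N "snd \<pi>" x]
        by linarith
    qed (use C in simp)
    then show ?thesis unfolding bf.pert_def using d1[of x] total total_le B_def by linarith
  qed
  have lip: "\<bar>bf.pert t x - bf.pert t y\<bar> \<le> B * \<bar>x - y\<bar>" if t: "t \<in> bf.params" for t x y
  proof -
    have "\<bar>\<eta> / real G * (\<Sum>\<pi>\<in>bf.cells. real (t \<pi>) * ((bump r N (fst \<pi>) x - bump r N (snd \<pi>) x)
        - (bump r N (fst \<pi>) y - bump r N (snd \<pi>) y)))\<bar> \<le> 16 * real N ^ 2 * \<eta> * (2 * (C * \<bar>x - y\<bar>))"
    proof (rule bf.weighted_sum_cells_le[OF t])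
      show "\<bar>(bump r N (fst \<pi>) x - bump r N (snd \<pi>) x) - (bump r N (fst \<pi>) y - bump r N (snd \<pi>) y)\<bar>
          \<le> 2 * (C * \<bar>x - y\<bar>)" for \<pi> :: "nat \<times> nat"
        using bump_lip[of "fst \<pi>" x y] bump_lip[of "snd \<pi>" x y] by linarith
    qed (use C in simp)
    also have "\<dots> = 2 * (16 * real N ^ 2 * \<eta> * C) * \<bar>x - y\<bar>" by simp
    also have "\<dots> \<le> 1 * \<bar>x - y\<bar>" unfolding total using total_le by (intro mult_right_mono) auto
    finally have "\<bar>\<eta> / real G * (\<Sum>\<pi>\<in>bf.cells. real (t \<pi>) * (bump r N (fst \<pi>) x - bump r N (snd \<pi>) x))
        - \<eta> / real G * (\<Sum>\<pi>\<in>bf.cells. real (t \<pi>) * (bump r N (fst \<pi>) y - bump r N (snd \<pi>) y))\<bar> \<le> \<bar>x - y\<bar>"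
      by (simp add: right_diff_distrib sum_subtractf)
    moreover have "\<bar>(a + u) - (c + v)\<bar> \<le> d + f" if "\<bar>a - c\<bar> \<le> d" "\<bar>u - v\<bar> \<le> f" for a u c v d f :: real
      using that by linarith
    ultimately show ?thesis unfolding bf.pert_def B_def distrib_right mult_1 using d1_lip[of x y] by blast
  qed
  obtain t where t: "t \<in> bf.params"
    and few: "\<And>x v. 0 \<le> x \<Longrightarrow> x < 1 \<Longrightarrow> real (card (surv (bf.pert t) \<theta> p x v)) < \<sigma> ^ (2 * p)"
    using bf.exists_param[OF bound lip J M small[folded loss]] by auto
  define w where "w \<pi> = \<eta> / real G * real (t \<pi>)" for \<pi>
  define \<psi> where "\<psi> x = (\<Sum>\<pi>\<in>bf.cells. w \<pi> * \<phi> (fst \<pi>) (snd \<pi>) x)" for x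
  have w: "0 \<le> w \<pi>" for \<pi> using \<eta> by (simp add: w_def)
  have "Cr_bounded r (\<Sum>\<pi>\<in>bf.cells. w \<pi> * C) \<psi>"
    unfolding \<psi>_def using cells \<phi>(2) w by (intro Cr_bounded_sum bf.finite_cells Cr_bounded_cmult) auto
  moreover have "(\<Sum>\<pi>\<in>bf.cells. w \<pi> * C) \<le> e' / (2 * real (r + 1))"
  proof -
    have "(\<Sum>\<pi>\<in>bf.cells. w \<pi> * C) = \<eta> / real G * (\<Sum>\<pi>\<in>bf.cells. real (t \<pi>) * C)"
      by (simp add: w_def sum_distrib_left mult.assoc)
    also have "\<dots> \<le> 16 * real N ^ 2 * \<eta> * C"
      by (rule order_trans[OF abs_ge_self bf.weighted_sum_cells_le[OF t]]) (use C in auto)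
    finally show ?thesis by (simp only: total)
  qed
  ultimately have \<psi>: "Cr_bounded r (e' / (2 * real (r + 1))) \<psi>" by (rule Cr_bounded_mono)
  then have "Cr_norm r \<psi> \<le> real (r + 1) * (e' / (2 * real (r + 1)))" by (rule Cr_norm_le)
  also have "\<dots> = e' / 2"
  proof -
    have "c * (e' / (2 * c)) = e' / 2" if "c \<noteq> 0" for c :: real using that by simp
    from this[of "real (r + 1)"] show ?thesis by simp
  qed
  also have "\<dots> < e" using e' by simp
  finally have \<psi>_norm: "Cr_norm r \<psi> < e" .
  have \<psi>S: "\<psi> \<in> CrS1 r"
    using \<psi> \<phi>(1) cells by (auto simp: CrS1_def Cr_bounded_def periodic1_def \<psi>_def intro!: sum.cong)
  define h where "h = (\<lambda>x. 1 * \<tau> x + 1 * \<psi> x)"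
  have hS: "h \<in> CrS1 r" unfolding h_def by (rule CrS1_linear[OF \<tau> \<psi>S])
  have "deriv h = bf.pert t"
  proof (rule ext, rule DERIV_imp_deriv)
    fix x
    have "(\<psi> has_real_derivative (\<Sum>\<pi>\<in>bf.cells. w \<pi> * (bump r N (fst \<pi>) x - bump r N (snd \<pi>) x))) (at x)"
      unfolding \<psi>_def using cells \<phi>(3) by (intro DERIV_sum DERIV_cmult) auto
    from DERIV_add[OF \<tau>' this]
    show "(h has_real_derivative bf.pert t x) (at x)"
      by (simp add: h_def bf.pert_def w_def sum_distrib_left mult.assoc)
  qed
  moreover from this have "sup_norm_deriv h \<le> B"
    unfolding sup_norm_deriv_def using bound[OF t] by (intro cSUP_least) auto
  ultimately have "h \<in> slopes_split \<rho>"
    using hS few par(2) unfolding slopes_split_def \<theta>_def \<sigma>(2)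
    by (intro CollectI conjI exI[of _ p] exI[of _ "B + 2"]) simp_all
  moreover have "Cr_dist r h \<tau> < e" using \<psi>_norm by (simp add: Cr_dist_def h_def)
  ultimately show "\<exists>h\<in>slopes_split \<rho>. Cr_dist r h \<tau> < e" by blast
qed

end

theorem theorem1:
  fixes r l :: nat and E :: "real \<Rightarrow> real" and lam Lam :: real
  assumes "r \<ge> 2" and "l \<ge> 2" and "expanding r E l lam Lam"
  shows "(\<forall>\<rho>>1. \<exists>V. Cr_open r V \<and> Cr_dense r V \<and> (\<forall>\<tau>\<in>V. Ncap E lam \<tau> < \<rho>))
       \<and> (\<exists>S. Cr_residual r S \<and> (\<forall>\<tau>\<in>S. Ncap E lam \<tau> = 1))"
proof -
  obtain L where "circle_expansion E (deriv E) l lam Lam L"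
    using expanding_circle_expansion[OF assms] .
  then interpret circle_cocycle E l lam Lam L r
    using assms(1) by (intro circle_cocycle.intro circle_cocycle_axioms.intro)
  define U where "U n = slopes_split (1 + 1 / real (Suc n))" for n
  have U: "Cr_open r (U n)" "Cr_dense r (U n)" for n
    unfolding U_def by (rule slopes_split_open, rule slopes_split_dense) simp
  have "(\<Inter>n. U n) \<subseteq> CrS1 r" by (auto simp: U_def slopes_split_def)
  then have "Cr_residual r (\<Inter>n. U n)" using U unfolding Cr_residual_def by (intro conjI exI[of _ U]) auto
  moreover have "Ncap E lam \<tau> = 1" if \<tau>: "\<tau> \<in> (\<Inter>n. U n)" for \<tau>
  proof (rule antisym)
    show "1 \<le> Ncap E lam \<tau>" using \<tau> by (intro Ncap_ge_1) (auto simp: U_def slopes_split_def)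
    show "Ncap E lam \<tau> \<le> 1"
    proof (rule field_le_epsilon)
      fix e :: real assume "0 < e"
      then obtain n where "1 / real (Suc n) < e" using nat_approx_posE by blast
      moreover have "Ncap E lam \<tau> < 1 + 1 / real (Suc n)"
        using \<tau> by (intro Ncap_less) (auto simp: U_def)
      ultimately show "Ncap E lam \<tau> \<le> 1 + e" by linarith
    qed
  qed
  ultimately show ?thesis using slopes_split_open slopes_split_dense Ncap_less by blast
qed

end
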